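(* Let $B$ be a finite simplicial complex and $\pi:E\to B$ a circle bundle. Assume that $H^2(B;\mathbb{Z})$ has no elements of order two. Assume there exists a simplicial $2$-cocycle $e$ on $B$ taking values in $\{\pm1,\pm2\}$ on the $2$-simplices such that (1) $e$ represents the integer Euler class of the bundle, and (2) there is a simplicial $1$-cochain $a\in C^1(B;\mathbb{Z})$ taking only the values $\pm1$ with $e=\mathcal{G}_a$. Then the circle bundle admits a classical triangulation over the given triangulation of $B$.
   Context: A circle bundle is a principal $S^1$-bundle; its integer Euler class lies in $H^2(B;\mathbb{Z})$. A classical triangulation of $\pi:E\to B$ over the simplicial complex $B$ is a representation of $E$ as a finite simplicial complex such that $\pi$ is simplicial. Simplicial cochains are evaluated on oriented simplices and change sign under odd reorderings; $d$ is the simplicial coboundary, so $da([v_0,v_1,v_2])=a([v_1,v_2])-a([v_0,v_2])+a([v_0,v_1])$. If $a$ takes values $\pm1$ only, then $da$ takes values in $\{\pm1,\pm3\}$. Define $\mathcal{F}:\{\pm1,\pm3\}\to\{\pm1/4\}$ by $\mathcal{F}(3)=\mathcal{F}(-1)=1/4$ and $\mathcal{F}(-3)=\mathcal{F}(1)=-1/4$, applied valuewise to $2$-cochains, and set $\mathcal{G}_a=\mathcal{F}(da)-\tfrac{3}{4}\,da\in C^2(B;\mathbb{Z})$ (an integer cochain with values in $\{\pm1,\pm2\}$). *)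

theory Defs
  imports "HOL-Complex_Analysis.Complex_Analysis"
begin

definition simplicial_complex :: "'v set \<Rightarrow> 'v set set \<Rightarrow> bool" where
  "simplicial_complex V K \<longleftrightarrow> finite V
     \<and> (\<forall>\<sigma>\<in>K. \<sigma> \<noteq> {} \<and> \<sigma> \<subseteq> V)
     \<and> (\<forall>\<sigma>\<in>K. \<forall>\<tau>. \<tau> \<noteq> {} \<and> \<tau> \<subseteq> \<sigma> \<longrightarrow> \<tau> \<in> K)
     \<and> (\<forall>v\<in>V. {v} \<in> K)"

text \<open>Geometric realization in barycentric coordinates (product topology on functions).\<close>
definition geom :: "'v set set \<Rightarrow> ('v \<Rightarrow> real) set" where
  "geom K = {x. (\<forall>v. 0 \<le> x v) \<and> {v. x v \<noteq> 0} \<in> K \<and> sum x {v. x v \<noteq> 0} = 1}"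

definition skel1 :: "'v set set \<Rightarrow> 'v set set" where
  "skel1 K = {\<sigma>\<in>K. card \<sigma> \<le> 2}"

definition faces :: "'v set \<Rightarrow> 'v set set" where
  "faces \<sigma> = {\<tau>. \<tau> \<noteq> {} \<and> \<tau> \<subseteq> \<sigma>}"

definition vtx :: "'v \<Rightarrow> 'v \<Rightarrow> real" where
  "vtx v = (\<lambda>x. if x = v then 1 else 0)"

definition seg :: "('v \<Rightarrow> real) \<Rightarrow> ('v \<Rightarrow> real) \<Rightarrow> real \<Rightarrow> 'v \<Rightarrow> real" where
  "seg p q t = (\<lambda>x. (1 - t) * p x + t * q x)"

definition bdry :: "'v \<Rightarrow> 'v \<Rightarrow> 'v \<Rightarrow> real \<Rightarrow> 'v \<Rightarrow> real" where
  "bdry u v w t = (if t \<le> 1/3 then seg (vtx u) (vtx v) (3 * t)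
                   else if t \<le> 2/3 then seg (vtx v) (vtx w) (3 * t - 1)
                   else seg (vtx w) (vtx u) (3 * t - 2))"

definition alt1 :: "'v set set \<Rightarrow> ('v \<Rightarrow> 'v \<Rightarrow> 'a::ab_group_add) \<Rightarrow> bool" where
  "alt1 K b \<longleftrightarrow> (\<forall>u v. {u, v} \<in> K \<and> u \<noteq> v \<longrightarrow> b v u = - b u v)"

definition alt2 :: "'v set set \<Rightarrow> ('v \<Rightarrow> 'v \<Rightarrow> 'v \<Rightarrow> 'a::ab_group_add) \<Rightarrow> bool" where
  "alt2 K c \<longleftrightarrow> (\<forall>u v w. {u, v, w} \<in> K \<and> distinct [u, v, w] \<longrightarrow>
      c v u w = - c u v w \<and> c u w v = - c u v w)"

definition cobd1 :: "('v \<Rightarrow> 'v \<Rightarrow> 'a::ab_group_add) \<Rightarrow> 'v \<Rightarrow> 'v \<Rightarrow> 'v \<Rightarrow> 'a" where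
  "cobd1 b u v w = b v w - b u w + b u v"

definition cobd2 :: "('v \<Rightarrow> 'v \<Rightarrow> 'v \<Rightarrow> 'a::ab_group_add) \<Rightarrow> 'v \<Rightarrow> 'v \<Rightarrow> 'v \<Rightarrow> 'v \<Rightarrow> 'a" where
  "cobd2 c v0 v1 v2 v3 = c v1 v2 v3 - c v0 v2 v3 + c v0 v1 v3 - c v0 v1 v2"

definition cocycle2 :: "'v set set \<Rightarrow> ('v \<Rightarrow> 'v \<Rightarrow> 'v \<Rightarrow> int) \<Rightarrow> bool" where
  "cocycle2 K c \<longleftrightarrow> alt2 K c \<and>
     (\<forall>v0 v1 v2 v3. {v0, v1, v2, v3} \<in> K \<and> distinct [v0, v1, v2, v3] \<longrightarrow> cobd2 c v0 v1 v2 v3 = 0)"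

definition coboundary2 :: "'v set set \<Rightarrow> ('v \<Rightarrow> 'v \<Rightarrow> 'v \<Rightarrow> int) \<Rightarrow> bool" where
  "coboundary2 K c \<longleftrightarrow> (\<exists>b. alt1 K b \<and>
     (\<forall>u v w. {u, v, w} \<in> K \<and> distinct [u, v, w] \<longrightarrow> c u v w = cobd1 b u v w))"

definition no_2torsion_H2 :: "'v set set \<Rightarrow> bool" where
  "no_2torsion_H2 K \<longleftrightarrow> (\<forall>c. cocycle2 K c \<and> coboundary2 K (\<lambda>u v w. 2 * c u v w)
      \<longrightarrow> coboundary2 K c)"

definition FF :: "int \<Rightarrow> real" where
  "FF x = (if x = 3 \<or> x = -1 then 1/4 else if x = -3 \<or> x = 1 then -1/4 else 0)"

definition GG :: "('v \<Rightarrow> 'v \<Rightarrow> int) \<Rightarrow> 'v \<Rightarrow> 'v \<Rightarrow> 'v \<Rightarrow> real" where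
  "GG a u v w = FF (cobd1 a u v w) - 3/4 * of_int (cobd1 a u v w)"

definition local_triv ::
  "'e topology \<Rightarrow> ('e \<Rightarrow> 'b::topological_space) \<Rightarrow> (complex \<Rightarrow> 'e \<Rightarrow> 'e) \<Rightarrow> 'b set
     \<Rightarrow> ('e \<Rightarrow> 'b \<times> complex) \<Rightarrow> bool" where
  "local_triv E p act U \<phi> \<longleftrightarrow>
     homeomorphic_map (subtopology E {x \<in> topspace E. p x \<in> U})
                      (prod_topology (top_of_set U) (top_of_set (sphere 0 1))) \<phi>
   \<and> (\<forall>x\<in>topspace E. p x \<in> U \<longrightarrow> fst (\<phi> x) = p x \<and>
        (\<forall>z\<in>sphere 0 1. \<phi> (act z x) = (p x, z * snd (\<phi> x))))"

definition circle_bundle ::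
  "'e topology \<Rightarrow> ('e \<Rightarrow> 'b::topological_space) \<Rightarrow> (complex \<Rightarrow> 'e \<Rightarrow> 'e) \<Rightarrow> 'b set \<Rightarrow> bool" where
  "circle_bundle E p act X \<longleftrightarrow>
     continuous_map E (top_of_set X) p \<and> p ` topspace E = X
   \<and> continuous_map (prod_topology (top_of_set (sphere 0 1)) E) E (\<lambda>(z, x). act z x)
   \<and> (\<forall>x\<in>topspace E. act 1 x = x \<and> (\<forall>z\<in>sphere 0 1. act z x \<in> topspace E \<and> p (act z x) = p x
        \<and> (\<forall>w\<in>sphere 0 1. act z (act w x) = act (z * w) x)))
   \<and> (\<forall>y\<in>X. \<exists>U. openin (top_of_set X) U \<and> y \<in> U \<and> (\<exists>\<phi>. local_triv E p act U \<phi>))"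

text \<open>The integer 2-cochain e represents the Euler class: it is cohomologous to the
  obstruction cocycle of some section over the 1-skeleton, whose value on an oriented
  2-simplex [u,v,w] is the winding number of the section along the boundary loop,
  read in any equivariant trivialization over the closed simplex.\<close>
definition represents_euler ::
  "'v set set \<Rightarrow> 'e topology \<Rightarrow> ('e \<Rightarrow> 'v \<Rightarrow> real) \<Rightarrow> (complex \<Rightarrow> 'e \<Rightarrow> 'e)
     \<Rightarrow> ('v \<Rightarrow> 'v \<Rightarrow> 'v \<Rightarrow> int) \<Rightarrow> bool" where
  "represents_euler K E p act e \<longleftrightarrow>
    (\<exists>s b. continuous_map (top_of_set (geom (skel1 K))) E s
       \<and> (\<forall>x\<in>geom (skel1 K). p (s x) = x)
       \<and> alt1 K b
       \<and> (\<forall>u v w. {u, v, w} \<in> K \<and> distinct [u, v, w] \<longrightarrow>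
            (\<forall>\<phi>. local_triv E p act (geom (faces {u, v, w})) \<phi> \<longrightarrow>
               complex_of_int (e u v w - cobd1 b u v w)
                 = winding_number (\<lambda>t. snd (\<phi> (s (bdry u v w t)))) 0)))"

definition classical_triangulation ::
  "'v set set \<Rightarrow> 'e topology \<Rightarrow> ('e \<Rightarrow> 'v \<Rightarrow> real) \<Rightarrow> bool" where
  "classical_triangulation K E p \<longleftrightarrow>
    (\<exists>(W::nat set) L h f. simplicial_complex W L
       \<and> homeomorphic_map (top_of_set (geom L)) E h
       \<and> (\<forall>\<sigma>\<in>L. f ` \<sigma> \<in> K)
       \<and> (\<forall>x\<in>geom L. p (h x) = (\<lambda>v. \<Sum>w\<in>{w\<in>W. f w = v}. x w)))"

end

theory Submission
  imports Defs
begin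

text \<open>
  Put \<open>\<epsilon> = 4 e + 3 da = 4 \<F>(da)\<close>. Its values are \<open>\<plusminus>1\<close>, and the cocycle condition for \<open>e\<close> is Huntington's
  transitivity axiom, so \<open>\<epsilon>\<close> is a coherent family of cyclic orders on the simplices. Over a point \<open>x\<close>
  of the base we view the fibre as \<open>\<real>/4\<int>\<close> with a mark \<open>m\<^sub>v\<close> for every vertex \<open>v\<close> of the carrier of \<open>x\<close>, where
  \<open>m\<^sub>v - m\<^sub>u = a(u,v) + (\<Sum>\<^sub>z \<epsilon>(u,v,z) x\<^sub>z)\<close>. The arcs of radius \<open>x\<^sub>v\<close> around \<open>m\<^sub>v\<close> and \<open>m\<^sub>v + 2\<close> tile the circle
  in the cyclic order given by \<open>\<epsilon>\<close>; bisecting them yields a fibrewise subdivision with four vertices over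
  every \<open>v\<close>, which is a simplicial complex mapping simplicially to the base.

  The differences of marks add up to \<open>da + \<epsilon> = 4 (e + da)\<close> around a triangle. As \<open>e\<close> represents the Euler
  class, the transition angles between trivialisations over the closed stars can be lifted to real functions
  whose Cech coboundary cancels this, so that the marks can be realised in the given bundle by averaging
  with the barycentric coordinates.
\<close>

section \<open>Coordinates on one fibre\<close>

text \<open>The circumference is 4 because every vertex owns two arcs of length
  \<open>2 * x v\<close> and the barycentric coordinates add up to 1. The same count explains the
  formula for the marks: for signs \<open>eps\<close>, the number 1 plus the sum of
  \<open>eps u v z * x z\<close> over the remaining \<open>z\<close> equals \<open>x u + x v\<close>
  plus twice the sum of those \<open>x z\<close> with \<open>eps u v z = 1\<close>. This is the
  distance between the centres of an arc of \<open>u\<close> and an arc of \<open>v\<close> if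
  exactly these \<open>z\<close> have an arc in between. As each arc has an antipodal copy,
  replacing 1 by -1 only changes which copy is met, and \<open>a\<close> records this. The cyclic
  order of the arcs is never written down. The simplices are the nonempty subsets of the coordinate
  supports that occur over points of the bundle; to be shown is that the coordinates separate the
  points of a fibre and that each such simplex is filled. The topology of \<open>E\<close> is known
  only through its charts, so continuity of inverses and of functions on the base is drawn from
  compactness of \<open>E\<close> and the Hausdorff property of the target.\<close>

definition qcis :: "real \<Rightarrow> complex" where
  "qcis r = cis (pi / 2 * r)"

definition unit_sign :: "bool \<Rightarrow> complex" where
  "unit_sign b = (if b then 1 else - 1)"

text \<open>Here \<open>q\<close> is the position in the fibre relative to the mark of a vertex \<open>v\<close>, and \<open>x\<close> the barycentric
  coordinate of \<open>v\<close>. Index \<open>(True, s)\<close> is the vertex at the centre of an arc of \<open>v\<close>, index \<open>(False, s)\<close>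
  the one sitting in the gap that follows it; \<open>s\<close> distinguishes antipodal copies.\<close>

definition weight :: "bool \<times> bool \<Rightarrow> complex \<Rightarrow> real \<Rightarrow> real" where
  "weight i q x = (if fst i then max 0 (x - 2 / pi * arccos (Re (unit_sign (snd i) * q)))
               else min x (max 0 (2 / pi * arcsin (Im (unit_sign (snd i) * q)))))"

section \<open>Arithmetic on a circle of circumference four\<close>

lemma qcis_0 [simp]: "qcis 0 = 1" and norm_qcis [simp]: "norm (qcis r) = 1"
  by (simp_all add: qcis_def)

lemma qcis_add: "qcis (r + t) = qcis r * qcis t"
  by (simp add: qcis_def cis_mult distrib_left)

lemma qcis_minus: "qcis (- r) = inverse (qcis r)"
  by (simp add: qcis_def cis_inverse)

lemma qcis_diff: "qcis (r - t) = qcis r * inverse (qcis t)"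
  using qcis_add[of r "- t"] by (simp add: qcis_minus)

lemma qcis_nonzero [simp]: "qcis r \<noteq> 0"
  by (simp add: qcis_def)

lemma qcis_2 [simp]: "qcis 2 = - 1"
  by (simp add: qcis_def)

lemma qcis_eq_1_iff: "qcis r = 1 \<longleftrightarrow> (\<exists>n::int. r = 4 * n)"
proof -
  have "qcis r = 1 \<longleftrightarrow> exp (\<i> * complex_of_real (pi / 2 * r)) = 1"
    by (simp add: qcis_def cis_conv_exp)
  also have "\<dots> \<longleftrightarrow> (\<exists>n::int. pi / 2 * r = of_int (2 * n) * pi)"
    by (simp add: exp_eq_1)
  also have "\<dots> \<longleftrightarrow> (\<exists>n::int. r = 4 * n)"
    by (simp add: field_simps)
  finally show ?thesis .
qed

lemma unit_sign_simps [simp]: "unit_sign True = 1" "unit_sign False = - 1" "unit_sign (\<not> b) = - unit_sign b"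
  "unit_sign b * unit_sign b = 1" "norm (unit_sign b) = 1" "unit_sign b \<noteq> 0" "unit_sign b * (unit_sign b * c) = c"
  by (auto simp: unit_sign_def)

lemma unit_eq_qcis:
  assumes "norm q = 1"
  obtains r where "q = qcis r" "- 2 < r" "r \<le> 2"
proof
  have "q \<noteq> 0" using assms by auto
  then show "q = qcis (Arg q * 2 / pi)"
    using assms by (simp add: qcis_def cis_Arg sgn_div_norm)
  show "- 2 < Arg q * 2 / pi" "Arg q * 2 / pi \<le> 2"
    using Arg_bounded[of q] by (auto simp: field_simps)
qed

text \<open>Measured in quarter turns, \<open>arccos\<close> of the real part is the distance of a
  point of the circle from 1; this makes the centre weight a tent over its arc.\<close>

lemma arccos_Re_qcis: "\<bar>r\<bar> \<le> 2 \<Longrightarrow> 2 / pi * arccos (Re (qcis r)) = \<bar>r\<bar>"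
proof -
  assume r: "\<bar>r\<bar> \<le> 2"
  have "cos (pi / 2 * r) = cos (pi / 2 * \<bar>r\<bar>)"
    by (cases "r \<ge> 0") (auto simp: abs_if)
  moreover have "arccos (cos (pi / 2 * \<bar>r\<bar>)) = pi / 2 * \<bar>r\<bar>"
    by (rule arccos_cos) (use r in \<open>auto simp: field_simps\<close>)
  ultimately show ?thesis by (simp add: qcis_def field_simps)
qed

text \<open>As a function of \<open>r\<close> this is a triangle wave of period 4: the reflections
  in 1 and -1 preserve the imaginary part and carry the rising branch to the two falling
  ones.\<close>

lemma arcsin_Im_qcis:
  "\<bar>r\<bar> \<le> 1 \<Longrightarrow> 2 / pi * arcsin (Im (qcis r)) = r"
  "1 \<le> r \<Longrightarrow> r \<le> 3 \<Longrightarrow> 2 / pi * arcsin (Im (qcis r)) = 2 - r"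
  "- 3 \<le> r \<Longrightarrow> r \<le> - 1 \<Longrightarrow> 2 / pi * arcsin (Im (qcis r)) = - 2 - r"
proof -
  show *: "2 / pi * arcsin (Im (qcis r)) = r" if "\<bar>r\<bar> \<le> 1" for r
  proof -
    have "arcsin (sin (pi / 2 * r)) = pi / 2 * r"
      by (rule arcsin_sin) (use that mult_left_mono[of "- 1" r pi] in \<open>auto simp: field_simps abs_le_iff\<close>)
    then show ?thesis by (simp add: qcis_def field_simps)
  qed
  have "Im (qcis r) = Im (qcis (2 - r))"
    by (simp add: qcis_def right_diff_distrib sin_diff)
  then show "1 \<le> r \<Longrightarrow> r \<le> 3 \<Longrightarrow> 2 / pi * arcsin (Im (qcis r)) = 2 - r"
    using *[of "2 - r"] by simp
  have "Im (qcis r) = Im (qcis (- 2 - r))"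
    by (simp add: qcis_def right_diff_distrib sin_diff)
  then show "- 3 \<le> r \<Longrightarrow> r \<le> - 1 \<Longrightarrow> 2 / pi * arcsin (Im (qcis r)) = - 2 - r"
    using *[of "- 2 - r"] by simp
qed

lemma arccos_Re_minus_qcis: "\<bar>r\<bar> \<le> 2 \<Longrightarrow> 2 / pi * arccos (Re (- qcis r)) = 2 - \<bar>r\<bar>"
proof -
  assume r: "\<bar>r\<bar> \<le> 2"
  have "\<bar>Re (qcis r)\<bar> \<le> 1" by (metis abs_Re_le_cmod norm_qcis)
  then have "arccos (Re (- qcis r)) = pi - arccos (Re (qcis r))"
    by (simp add: arccos_minus abs_le_iff)
  then show ?thesis using arccos_Re_qcis[OF r] by (simp add: field_simps)
qed

lemma arcsin_Im_minus:
  assumes "norm q = 1" shows "arcsin (Im (- q)) = - arcsin (Im q)"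
proof -
  have "\<bar>Im q\<bar> \<le> 1" by (metis abs_Im_le_cmod assms)
  then show ?thesis by (simp add: arcsin_minus abs_le_iff)
qed

text \<open>Across an arc a point runs along the broken line from the gap vertex before the arc
  through the centre vertex to the gap vertex after it, and \<open>r\<close> is an affine parameter
  on either half. In particular the weights determine \<open>r\<close>.\<close>

lemma weight_peak_values:
  assumes "\<bar>r\<bar> \<le> x" "x \<le> 1"
  shows "weight (True, s) (unit_sign s * qcis r) x = x - \<bar>r\<bar>"
    and "weight (True, \<not> s) (unit_sign s * qcis r) x = 0"
    and "weight (False, s) (unit_sign s * qcis r) x = max 0 r"
    and "weight (False, \<not> s) (unit_sign s * qcis r) x = max 0 (- r)"
proof -
  have r: "\<bar>r\<bar> \<le> 1" "\<bar>r\<bar> \<le> 2" using assms by auto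
  show "weight (True, s) (unit_sign s * qcis r) x = x - \<bar>r\<bar>"
    using arccos_Re_qcis[OF r(2)] assms by (simp add: weight_def)
  show "weight (True, \<not> s) (unit_sign s * qcis r) x = 0"
    using arccos_Re_minus_qcis[OF r(2)] assms by (simp add: weight_def)
  show "weight (False, s) (unit_sign s * qcis r) x = max 0 r"
    using arcsin_Im_qcis(1)[OF r(1)] assms by (simp add: weight_def)
  show "weight (False, \<not> s) (unit_sign s * qcis r) x = max 0 (- r)"
    using arcsin_Im_qcis(1)[OF r(1)] arcsin_Im_minus[of "qcis r"] assms by (simp add: weight_def)
qed

text \<open>Throughout a gap the whole mass of the vertex stays on one gap vertex. Its four weights
  are constant there, so movement inside the gap can only be seen by the weights of other
  vertices.\<close>

lemma weight_flat_values:
  assumes "x \<le> r" "r \<le> 2 - x" "0 \<le> x"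
  shows "weight (True, t) (unit_sign s * qcis r) x = 0"
    and "weight (False, s) (unit_sign s * qcis r) x = x"
    and "weight (False, \<not> s) (unit_sign s * qcis r) x = 0"
proof -
  have r: "\<bar>r\<bar> \<le> 2" using assms by auto
  have p: "2 / pi * arcsin (Im (qcis r)) = (if r \<le> 1 then r else 2 - r)"
    using arcsin_Im_qcis(1,2)[of r] assms by auto
  show "weight (True, t) (unit_sign s * qcis r) x = 0"
    using arccos_Re_qcis[OF r] arccos_Re_minus_qcis[OF r] assms
    by (cases "t = s") (auto simp: weight_def unit_sign_def split: if_splits)
  show "weight (False, s) (unit_sign s * qcis r) x = x"
    using p assms by (auto simp: weight_def)
  show "weight (False, \<not> s) (unit_sign s * qcis r) x = 0"
    using p assms arcsin_Im_minus[of "qcis r"] by (auto simp: weight_def)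
qed

lemma weight_at_zero:
  assumes "norm q = 1" shows "weight i q 0 = 0"
proof -
  have "\<bar>Re (unit_sign (snd i) * q)\<bar> \<le> 1"
    using abs_Re_le_cmod[of "unit_sign (snd i) * q"] assms by (simp add: norm_mult)
  then have "0 \<le> arccos (Re (unit_sign (snd i) * q))"
    by (intro arccos_lbound) (auto simp: abs_le_iff)
  then show ?thesis by (auto simp: weight_def)
qed

lemma weight_cases:
  assumes "norm q = 1" "0 \<le> x" "x \<le> 1"
  obtains (peak) s r where "\<bar>r\<bar> < x" "q = unit_sign s * qcis r"
    | (flat) s r where "x \<le> r" "r \<le> 2 - x" "q = unit_sign s * qcis r"
proof -
  obtain r where r: "q = qcis r" "- 2 < r" "r \<le> 2" using unit_eq_qcis assms(1) by blast
  have m: "qcis r = unit_sign False * qcis (r - 2)" "qcis r = unit_sign False * qcis (r + 2)"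
    by (simp_all add: qcis_diff qcis_add)
  \<comment> \<open>The arc around the antipode crosses the cut at 2 = -2 of the representatives,
    hence appears once at each end.\<close>
  consider "\<bar>r\<bar> < x" | "x \<le> r" "r \<le> 2 - x" | "\<bar>r - 2\<bar> < x" | "\<bar>r + 2\<bar> < x"
    | "x \<le> r + 2" "r + 2 \<le> 2 - x"
    using r assms by linarith
  then show thesis
  proof cases
    case 1 then show ?thesis using peak[of r True] r by simp
  next
    case 2 then show ?thesis using flat[of r True] r by simp
  next
    case 3 then show ?thesis using peak[of "r - 2" False] r m by simp
  next
    case 4 then show ?thesis using peak[of "r + 2" False] r m by simp
  next
    case 5 then show ?thesis using flat[of "r + 2" False] r m by simp
  qed
qed

lemma sum_bool_pair:
  "(\<Sum>i\<in>UNIV. f i) = f (True, s) + f (True, \<not> s) + f (False, s) + f (False, \<not> s)"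
  for f :: "bool \<times> bool \<Rightarrow> real"
  by (cases s) (simp_all add: UNIV_bool UNIV_Times_UNIV[symmetric] sum.cartesian_product[symmetric]
      del: UNIV_Times_UNIV)

text \<open>This is what puts the triangulation over the base: the projection, in coordinates, just
  adds up the four weights belonging to a vertex.\<close>

lemma weight_sum:
  assumes "norm q = 1" "0 \<le> x" "x \<le> 1"
  shows "(\<Sum>i\<in>UNIV. weight i q x) = x"
proof -
  show ?thesis using assms
  proof (cases rule: weight_cases)
    case (peak s r)
    then show ?thesis using weight_peak_values[of r x s] sum_bool_pair[of "\<lambda>i. weight i q x" s] assms by (auto simp: max_def abs_if)
  next
    case (flat s r)
    then show ?thesis using weight_flat_values[where x=x and r=r and s=s] sum_bool_pair[of "\<lambda>i. weight i q x" s] assms by auto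
  qed
qed

lemma weight_nonneg:
  assumes "norm q = 1" "0 \<le> x" shows "0 \<le> weight i q x"
  using assms by (auto simp: weight_def)

lemma weight_le:
  assumes "norm q = 1" "0 \<le> x" shows "weight i q x \<le> x"
proof -
  have "\<bar>Re (unit_sign (snd i) * q)\<bar> \<le> 1"
    using abs_Re_le_cmod[of "unit_sign (snd i) * q"] assms by (simp add: norm_mult)
  then have "0 \<le> arccos (Re (unit_sign (snd i) * q))"
    by (intro arccos_lbound) (auto simp: abs_le_iff)
  then show ?thesis using assms by (auto simp: weight_def)
qed

lemma weight_peak_pos:
  assumes "norm q = 1" "0 \<le> x" "x \<le> 1" "weight (True, s) q x \<noteq> 0"
  obtains r where "\<bar>r\<bar> < x" "q = unit_sign s * qcis r"
  using assms(1-3)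
proof (cases rule: weight_cases)
  case (peak s' r)
  then have "s' = s" using weight_peak_values(2)[of r x s'] assms by (cases "s = s'") auto
  then show ?thesis using that peak by blast
next
  case (flat s' r)
  then show ?thesis using weight_flat_values(1)[of x r s s'] assms by auto
qed

lemma weight_flat_pos:
  assumes "norm q = 1" "0 \<le> x" "x \<le> 1" "weight (False, s) q x \<noteq> 0"
  obtains r where "0 < r" "r < 2" "q = unit_sign s * qcis r"
  using assms(1-3)
proof (cases rule: weight_cases)
  case (peak s' r)
  show ?thesis
  proof (cases "s' = s")
    case True
    then show ?thesis using weight_peak_values(3)[of r x s] peak assms that[of r] by auto
  next
    case False
    then have s: "s = (\<not> s')" by auto
    have "weight (False, s) q x = max 0 (- r)"
      using weight_peak_values(4)[of r x s'] peak assms by (simp add: s)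
    then have "r < 0" using assms by auto
    \<comment> \<open>Just before the centre of an arc the positive gap vertex is that of the
      opposite copy; measured from that copy the position is \<open>r + 2\<close>.\<close>
    then show ?thesis using that[of "r + 2"] peak assms by (simp add: s qcis_add)
  qed
next
  case (flat s' r)
  have "s' = s" using weight_flat_values(3)[of x r s'] flat assms by (cases "s = s'") auto
  moreover have "x > 0" using weight_at_zero assms by (cases "x = 0") auto
  ultimately show ?thesis using that[of r] flat by auto
qed

text \<open>The two gap vertices live on the opposite open half circles distinguished by the sign of
  the imaginary part, so no simplex will contain both.\<close>

lemma weight_flat_not_both:
  assumes "norm q = 1" "weight (False, s) q x \<noteq> 0" "0 \<le> x"
  shows "weight (False, \<not> s) q x = 0"
proof -
  have n: "norm (unit_sign s * q) = 1" using assms by (simp add: norm_mult)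
  show ?thesis using assms arcsin_Im_minus[OF n] by (auto simp: weight_def)
qed

definition supp :: "('v \<Rightarrow> real) \<Rightarrow> 'v set" where
  "supp x = {v. x v \<noteq> 0}"

lemma geom_supp:
  "x \<in> geom K \<longleftrightarrow> (\<forall>v. 0 \<le> x v) \<and> supp x \<in> K \<and> sum x (supp x) = 1"
  by (simp add: geom_def supp_def)

section \<open>Cyclic systems on a simplicial complex\<close>

text \<open>The identity \<open>eps_cocycle\<close> is demanded also for \<open>z\<close> among
  \<open>u\<close>, \<open>v\<close>, \<open>w\<close>, where it expresses the symmetry of
  \<open>eps\<close>. It can then be summed against all barycentric coordinates without exceptions,
  while \<open>eps_deg\<close> keeps the two ends of a pair from influencing their own
  distance.\<close>

locale cyclic_system =
  fixes K :: "'v set set" and a :: "'v \<Rightarrow> 'v \<Rightarrow> int" and eps :: "'v \<Rightarrow> 'v \<Rightarrow> 'v \<Rightarrow> int"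
  assumes face: "\<sigma> \<in> K \<Longrightarrow> \<tau> \<subseteq> \<sigma> \<Longrightarrow> \<tau> \<noteq> {} \<Longrightarrow> \<tau> \<in> K"
    and fin: "\<sigma> \<in> K \<Longrightarrow> finite \<sigma>"
    and a_anti: "{u, v} \<in> K \<Longrightarrow> u \<noteq> v \<Longrightarrow> a v u = - a u v"
    and a_val: "{u, v} \<in> K \<Longrightarrow> u \<noteq> v \<Longrightarrow> a u v = 1 \<or> a u v = - 1"
    and eps_abs: "{u, v, w} \<in> K \<Longrightarrow> \<bar>eps u v w\<bar> \<le> 1"
    and eps_deg: "eps u v u = 0" "eps u v v = 0"
    and eps_anti: "{u, v, w} \<in> K \<Longrightarrow> u \<noteq> v \<Longrightarrow> eps v u w = - eps u v w"
    and eps_cocycle: "{u, v, w, z} \<in> K \<Longrightarrow> distinct [u, v, w] \<Longrightarrow>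
           eps v w z - eps u w z + eps u v z = eps u v w"
begin

text \<open>The function \<open>eps u v\<close> on the vertices, extended affinely to the points of
  the complex.\<close>

definition drift :: "'v \<Rightarrow> 'v \<Rightarrow> ('v \<Rightarrow> real) \<Rightarrow> real" where
  "drift u v x = (\<Sum>z\<in>supp x. of_int (eps u v z) * x z)"

definition mark_diff :: "'v \<Rightarrow> 'v \<Rightarrow> ('v \<Rightarrow> real) \<Rightarrow> real" where
  "mark_diff u v x = of_int (a u v) + drift u v x"

text \<open>A point of the fibre over \<open>x\<close> is described by its positions \<open>q v\<close> relative to all marks.\<close>

definition compatible :: "('v \<Rightarrow> real) \<Rightarrow> ('v \<Rightarrow> complex) \<Rightarrow> bool" where
  "compatible x q \<longleftrightarrow> (\<forall>v\<in>supp x. norm (q v) = 1) \<and>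
     (\<forall>u\<in>supp x. \<forall>v\<in>supp x. u \<noteq> v \<longrightarrow> q v = q u * qcis (- mark_diff u v x))"

section \<open>Bounds and identities for the drift\<close>

lemma geomD:
  assumes "x \<in> geom K"
  shows "0 \<le> x v" "supp x \<in> K" "finite (supp x)" "sum x (supp x) = 1" "supp x \<noteq> {}" "x v \<le> 1"
proof -
  show *: "0 \<le> x v" "supp x \<in> K" "finite (supp x)" "sum x (supp x) = 1" for v
    using assms fin by (auto simp: geom_supp)
  then show "supp x \<noteq> {}" by auto
  show "x v \<le> 1"
  proof (cases "v \<in> supp x")
    case True
    then show ?thesis using *(4) member_le_sum[of v "supp x" x] *(1,3) by auto
  qed (auto simp: supp_def)
qed

text \<open>The terms at \<open>u\<close> and \<open>v\<close> vanish and the others have total mass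
  \<open>1 - x u - x v\<close>. Since the marks differ by an odd integer plus the drift, their
  distance modulo 2 is at least \<open>x u + x v\<close>: arcs of different vertices do not
  overlap.\<close>

lemma drift_bound:
  assumes x: "x \<in> geom K" and uv: "supp x \<union> {u, v} \<in> K" "u \<noteq> v"
  shows "\<bar>drift u v x\<bar> \<le> 1 - x u - x v"
proof -
  note g = geomD[OF x]
  have "drift u v x = (\<Sum>z\<in>supp x - {u, v}. of_int (eps u v z) * x z)"
    unfolding drift_def using g by (intro sum.mono_neutral_right) (auto simp: eps_deg)
  also have "\<bar>\<dots>\<bar> \<le> (\<Sum>z\<in>supp x - {u, v}. \<bar>of_int (eps u v z) * x z\<bar>)"
    by (rule sum_abs)
  also have "\<dots> \<le> (\<Sum>z\<in>supp x - {u, v}. x z)"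
  proof (rule sum_mono)
    fix z assume "z \<in> supp x - {u, v}"
    then have "{u, v, z} \<in> K" using face[OF uv(1), of "{u, v, z}"] by auto
    then have "\<bar>of_int (eps u v z) :: real\<bar> \<le> 1" using eps_abs[of u v z] by linarith
    then show "\<bar>of_int (eps u v z) * x z\<bar> \<le> x z"
      using g(1)[of z] by (simp add: abs_mult mult_left_le_one_le)
  qed
  also have "\<dots> = 1 - x u - x v"
  proof -
    have "(\<Sum>z\<in>supp x \<union> {u, v}. x z) = 1"
      using g by (subst sum.mono_neutral_right[of "supp x \<union> {u, v}" "supp x"]) (auto simp: supp_def)
    moreover have "(\<Sum>z\<in>supp x \<union> {u, v}. x z) = (\<Sum>z\<in>(supp x \<union> {u, v}) - {u, v}. x z) + (\<Sum>z\<in>{u, v}. x z)"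
      using g by (intro sum.subset_diff) auto
    moreover have "(supp x \<union> {u, v}) - {u, v} = supp x - {u, v}" by auto
    ultimately show ?thesis using uv by simp
  qed
  finally show ?thesis .
qed

lemma drift_anti:
  assumes "supp x \<union> {u, v} \<in> K" "u \<noteq> v"
  shows "drift v u x = - drift u v x"
proof -
  have "eps v u z = - eps u v z" if "z \<in> supp x" for z
    by (rule eps_anti[OF face[OF assms(1)] assms(2)]) (use that in auto)
  then show ?thesis
    by (simp add: drift_def sum_negf[symmetric] cong: sum.cong)
qed

text \<open>The identity for \<open>eps\<close> holds for each \<open>z\<close> with a right side
  independent of \<open>z\<close>; averaging with weights of total mass 1 leaves that constant. So
  the mark differences, although they vary with \<open>x\<close>, have an integer
  coboundary.\<close>

lemma drift_cocycle:
  assumes "x \<in> geom K" "supp x \<union> {u, v, w} \<in> K" "distinct [u, v, w]"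
  shows "drift v w x - drift u w x + drift u v x = of_int (eps u v w)"
proof -
  have "drift v w x - drift u w x + drift u v x
      = (\<Sum>z\<in>supp x. of_int (eps v w z - eps u w z + eps u v z) * x z)"
    by (simp add: drift_def sum.distrib sum_subtractf algebra_simps)
  also have "\<dots> = (\<Sum>z\<in>supp x. of_int (eps u v w) * x z)"
  proof (rule sum.cong[OF refl])
    fix z assume "z \<in> supp x"
    then have "{u, v, w, z} \<in> K" by (intro face[OF assms(2)]) auto
    then show "of_int (eps v w z - eps u w z + eps u v z) * x z = of_int (eps u v w) * x z"
      using eps_cocycle assms(3) by simp
  qed
  also have "\<dots> = of_int (eps u v w)"
    using geomD(4)[OF assms(1)] by (simp add: sum_distrib_left[symmetric])
  finally show ?thesis .
qed

lemma supp_union2: "x \<in> geom K \<Longrightarrow> u \<in> supp x \<Longrightarrow> v \<in> supp x \<Longrightarrow> supp x \<union> {u, v} \<in> K"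
  using geomD(2)[of x] by (metis Un_absorb2 empty_subsetI insert_subset)

lemma supp_union3:
  "x \<in> geom K \<Longrightarrow> u \<in> supp x \<Longrightarrow> v \<in> supp x \<Longrightarrow> w \<in> supp x \<Longrightarrow> supp x \<union> {u, v, w} \<in> K"
  using geomD(2)[of x] by (metis Un_absorb2 empty_subsetI insert_subset)

lemma supp_edge: "x \<in> geom K \<Longrightarrow> u \<in> supp x \<Longrightarrow> v \<in> supp x \<Longrightarrow> {u, v} \<in> K"
  using geomD(2)[of x] face[of "supp x" "{u, v}"] by auto

lemma supp_pos: "x \<in> geom K \<Longrightarrow> v \<in> supp x \<Longrightarrow> 0 < x v"
  using geomD(1)[of x v] by (auto simp: supp_def less_le)

lemma compatibleD:
  assumes "compatible x q"
  shows "v \<in> supp x \<Longrightarrow> norm (q v) = 1"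
    and "u \<in> supp x \<Longrightarrow> v \<in> supp x \<Longrightarrow> u \<noteq> v \<Longrightarrow> q v = q u * qcis (- mark_diff u v x)"
  using assms unfolding compatible_def by blast+

lemma compatible_scale:
  assumes "compatible x q" "norm z = 1"
  shows "compatible x (\<lambda>v. z * q v)"
  unfolding compatible_def
proof (intro conjI ballI impI)
  show "norm (z * q v) = 1" if "v \<in> supp x" for v
    using compatibleD(1)[OF assms(1) that] assms(2) by (simp add: norm_mult)
  show "z * q v = z * q u * qcis (- mark_diff u v x)" if "u \<in> supp x" "v \<in> supp x" "u \<noteq> v" for u v
    using compatibleD(2)[OF assms(1) that] by (simp only: mult.assoc)
qed

text \<open>A point of the fibre lying in the arc of \<open>v\<close> is in the gaps of all other vertices,
  and \<open>a\<close> tells on which side.\<close>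

lemma peak_determines_flat:
  assumes x: "x \<in> geom K" and q: "compatible x q" and v: "v \<in> supp x" and w: "w \<in> supp x" "w \<noteq> v"
    and r: "\<bar>r\<bar> < x v" "q v = unit_sign s * qcis r"
  shows "weight (True, t) (q w) (x w) = 0"
    and "weight (False, t) (q w) (x w) = (if t = (s \<noteq> (a v w = 1)) then x w else 0)"
proof -
  have b: "\<bar>drift v w x\<bar> \<le> 1 - x v - x w"
    using drift_bound[OF x supp_union2[OF x v w(1)]] w by auto
  have qw: "q w = unit_sign s * qcis (r - drift v w x - of_int (a v w))"
    using compatibleD(2)[OF q v w(1)] w(2) unfolding mark_diff_def r(2)
    by (simp add: qcis_add[symmetric] mult.assoc algebra_simps)
  define c where "c = (a v w = 1)"
  \<comment> \<open>For either value of \<open>a v w\<close> the position relative to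
    \<open>w\<close> is \<open>\<rho>\<close> up to a half turn; the half turn is recorded by
    flipping the sign \<open>s\<close> when \<open>a v w = 1\<close>.\<close>
  define \<rho> where "\<rho> = r - drift v w x + 1"
  have "a v w = 1 \<or> a v w = - 1"
    using a_val[OF supp_edge[OF x v w(1)]] w by auto
  then have qw': "q w = unit_sign (s \<noteq> c) * qcis \<rho>"
  proof
    assume "a v w = 1"
    moreover have "qcis (r - drift v w x - 1) = - qcis \<rho>"
      using qcis_add[of "r - drift v w x - 1" 2] by (simp add: \<rho>_def add.commute)
    ultimately show ?thesis using qw by (simp add: c_def)
  next
    assume "a v w = - 1"
    then show ?thesis using qw by (simp add: c_def \<rho>_def)
  qed
  \<comment> \<open>The drift bound and \<open>\<bar>r\<bar> < x v\<close> keep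
    \<open>r - drift v w x\<close> within \<open>1 - x w\<close> of 0, and \<open>1 - x w\<close> is
    the half length of the gap.\<close>
  have \<rho>: "x w \<le> \<rho>" "\<rho> \<le> 2 - x w" using b r by (auto simp: \<rho>_def)
  note F = weight_flat_values[OF \<rho> geomD(1)[OF x]]
  show "weight (True, t) (q w) (x w) = 0" using F(1) qw' by simp
  show "weight (False, t) (q w) (x w) = (if t = (s \<noteq> (a v w = 1)) then x w else 0)"
    using F(2)[of "s \<noteq> c"] F(3)[of "s \<noteq> c"] qw' by (cases "t = (s \<noteq> c)") (auto simp: c_def)
qed

text \<open>The difference is odd because \<open>a u v\<close> is, and below 3 in absolute value
  because both positions lie in an interval of length 2 and the drift is less than 1. By the second
  claim the signs and \<open>a u v\<close> decide which of the two values occurs.\<close>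

lemma gap_difference_odd:
  assumes x: "x \<in> geom K" and q: "compatible x q" and u: "u \<in> supp x" and v: "v \<in> supp x" "u \<noteq> v"
    and qu: "q u = unit_sign su * qcis Ru" and qv: "q v = unit_sign sv * qcis Rv"
    and b: "0 < Ru" "Ru < 2" "0 < Rv" "Rv < 2"
  shows "Ru - Rv - drift u v x = 1 \<or> Ru - Rv - drift u v x = - 1"
    and "unit_sign sv * qcis (of_int (a u v)) = unit_sign su * qcis (Ru - Rv - drift u v x)"
proof -
  have "\<bar>drift u v x\<bar> \<le> 1 - x u - x v" "x u > 0" "x v > 0"
    using drift_bound[OF x supp_union2[OF x u v(1)] v(2)] supp_pos[OF x] u v by auto
  then have t: "\<bar>Ru - Rv - drift u v x\<bar> < 3" using b by linarith
  have "unit_sign sv * qcis Rv = unit_sign su * qcis Ru * qcis (- mark_diff u v x)"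
    using compatibleD(2)[OF q u v] unfolding qu qv .
  then have "unit_sign sv * qcis Rv * qcis (of_int (a u v) - Rv)
      = unit_sign su * qcis Ru * qcis (- mark_diff u v x) * qcis (of_int (a u v) - Rv)" by simp
  moreover have "Ru + (- drift u v x - Rv) = Ru - Rv - drift u v x" by simp
  ultimately show *: "unit_sign sv * qcis (of_int (a u v)) = unit_sign su * qcis (Ru - Rv - drift u v x)"
    by (simp add: mult.assoc qcis_add[symmetric] mark_diff_def)
  \<comment> \<open>Squaring removes the unknown signs at the price of half the period: the
    difference is then known modulo 2.\<close>
  have "qcis (2 * of_int (a u v)) = qcis (2 * (Ru - Rv - drift u v x))"
  proof -
    have "(unit_sign sv * qcis (of_int (a u v))) ^ 2 = (unit_sign su * qcis (Ru - Rv - drift u v x)) ^ 2"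
      using * by simp
    moreover have "(unit_sign s) ^ 2 = 1" for s by (simp add: power2_eq_square)
    moreover have "qcis r ^ 2 = qcis (2 * r)" for r
      by (metis qcis_add mult_2 power2_eq_square)
    ultimately show ?thesis by (simp add: power_mult_distrib)
  qed
  then have "qcis (2 * (Ru - Rv - drift u v x) - 2 * of_int (a u v)) = 1"
    unfolding qcis_diff[of "2 * (Ru - Rv - drift u v x)"] by simp
  then obtain n :: int where "2 * (Ru - Rv - drift u v x) - 2 * of_int (a u v) = 4 * real_of_int n"
    using qcis_eq_1_iff by blast
  then have n: "Ru - Rv - drift u v x = of_int (2 * n + a u v)" by simp
  with t have "\<bar>2 * n + a u v\<bar> < 3" by linarith
  moreover have "a u v = 1 \<or> a u v = - 1" using a_val supp_edge[OF x u v(1)] v by auto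
  ultimately have "2 * n + a u v = 1 \<or> 2 * n + a u v = - 1" by presburger
  with n show "Ru - Rv - drift u v x = 1 \<or> Ru - Rv - drift u v x = - 1" by auto
qed

text \<open>Geometrically the point is the common end of two arcs: that of \<open>v\<close>, whose
  mark is nearest behind it, and the coming copy of that of \<open>u\<close>, whose mark is farthest
  behind. The order of the positions forces +1 for all pairs involved, the cocycle identity turns
  this into \<open>eps u v z = 1\<close>, and so the drift reaches its bound.\<close>

lemma gap_tight:
  assumes x: "x \<in> geom K" and u: "u \<in> supp x" and v: "v \<in> supp x" "u \<noteq> v"
    and R: "\<And>w z. w \<in> supp x \<Longrightarrow> z \<in> supp x \<Longrightarrow> w \<noteq> z \<Longrightarrow>
              R w - R z - drift w z x = 1 \<or> R w - R z - drift w z x = - (1::real)"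
    and max: "\<And>w. w \<in> supp x \<Longrightarrow> R w \<le> R u" and min: "\<And>w. w \<in> supp x \<Longrightarrow> R v \<le> R w"
  shows "R u - R v = 2 - x u - x v"
proof -
  \<comment> \<open>With the other sign \<open>R w\<close> would be strictly below
    \<open>R z\<close>, since the drift is less than 1.\<close>
  have le: "R w - R z - drift w z x = 1"
    if "w \<in> supp x" "z \<in> supp x" "w \<noteq> z" "R z \<le> R w" for w z
  proof -
    have "\<bar>drift w z x\<bar> \<le> 1 - x w - x z" "x w > 0" "x z > 0"
      using drift_bound[OF x supp_union2[OF x that(1,2)] that(3)] supp_pos[OF x] that by auto
    then show ?thesis using R[OF that(1-3)] that(4) by linarith
  qed
  have "eps u v z = 1" if z: "z \<in> supp x" "z \<noteq> u" "z \<noteq> v" for z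
  proof -
    have "drift v z x - drift u z x + drift u v x = of_int (eps u v z)"
      using drift_cocycle[OF x supp_union3[OF x u v(1) z(1)]] z v by auto
    moreover have "drift v z x = - drift z v x"
      using drift_anti[OF supp_union2[OF x z(1) v(1)]] z by auto
    moreover have "R z - R v - drift z v x = 1" "R u - R z - drift u z x = 1" "R u - R v - drift u v x = 1"
      using le z u v max min by auto
    ultimately have "real_of_int (eps u v z) = 1" by linarith
    then show ?thesis by linarith
  qed
  then have "drift u v x = (\<Sum>z\<in>supp x - {u, v}. x z)"
    unfolding drift_def using geomD(3)[OF x] 
    by (subst sum.mono_neutral_right[of "supp x" "supp x - {u, v}"]) (auto simp: eps_deg)
  also have "\<dots> = 1 - x u - x v"
    using sum.subset_diff[of "{u, v}" "supp x" x] u v geomD(3,4)[OF x] by simp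
  finally show ?thesis using le[OF u v(1,2)] max[OF v(1)] by auto
qed

text \<open>If a centre vertex carries weight, its arc parameter is read off the gap weights.
  Otherwise the weights yield only signs; these fix all differences of positions, and tightness of
  the extreme positions removes the one remaining translation.\<close>

lemma fibre_injective:
  assumes x: "x \<in> geom K" and q: "compatible x q" and z: "norm z = 1"
    and eq: "\<And>v i. v \<in> supp x \<Longrightarrow> weight i (z * q v) (x v) = weight i (q v) (x v)"
  shows "z = 1"
proof (cases "\<exists>v\<in>supp x. \<exists>s. weight (True, s) (q v) (x v) \<noteq> 0")
  case True
  then obtain v s where v: "v \<in> supp x" and s: "weight (True, s) (q v) (x v) \<noteq> 0" by auto
  have n: "norm (q v) = 1" "norm (z * q v) = 1" using compatibleD(1)[OF q v] z by (simp_all add: norm_mult)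
  note g = geomD(1,6)[OF x, of v]
  obtain r where r: "\<bar>r\<bar> < x v" "q v = unit_sign s * qcis r" using weight_peak_pos[OF n(1) g s] .
  have "weight (True, s) (z * q v) (x v) \<noteq> 0" using s eq[OF v] by simp
  then obtain r' where r': "\<bar>r'\<bar> < x v" "z * q v = unit_sign s * qcis r'" using weight_peak_pos[OF n(2) g] by blast
  have "max 0 r = max 0 r'" "max 0 (- r) = max 0 (- r')"
    using weight_peak_values(3,4)[of r "x v" s] weight_peak_values(3,4)[of r' "x v" s] r(1) r'(1) g
      eq[OF v, of "(False, s)"] eq[OF v, of "(False, \<not> s)"]
    unfolding r(2)[symmetric] r'(2)[symmetric] by auto
  then have "r = r'" by (auto simp: max_def split: if_splits)
  then have "z * q v = q v" using r r' by simp
  then show ?thesis using n by auto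
next
  case False
  have "\<exists>s R R'. q v = unit_sign s * qcis R \<and> z * q v = unit_sign s * qcis R' \<and> x v \<le> R \<and> R \<le> 2 - x v
      \<and> x v \<le> R' \<and> R' \<le> 2 - x v" if v: "v \<in> supp x" for v
  proof -
    have n: "norm (q v) = 1" "norm (z * q v) = 1" using compatibleD(1)[OF q v] z by (simp_all add: norm_mult)
    note g = geomD(1,6)[OF x, of v]
    have gap: "\<exists>s R. p = unit_sign s * qcis R \<and> x v \<le> R \<and> R \<le> 2 - x v"
      if "norm p = 1" and w: "\<And>s. weight (True, s) p (x v) = 0" for p
      using that(1) g
    proof (cases rule: weight_cases)
      case (peak s r)
      then show ?thesis using weight_peak_values(1)[of r "x v" s] g w[of s] by auto
    qed auto
    obtain s R where R: "q v = unit_sign s * qcis R" "x v \<le> R" "R \<le> 2 - x v"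
      using gap[OF n(1)] False v by blast
    obtain s' R' where R': "z * q v = unit_sign s' * qcis R'" "x v \<le> R'" "R' \<le> 2 - x v"
      using gap[OF n(2)] False v eq[OF v] by metis
    have "weight (False, s) (z * q v) (x v) = x v" 
      using weight_flat_values(2)[OF R(2,3) g(1), of s] R eq[OF v] by simp
    then have "s = s'" using weight_flat_values(3)[OF R'(2,3) g(1), of s'] R' supp_pos[OF x v]
      by (cases "s = s'") auto
    then show ?thesis using R R' by blast
  qed
  then have "\<forall>v\<in>supp x. \<exists>f. q v = unit_sign (fst f) * qcis (fst (snd f)) \<and> z * q v = unit_sign (fst f) * qcis (snd (snd f))
      \<and> x v \<le> fst (snd f) \<and> fst (snd f) \<le> 2 - x v \<and> x v \<le> snd (snd f) \<and> snd (snd f) \<le> 2 - x v"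
    by fastforce
  then obtain f where f: "\<forall>v\<in>supp x. q v = unit_sign (fst (f v)) * qcis (fst (snd (f v))) \<and> z * q v = unit_sign (fst (f v)) * qcis (snd (snd (f v)))
      \<and> x v \<le> fst (snd (f v)) \<and> fst (snd (f v)) \<le> 2 - x v \<and> x v \<le> snd (snd (f v)) \<and> snd (snd (f v)) \<le> 2 - x v"
    unfolding bchoice_iff by blast
  define s R R' where "s = (\<lambda>v. fst (f v))" and "R = (\<lambda>v. fst (snd (f v)))" and "R' = (\<lambda>v. snd (snd (f v)))"
  have R: "\<And>v. v \<in> supp x \<Longrightarrow> q v = unit_sign (s v) * qcis (R v)"
    and R': "\<And>v. v \<in> supp x \<Longrightarrow> z * q v = unit_sign (s v) * qcis (R' v)"
    and b: "\<And>v. v \<in> supp x \<Longrightarrow> x v \<le> R v" "\<And>v. v \<in> supp x \<Longrightarrow> R v \<le> 2 - x v"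
    and b': "\<And>v. v \<in> supp x \<Longrightarrow> x v \<le> R' v" "\<And>v. v \<in> supp x \<Longrightarrow> R' v \<le> 2 - x v"
    using f unfolding s_def R_def R'_def by blast+
  have st: "0 < R v" "R v < 2" "0 < R' v" "R' v < 2" if "v \<in> supp x" for v
    using b b' that supp_pos[OF x that] by (smt (verit))+
  note c' = compatible_scale[OF q z]
  \<comment> \<open>Equal signs force the same odd part on both sides, as \<open>qcis 1\<close> and
    \<open>qcis (- 1)\<close> differ.\<close>
  have diff: "R' w - R' v = R w - R v" if "w \<in> supp x" "v \<in> supp x" for w v
  proof (cases "w = v")
    case False
    have A: "R w - R v - drift w v x = 1 \<or> R w - R v - drift w v x = - 1"
      "unit_sign (s v) * qcis (of_int (a w v)) = unit_sign (s w) * qcis (R w - R v - drift w v x)"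
      using gap_difference_odd[OF x q that False R[OF that(1)] R[OF that(2)]] st that by auto
    have B: "R' w - R' v - drift w v x = 1 \<or> R' w - R' v - drift w v x = - 1"
      "unit_sign (s v) * qcis (of_int (a w v)) = unit_sign (s w) * qcis (R' w - R' v - drift w v x)"
      using gap_difference_odd[OF x c' that False R'[OF that(1)] R'[OF that(2)]] st that by auto
    have "qcis 1 \<noteq> qcis (- 1)"
    proof
      assume "qcis 1 = qcis (- 1)"
      then have "qcis 1 * qcis 1 = qcis (- 1) * qcis 1" by simp
      then show False by (simp add: qcis_add[symmetric])
    qed
    then show ?thesis using A B by auto
  qed auto
  have fin: "finite (supp x)" and ne: "supp x \<noteq> {}" using geomD[OF x] by auto
  obtain u where u: "u \<in> supp x" "\<And>w. w \<in> supp x \<Longrightarrow> R w \<le> R u"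
    using ex_is_arg_min_if_finite[OF fin ne, of "\<lambda>w. - R w"] by (auto simp: is_arg_min_linorder)
  obtain v where v: "v \<in> supp x" "\<And>w. w \<in> supp x \<Longrightarrow> R v \<le> R w"
    using ex_is_arg_min_if_finite[OF fin ne, of R] by (auto simp: is_arg_min_linorder)
  have "R u = R' u"
  proof (cases "u = v")
    case True
    \<comment> \<open>Here all positions agree; with a second vertex the drift would have absolute
      value 1, against its bound. Hence the point lies over a vertex, where the gap is reduced to
      the position 1.\<close>
    have "supp x = {u}"
    proof (rule ccontr)
      assume "supp x \<noteq> {u}"
      then obtain w where w: "w \<in> supp x" "w \<noteq> u" using u by auto
      then have "R w = R u" using u(2)[OF w(1)] v(2)[OF w(1)] True by simp
      moreover have "\<bar>drift u w x\<bar> \<le> 1 - x u - x w" "x w > 0" "x u > 0"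
        using drift_bound[OF x supp_union2[OF x u(1) w(1)]] w supp_pos[OF x] u by auto
      ultimately show False
        using gap_difference_odd(1)[OF x q u(1) w(1) w(2)[symmetric] R[OF u(1)] R[OF w(1)]] st w u by auto
    qed
    then have "x u = 1" using geomD(4)[OF x] by simp
    then show ?thesis using b b' u by (smt (verit))
  next
    case False
    have "R u - R v = 2 - x u - x v"
      using gap_difference_odd(1)[OF x q _ _ _ R R] st
      by (intro gap_tight[OF x u(1) v(1) False]) (use u v in auto)
    \<comment> \<open>The difference takes up all the room between \<open>x v\<close> and
      \<open>2 - x u\<close>, so both bounds are attained, for \<open>R\<close> and for
      \<open>R'\<close> alike.\<close>
    then show ?thesis using diff[OF u(1) v(1)] b[OF u(1)] b'[OF u(1)] b[OF v(1)] b'[OF v(1)] by linarith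
  qed
  then have "z * q u = q u" using R[OF u(1)] R'[OF u(1)] by metis
  moreover have "q u \<noteq> 0" using compatibleD(1)[OF q u(1)] by auto
  ultimately show ?thesis by simp
qed


text \<open>The coboundaries of \<open>t\<close> and of the drift cancel, so
  \<open>t + drift\<close> has a primitive, unique up to translation; a translation into the gaps of
  all vertices is to be found.\<close>

lemma gap_positions_exist:
  assumes x: "x \<in> geom K" and u0: "u0 \<in> supp x"
    and t: "\<And>u v. u \<in> supp x \<Longrightarrow> v \<in> supp x \<Longrightarrow> u \<noteq> v \<Longrightarrow> t u v = 1 \<or> t u v = - (1::real)"
    and anti: "\<And>u v. u \<in> supp x \<Longrightarrow> v \<in> supp x \<Longrightarrow> u \<noteq> v \<Longrightarrow> t v u = - t u v"
    and cocycle: "\<And>u v w. u \<in> supp x \<Longrightarrow> v \<in> supp x \<Longrightarrow> w \<in> supp x \<Longrightarrow> distinct [u, v, w] \<Longrightarrow>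
              t v w - t u w + t u v = - of_int (eps u v w)"
  obtains R where "\<And>v. v \<in> supp x \<Longrightarrow> x v \<le> R v \<and> R v \<le> 2 - x v"
    and "\<And>v. v \<in> supp x \<Longrightarrow> v \<noteq> u0 \<Longrightarrow> R u0 - R v = t u0 v + drift u0 v x"
proof -
  define N where "N v = (if v = u0 then 0 else - (t u0 v + drift u0 v x))" for v
  have N: "N u - N v = t u v + drift u v x" if uv: "u \<in> supp x" "v \<in> supp x" "u \<noteq> v" for u v
  proof -
    consider "u = u0" | "v = u0" | "distinct [u0, u, v]" using uv by fastforce
    then show ?thesis
    proof cases
      case 1 then show ?thesis using that by (simp add: N_def)
    next
      case 2 then show ?thesis
        using that anti[of u0 u] drift_anti[OF supp_union2[OF x u0, of u]] by (simp add: N_def u0)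
    next
      case 3
      then show ?thesis
        using that cocycle[OF u0 that(1,2) 3] drift_cocycle[OF x supp_union3[OF x u0 that(1,2)] 3]
        by (auto simp: N_def)
    qed
  qed
  have fin: "finite (supp x)" and ne: "supp x \<noteq> {}" using geomD[OF x] by auto
  \<comment> \<open>The least translation that brings every position up to its coordinate is tight
    at \<open>u\<close>; the drift bound against \<open>u\<close> then yields the upper
    estimates.\<close>
  obtain u where u: "u \<in> supp x" "\<And>w. w \<in> supp x \<Longrightarrow> x w - N w \<le> x u - N u"
    using ex_is_arg_min_if_finite[OF fin ne, of "\<lambda>w. N w - x w"]
    by (fastforce simp: is_arg_min_linorder)
  show thesis
  proof (rule that[of "\<lambda>v. N v + (x u - N u)"])
    fix v assume v: "v \<in> supp x"
    show "x v \<le> N v + (x u - N u) \<and> N v + (x u - N u) \<le> 2 - x v"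
    proof (cases "v = u")
      case True
      then show ?thesis using geomD(6)[OF x, of u] by simp
    next
      case False
      have "\<bar>drift v u x\<bar> \<le> 1 - x v - x u"
        using drift_bound[OF x supp_union2[OF x v u(1)] False] .
      then show ?thesis using N[OF v u(1) False] t[OF v u(1) False] u(2)[OF v] by auto
    qed
  next
    fix v assume "v \<in> supp x" "v \<noteq> u0"
    then show "N u0 + (x u - N u) - (N v + (x u - N u)) = t u0 v + drift u0 v x"
      using N[of u0 v] u0 by simp
  qed
qed

text \<open>Every simplex of the complex will be a face of the support of a point over some
  \<open>x0\<close>; this lemma fills it. The point over \<open>x0\<close> supplies only discrete
  data, signs and odd parts, which do not depend on the barycentric coordinates and can be reused
  over \<open>x\<close>.\<close>

lemma fibre_surjective:
  assumes x0: "x0 \<in> geom K" and q0: "compatible x0 q0" and x: "x \<in> geom K" and sub: "supp x \<subseteq> supp x0"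
    and q: "compatible x q" and y0: "\<And>v i. 0 \<le> y v i"
    and y: "\<And>v i. v \<in> supp x \<Longrightarrow> y v i \<noteq> 0 \<Longrightarrow> weight i (q0 v) (x0 v) \<noteq> 0"
    and xy: "\<And>v. v \<in> supp x \<Longrightarrow> x v = (\<Sum>i\<in>UNIV. y v i)"
  obtains z where "norm z = 1" "\<And>v i. v \<in> supp x \<Longrightarrow> weight i (z * q v) (x v) = y v i"
proof -
  have n0: "norm (q0 v) = 1" if "v \<in> supp x" for v using compatibleD(1)[OF q0] sub that by blast
  have n: "norm (q v) = 1" if "v \<in> supp x" for v using compatibleD(1)[OF q] that by blast
  have S: "x v = y v (True, s) + y v (True, \<not> s) + y v (False, s) + y v (False, \<not> s)"
    if "v \<in> supp x" for v s
    using xy[OF that] sum_bool_pair[of "y v" s] by simp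
  have nb: "y v (False, s) = 0 \<or> y v (False, \<not> s) = 0" if "v \<in> supp x" for v s
    using weight_flat_not_both[OF n0[OF that] _ geomD(1)[OF x0]] y[OF that] by blast
  have all: "weight i p c = y v i"
    if "weight (True, s) p c = y v (True, s)" "weight (True, \<not> s) p c = y v (True, \<not> s)"
      "weight (False, s) p c = y v (False, s)" "weight (False, \<not> s) p c = y v (False, \<not> s)" for i p c v s
    using that by (cases i; cases "snd i = s") (auto; metis)+
  show thesis
  proof (cases "\<exists>v\<in>supp x. \<exists>s. y v (True, s) \<noteq> 0")
    case True
    then obtain v s where v: "v \<in> supp x" and s: "y v (True, s) \<noteq> 0" by auto
    obtain r0 where r0: "\<bar>r0\<bar> < x0 v" "q0 v = unit_sign s * qcis r0"
      using weight_peak_pos[OF n0[OF v] geomD(1,6)[OF x0] y[OF v s]] .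
    have v': "v \<in> supp x0" using v sub by auto
    \<comment> \<open>At most one of the two gap weights is nonzero, so this inverts the formulas
      for the weights inside an arc.\<close>
    define r where "r = y v (False, s) - y v (False, \<not> s)"
    have "weight (True, \<not> s) (q0 v) (x0 v) = 0"
      using weight_peak_values(2)[of r0 "x0 v" s] r0 geomD(6)[OF x0] by simp
    then have z0: "y v (True, \<not> s) = 0" using y[OF v] by blast
    have r: "y v (False, s) = max 0 r" "y v (False, \<not> s) = max 0 (- r)" "x v = y v (True, s) + \<bar>r\<bar>"
      using nb[OF v, of s] S[OF v, of s] y0[of v "(False, s)"] y0[of v "(False, \<not> s)"] z0
      by (auto simp: r_def)
    have rx: "\<bar>r\<bar> < x v" using r(3) s y0[of v "(True, s)"] by linarith
    define z where "z = unit_sign s * qcis r / q v"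
    have z: "norm z = 1" "z * q v = unit_sign s * qcis r"
      using n[OF v] by (auto simp: z_def norm_divide norm_mult)
    note c = compatible_scale[OF q z(1)]
    show thesis
    proof (rule that[OF z(1)])
      fix w i assume w: "w \<in> supp x"
      show "weight i (z * q w) (x w) = y w i"
      proof (cases "w = v")
        case True
        show ?thesis
          unfolding True z(2)
          by (rule all[of s]) (use weight_peak_values[of r "x v" s] rx geomD(6)[OF x, of v] z0 r in auto)
      next
        case False
        have w': "w \<in> supp x0" using w sub by auto
        note P0 = peak_determines_flat[OF x0 q0 v' w' False r0]
        note P = peak_determines_flat[OF x c v w False rx z(2)]
        \<comment> \<open>The gap of \<open>w\<close> containing the point depends only on
          \<open>s\<close> and \<open>a v w\<close>, hence is the same over \<open>x0\<close> and
          over \<open>x\<close>.\<close>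
        define t where "t = (s \<noteq> (a v w = 1))"
        have 0: "y w (True, t) = 0" "y w (True, \<not> t) = 0" "y w (False, \<not> t) = 0"
          using y[OF w, of "(True, t)"] y[OF w, of "(True, \<not> t)"] y[OF w, of "(False, \<not> t)"]
            P0(1) P0(2)[of "\<not> t", folded t_def] by auto
        show ?thesis
          by (rule all[of t]) (use 0 P S[OF w, of t] in \<open>auto simp: t_def\<close>)
      qed
    qed
  next
    case False
    have "\<exists>f. 0 < snd f \<and> snd f < 2 \<and> q0 v = unit_sign (fst f) * qcis (snd f) \<and> y v (False, fst f) = x v
        \<and> y v (False, \<not> fst f) = 0" if v: "v \<in> supp x" for v
    proof -
      have "y v (False, True) \<noteq> 0 \<or> y v (False, False) \<noteq> 0"
        using S[OF v, of True] False v supp_pos[OF x v] by force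
      then obtain s where s: "y v (False, s) \<noteq> 0" by blast
      obtain r where "0 < r" "r < 2" "q0 v = unit_sign s * qcis r"
        using weight_flat_pos[OF n0[OF v] geomD(1,6)[OF x0] y[OF v s]] .
      moreover have "y v (False, \<not> s) = 0" using nb[OF v] s by blast
      moreover have "y v (False, s) = x v" using S[OF v, of s] False v calculation(4) by auto
      ultimately show ?thesis by (intro exI[of _ "(s, r)"]) auto
    qed
    then have "\<exists>f. \<forall>v\<in>supp x. 0 < snd (f v) \<and> snd (f v) < 2 \<and> q0 v = unit_sign (fst (f v)) * qcis (snd (f v))
        \<and> y v (False, fst (f v)) = x v \<and> y v (False, \<not> fst (f v)) = 0"
      by (intro bchoice) blast
    then obtain f where f: "\<forall>v\<in>supp x. 0 < snd (f v) \<and> snd (f v) < 2 \<and> q0 v = unit_sign (fst (f v)) * qcis (snd (f v))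
        \<and> y v (False, fst (f v)) = x v \<and> y v (False, \<not> fst (f v)) = 0" by blast
    define s R0 where "s = (\<lambda>v. fst (f v))" and "R0 = (\<lambda>v. snd (f v))"
    have R0: "0 < R0 v" "R0 v < 2" "q0 v = unit_sign (s v) * qcis (R0 v)"
      and ys: "y v (False, s v) = x v" "y v (False, \<not> s v) = 0" if "v \<in> supp x" for v
      using f that by (simp_all add: s_def R0_def)
    \<comment> \<open>The odd parts observed over \<open>x0\<close>. The drifts over
      \<open>x0\<close> and over \<open>x\<close> have the same coboundary \<open>eps\<close>, so
      \<open>t\<close> fits over \<open>x\<close> as well.\<close>
    define t where "t u v = R0 u - R0 v - drift u v x0" for u v
    have t: "t u v = 1 \<or> t u v = - 1" "unit_sign (s v) * qcis (of_int (a u v)) = unit_sign (s u) * qcis (t u v)"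
      if "u \<in> supp x" "v \<in> supp x" "u \<noteq> v" for u v
      using gap_difference_odd[OF x0 q0 _ _ that(3) R0(3)[OF that(1)] R0(3)[OF that(2)]] R0(1,2) that sub
      unfolding t_def by blast+
    obtain u0 where u0: "u0 \<in> supp x" using geomD(5)[OF x] by auto
    obtain R where R: "\<And>v. v \<in> supp x \<Longrightarrow> x v \<le> R v \<and> R v \<le> 2 - x v"
      and Rd: "\<And>v. v \<in> supp x \<Longrightarrow> v \<noteq> u0 \<Longrightarrow> R u0 - R v = t u0 v + drift u0 v x"
    proof (rule gap_positions_exist[OF x u0, of t])
      fix u v assume uv: "u \<in> supp x" "v \<in> supp x" "u \<noteq> v"
      show "t v u = - t u v"
        using drift_anti[OF supp_union2[OF x0 subsetD[OF sub uv(1)] subsetD[OF sub uv(2)]] uv(3)]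
        by (simp add: t_def)
    next
      fix u v w assume uv: "u \<in> supp x" "v \<in> supp x" "w \<in> supp x" "distinct [u, v, w]"
      have "drift v w x0 - drift u w x0 + drift u v x0 = of_int (eps u v w)"
        using drift_cocycle[OF x0 supp_union3[OF x0] uv(4)] uv sub by blast
      then show "t v w - t u w + t u v = - of_int (eps u v w)" by (simp add: t_def)
    qed (use t in auto)
    define z where "z = unit_sign (s u0) * qcis (R u0) / q u0"
    have z: "norm z = 1" "z * q u0 = unit_sign (s u0) * qcis (R u0)"
      using n[OF u0] by (auto simp: z_def norm_divide norm_mult)
    have zv: "z * q v = unit_sign (s v) * qcis (R v)" if v: "v \<in> supp x" for v
    proof (cases "v = u0")
      case False
      have "z * q v = unit_sign (s u0) * qcis (R u0) * qcis (- mark_diff u0 v x)"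
        using compatibleD(2)[OF compatible_scale[OF q z(1)] u0 v] False z(2) by simp
      also have "\<dots> = unit_sign (s u0) * (qcis (R u0) * qcis (- mark_diff u0 v x))" by simp
      also have "qcis (R u0) * qcis (- mark_diff u0 v x) = qcis (R v) * qcis (t u0 v) * qcis (- of_int (a u0 v))"
        using Rd[OF v False] by (simp add: qcis_add[symmetric] mark_diff_def algebra_simps)
      also have "unit_sign (s u0) * \<dots> = unit_sign (s u0) * qcis (t u0 v) * (qcis (R v) * qcis (- of_int (a u0 v)))"
        by (simp add: mult_ac)
      also have "\<dots> = unit_sign (s v) * qcis (R v) * (qcis (of_int (a u0 v)) * qcis (- of_int (a u0 v)))"
        using t(2)[OF u0 v] False by (simp add: mult_ac)
      finally show ?thesis by (simp add: mult_ac qcis_add[symmetric])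
    qed (use z in simp)
    show thesis
    proof (rule that[OF z(1)])
      fix v i assume v: "v \<in> supp x"
      show "weight i (z * q v) (x v) = y v i"
        unfolding zv[OF v]
        by (rule all[of "s v"])
          (use weight_flat_values[of "x v" "R v", OF _ _ geomD(1)[OF x]] R[OF v] ys[OF v] False v in auto)
    qed
  qed
qed

end

section \<open>Lifting angles over star-shaped sets\<close>

text \<open>Extension by zero: where \<open>r\<close> vanishes, the estimate makes \<open>F\<close>
  vanish and squeezes it nearby. It serves functions built from data that make sense only where
  \<open>r\<close> is nonzero, such as chart coordinates and positions relative to a mark.\<close>

lemma continuous_map_dominated:
  fixes F :: "'a \<Rightarrow> 'b::real_normed_vector"
  assumes r: "continuous_map X euclideanreal r"
    and F: "continuous_map (subtopology X {x \<in> topspace X. r x \<noteq> 0}) euclidean F"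
    and le: "\<And>x. x \<in> topspace X \<Longrightarrow> norm (F x) \<le> B * \<bar>r x\<bar>"
  shows "continuous_map X euclidean F"
  unfolding continuous_map_def
proof (intro conjI allI impI)
  fix U :: "'b set" assume U: "openin euclidean U"
  have op: "openin X {x \<in> topspace X. r x \<noteq> 0}"
    using openin_continuous_map_preimage[OF r, of "- {0}"] by (simp add: open_Compl)
  show "openin X {x \<in> topspace X. F x \<in> U}"
  proof (subst openin_subopen, intro ballI)
    fix x assume x: "x \<in> {x \<in> topspace X. F x \<in> U}"
    show "\<exists>T. openin X T \<and> x \<in> T \<and> T \<subseteq> {x \<in> topspace X. F x \<in> U}"
    proof (cases "r x = 0")
      case False
      have "openin (subtopology X {x \<in> topspace X. r x \<noteq> 0})
          {y \<in> topspace (subtopology X {x \<in> topspace X. r x \<noteq> 0}). F y \<in> U}"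
        using openin_continuous_map_preimage[OF F U] .
      then have "openin X {y \<in> topspace (subtopology X {x \<in> topspace X. r x \<noteq> 0}). F y \<in> U}"
        using op openin_trans_full by blast
      then show ?thesis using x False by (intro exI) auto
    next
      case True
      then have "F x = 0" using le[of x] x by auto
      then obtain e where e: "e > 0" "ball 0 e \<subseteq> U"
        using U x by (auto simp: open_contains_ball open_openin[symmetric])
      have "continuous_map X euclideanreal (\<lambda>x. B * \<bar>r x\<bar>)"
        using r by (intro continuous_map_real_mult_left continuous_map_real_abs)
      from openin_continuous_map_preimage[OF this, of "{..<e}"]
      have "openin X {y \<in> topspace X. B * \<bar>r y\<bar> < e}" by simp
      moreover have "{y \<in> topspace X. B * \<bar>r y\<bar> < e} \<subseteq> {x \<in> topspace X. F x \<in> U}"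
      proof
        fix y assume "y \<in> {y \<in> topspace X. B * \<bar>r y\<bar> < e}"
        then show "y \<in> {x \<in> topspace X. F x \<in> U}" using le[of y] e(2) by (auto simp: subset_iff)
      qed
      ultimately show ?thesis using x True e by (intro exI conjI) auto
    qed
  qed
qed auto

text \<open>The set where \<open>N\<close> fails to be positive is compact and misses the diagonal,
  so \<open>\<bar>t - t'\<bar>\<close> has a positive lower bound on it, valid for all
  \<open>x\<close> at once.\<close>

lemma uniform_steps:
  fixes N :: "real \<Rightarrow> real \<Rightarrow> 'a::topological_space \<Rightarrow> real"
  assumes S: "compact S"
    and N: "continuous_on ({0..1} \<times> {0..1} \<times> S) (\<lambda>(t, t', x). N t t' x)"
    and pos: "\<And>t x. 0 \<le> t \<Longrightarrow> t \<le> 1 \<Longrightarrow> x \<in> S \<Longrightarrow> 0 < N t t x"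
  obtains M :: nat where "M > 0" "\<And>j x. j < M \<Longrightarrow> x \<in> S \<Longrightarrow> 0 < N (real j / M) (real (Suc j) / M) x"
proof -
  define D where "D = {0..1::real} \<times> {0..1::real} \<times> S"
  define C where "C = D \<inter> (\<lambda>(t, t', x). N t t' x) -` {..0}"
  have "compact D" unfolding D_def by (intro compact_Times S) auto
  moreover have "closedin (top_of_set D) C"
    unfolding C_def using N by (intro continuous_closedin_preimage) (auto simp: D_def)
  ultimately have C: "compact C" by (rule closedin_compact)
  obtain d where d: "d > 0" "\<And>t t' x. (t, t', x) \<in> C \<Longrightarrow> d \<le> \<bar>t - t'\<bar>"
  proof (cases "C = {}")
    case True
    then show ?thesis using that[of 1] by auto
  next
    case False
    have "continuous_on C (\<lambda>(t, t', x). \<bar>t - t'\<bar>)"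
      by (auto simp: case_prod_unfold intro!: continuous_intros)
    then obtain c where c: "c \<in> C" "\<forall>y\<in>C. (\<lambda>(t, t', x). \<bar>t - t'\<bar>) c \<le> (\<lambda>(t, t', x). \<bar>t - t'\<bar>) y"
      using continuous_attains_inf[OF C False] by blast
    obtain t t' x where tx: "c = (t, t', x)" by (cases c)
    have "t \<noteq> t'" using c(1) pos[of t x] by (auto simp: tx C_def D_def)
    then show ?thesis using that[of "\<bar>t - t'\<bar>"] c(2) by (fastforce simp: tx)
  qed
  obtain M :: nat where M: "1 / d < real M" using reals_Archimedean2 by blast
  have M0: "M > 0" using M d by (cases "M = 0") auto
  show thesis
  proof (rule that[OF M0])
    fix j x assume j: "j < M" "x \<in> S"
    show "0 < N (real j / M) (real (Suc j) / M) x"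
    proof (rule ccontr)
      assume "\<not> ?thesis"
      then have "(real j / M, real (Suc j) / M, x) \<in> C"
        using j by (auto simp: C_def D_def field_simps)
      then have "d \<le> \<bar>real j / M - real (Suc j) / M\<bar>" using d(2) by blast
      also have "\<dots> = 1 / M" using M0 by (simp add: diff_divide_distrib[symmetric])
      finally show False using M M0 d by (simp add: field_simps)
    qed
  qed
qed

definition star_at :: "('v \<Rightarrow> real) \<Rightarrow> ('v \<Rightarrow> real) set \<Rightarrow> bool" where
  "star_at c S \<longleftrightarrow> c \<in> S \<and> (\<forall>x\<in>S. \<forall>t\<in>{0..1}. seg c x t \<in> S)"

lemma seg_simps [simp]: "seg p q 0 = p" "seg p q 1 = q" "seg p p t = p"
  by (auto simp: seg_def algebra_simps)

lemma continuous_on_seg: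
  fixes g :: "'a::topological_space \<Rightarrow> 'v \<Rightarrow> real"
  assumes "continuous_on A f" "continuous_on A g" "continuous_on A h"
  shows "continuous_on A (\<lambda>x. seg (g x) (h x) (f x))"
  unfolding seg_def
  by (intro continuous_on_coordinatewise_then_product continuous_intros assms
      continuous_on_product_then_coordinatewise[OF assms(2)] continuous_on_product_then_coordinatewise[OF assms(3)])

lemma star_at_connected:
  assumes "star_at c S" shows "connected S"
proof -
  have "S = (\<Union>x\<in>S. seg c x ` {0..1})"
  proof
    show "S \<subseteq> (\<Union>x\<in>S. seg c x ` {0..1})"
      using seg_simps(2) by (force intro: image_eqI[of _ _ 1])
  qed (use assms in \<open>auto simp: star_at_def\<close>)
  moreover have "connected (\<Union>x\<in>S. seg c x ` {0..1})"
  proof (rule connected_Union)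
    show "connected T" if "T \<in> (\<lambda>x. seg c x ` {0..1}) ` S" for T
      using that by (auto intro!: connected_continuous_image continuous_on_seg continuous_on_id continuous_on_const)
    have "c \<in> seg c x ` {0..1}" for x by (rule image_eqI[of _ _ 0]) auto
    then show "\<Inter> ((\<lambda>x. seg c x ` {0..1}) ` S) \<noteq> {}" by blast
  qed
  ultimately show ?thesis by simp
qed

lemma continuous_on_seg_comp:
  fixes f :: "('v \<Rightarrow> real) \<Rightarrow> 'a::topological_space"
  assumes "continuous_on S f" "star_at c S" "continuous_on A g" "continuous_on A h"
    and "\<And>y. y \<in> A \<Longrightarrow> h y \<in> S \<and> 0 \<le> g y \<and> g y \<le> 1"
  shows "continuous_on A (\<lambda>y. f (seg c (h y) (g y)))"
  by (rule continuous_on_compose2[OF assms(1)])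
    (use assms in \<open>auto simp: star_at_def intro!: continuous_on_seg continuous_on_const\<close>)

text \<open>Along the rays from \<open>c\<close>, short enough steps change \<open>f\<close> by
  factors within distance 1 of 1. The principal logarithms of these factors are continuous in the
  end point, and their sum telescopes to a logarithm of \<open>f\<close>.\<close>

lemma star_at_log:
  fixes f :: "('v \<Rightarrow> real) \<Rightarrow> complex"
  assumes S: "compact S" "star_at c S" and f: "continuous_on S f" and nz: "\<And>x. x \<in> S \<Longrightarrow> f x \<noteq> 0"
  obtains F where "continuous_on S F" "\<And>x. x \<in> S \<Longrightarrow> f x = exp (F x)"
proof -
  have in_S: "seg c x t \<in> S" if "x \<in> S" "0 \<le> t" "t \<le> 1" for x t
    using S(2) that by (auto simp: star_at_def)
  define N where "N t t' x = 1 - norm (f (seg c x t') / f (seg c x t) - 1)" for t t' x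
  have "continuous_on ({0..1} \<times> {0..1} \<times> S) (\<lambda>(t, t', x). N t t' x)"
    unfolding N_def case_prod_unfold
    by (intro continuous_intros continuous_on_seg_comp[OF f S(2)]) (auto simp: nz in_S)
  moreover have "0 < N t t x" if "0 \<le> t" "t \<le> 1" "x \<in> S" for t x
    using nz[OF in_S] that by (simp add: N_def)
  ultimately obtain M :: nat where M: "M > 0"
    "\<And>j x. j < M \<Longrightarrow> x \<in> S \<Longrightarrow> 0 < N (real j / M) (real (Suc j) / M) x"
    using uniform_steps[OF S(1)] by blast
  define \<rho> where "\<rho> j x = f (seg c x (real (Suc j) / M)) / f (seg c x (real j / M))" for j x
  have \<rho>: "\<rho> j x \<notin> \<real>\<^sub>\<le>\<^sub>0" if "j < M" "x \<in> S" for j x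
  proof
    assume "\<rho> j x \<in> \<real>\<^sub>\<le>\<^sub>0"
    then have "Re (\<rho> j x) \<le> 0" by (auto simp: complex_nonpos_Reals_iff)
    moreover have "\<bar>Re (\<rho> j x - 1)\<bar> < 1"
      using M(2)[OF that] abs_Re_le_cmod[of "\<rho> j x - 1"] by (simp add: N_def \<rho>_def)
    ultimately show False by simp
  qed
  define F where "F x = Ln (f c) + (\<Sum>j<M. Ln (\<rho> j x))" for x
  have "continuous_on S (\<rho> j)" if "j < M" for j
    unfolding \<rho>_def
    by (intro continuous_intros continuous_on_seg_comp[OF f S(2)]) (use that in \<open>auto simp: nz in_S\<close>)
  then have "continuous_on S F"
    unfolding F_def by (intro continuous_intros) (use \<rho> in auto)
  moreover have "f x = exp (F x)" if x: "x \<in> S" for x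
  proof -
    have "exp (Ln (f c) + (\<Sum>j<n. Ln (\<rho> j x))) = f (seg c x (real n / M))" if "n \<le> M" for n
      using that
    proof (induction n)
      case 0
      have "f c \<noteq> 0" using nz S(2) by (auto simp: star_at_def)
      then show ?case by simp
    next
      case (Suc n)
      have "f (seg c x (real n / M)) \<noteq> 0" "f (seg c x (real (Suc n) / M)) \<noteq> 0"
        using nz in_S[OF x] Suc.prems by auto
      then have "exp (Ln (\<rho> n x)) = \<rho> n x"
        "\<rho> n x * f (seg c x (real n / M)) = f (seg c x (real (Suc n) / M))"
        by (auto simp: \<rho>_def)
      then show ?case using Suc by (simp add: exp_add mult_ac)
    qed
    from this[of M] show ?thesis using M(1) by (simp add: F_def)
  qed
  ultimately show thesis by (rule that)
qed

lemma star_at_angle: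
  fixes f :: "('v \<Rightarrow> real) \<Rightarrow> complex"
  assumes S: "compact S" "star_at c S" and f: "continuous_on S f" and n: "\<And>x. x \<in> S \<Longrightarrow> norm (f x) = 1"
  obtains h where "continuous_on S h" "\<And>x. x \<in> S \<Longrightarrow> f x = cis (2 * pi * h x)"
proof -
  have "f x \<noteq> 0" if "x \<in> S" for x using n[OF that] by auto
  then obtain F where F: "continuous_on S F" "\<And>x. x \<in> S \<Longrightarrow> f x = exp (F x)"
    using star_at_log[OF S f] by blast
  show thesis
  proof (rule that)
    show "continuous_on S (\<lambda>x. Im (F x) / (2 * pi))"
      using F by (intro continuous_intros) auto
    fix x assume x: "x \<in> S"
    have "exp (Re (F x)) = 1" using F(2)[OF x] n[OF x] by simp
    then show "f x = cis (2 * pi * (Im (F x) / (2 * pi)))"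
      unfolding F(2)[OF x] by (subst exp_eq_polar) simp
  qed
qed

lemma cis_2pi_eq_1_iff: "cis (2 * pi * r) = 1 \<longleftrightarrow> r \<in> \<int>"
proof -
  have "cis (2 * pi * r) = qcis (4 * r)" by (simp add: qcis_def mult_ac)
  also have "\<dots> = 1 \<longleftrightarrow> (\<exists>n. r = of_int n)" by (simp add: qcis_eq_1_iff)
  finally show ?thesis by (auto simp: Ints_def)
qed

lemma connected_Ints_constant:
  fixes h :: "'a::topological_space \<Rightarrow> real"
  assumes "connected S" "continuous_on S h" "\<And>x. x \<in> S \<Longrightarrow> h x \<in> \<int>" "x \<in> S" "y \<in> S"
  shows "h x = h y"
proof -
  have "h constant_on S"
  proof (rule continuous_discrete_range_constant[OF assms(1,2)])
    fix x assume x: "x \<in> S"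
    have "1 \<le> norm (h y - h x)" if "y \<in> S" "h y \<noteq> h x" for y
      using assms(3)[OF x] assms(3)[OF that(1)] that(2) by (auto elim!: Ints_cases)
    then show "\<exists>e>0. \<forall>y. y \<in> S \<and> h y \<noteq> h x \<longrightarrow> e \<le> norm (h y - h x)" by (intro exI[of _ 1]) auto
  qed
  then show ?thesis using assms by (auto simp: constant_on_def)
qed

text \<open>Owing to this rigidity, later identities between lifts need to be checked at a single
  point only.\<close>

lemma cis_lift_difference:
  fixes g h :: "'a::topological_space \<Rightarrow> real"
  assumes "connected S" "continuous_on S g" "continuous_on S h"
    and "\<And>x. x \<in> S \<Longrightarrow> cis (2 * pi * g x) = cis (2 * pi * h x)" "x \<in> S" "y \<in> S"
  shows "g x - h x = g y - h y" "g x - h x \<in> \<int>"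
proof -
  have *: "g x - h x \<in> \<int>" if "x \<in> S" for x
  proof -
    have "cis (2 * pi * (g x - h x)) = 1"
      using assms(4)[OF that] by (simp add: right_diff_distrib cis_divide[symmetric])
    then show ?thesis by (simp only: cis_2pi_eq_1_iff)
  qed
  then show "g x - h x \<in> \<int>" using assms by blast
  show "g x - h x = g y - h y"
    by (rule connected_Ints_constant[OF assms(1) _ * assms(5,6)]) (intro continuous_intros assms)
qed

section \<open>Closed stars\<close>

lemma sum_supp: "finite A \<Longrightarrow> supp x \<subseteq> A \<Longrightarrow> sum x (supp x) = sum x A"
  by (rule sum.mono_neutral_left) (auto simp: supp_def)

lemma simplicial_complex_faces: "finite \<sigma> \<Longrightarrow> simplicial_complex \<sigma> (faces \<sigma>)"
  by (auto simp: simplicial_complex_def faces_def)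

lemma simplicial_complexD:
  assumes "simplicial_complex V K"
  shows "finite V" "finite K" "\<sigma> \<in> K \<Longrightarrow> finite \<sigma>" "\<sigma> \<in> K \<Longrightarrow> \<sigma> \<noteq> {}" "\<sigma> \<in> K \<Longrightarrow> \<sigma> \<subseteq> V"
    "\<sigma> \<in> K \<Longrightarrow> \<tau> \<subseteq> \<sigma> \<Longrightarrow> \<tau> \<noteq> {} \<Longrightarrow> \<tau> \<in> K"
proof -
  show "finite V" "\<sigma> \<in> K \<Longrightarrow> \<sigma> \<noteq> {}" "\<sigma> \<in> K \<Longrightarrow> \<sigma> \<subseteq> V" "\<sigma> \<in> K \<Longrightarrow> \<tau> \<subseteq> \<sigma> \<Longrightarrow> \<tau> \<noteq> {} \<Longrightarrow> \<tau> \<in> K"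
    using assms unfolding simplicial_complex_def by metis+
  then show "\<sigma> \<in> K \<Longrightarrow> finite \<sigma>" using finite_subset by metis
  have "K \<subseteq> Pow V" using assms unfolding simplicial_complex_def by blast
  then show "finite K" using \<open>finite V\<close> finite_subset by blast
qed

lemma supp_vtx [simp]: "supp (vtx v) = {v}"
  by (auto simp: supp_def vtx_def)

lemma vtx_in_geom: "{v} \<in> K \<Longrightarrow> vtx v \<in> geom K"
  by (auto simp: geom_supp) (auto simp: vtx_def)

lemma geom_sum: "x \<in> geom K \<Longrightarrow> finite A \<Longrightarrow> supp x \<subseteq> A \<Longrightarrow> sum x A = 1"
  using sum_supp[of A x] by (simp add: geom_supp)

lemma seg_in_geom:
  assumes K: "simplicial_complex V K" and x: "x \<in> geom K" and y: "y \<in> geom K" and t: "0 \<le> t" "t \<le> 1"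
    and xy: "supp x \<union> supp y \<in> K"
  shows "seg x y t \<in> geom K" and "supp (seg x y t) \<subseteq> supp x \<union> supp y"
proof -
  show s: "supp (seg x y t) \<subseteq> supp x \<union> supp y" by (auto simp: supp_def seg_def)
  have f: "finite (supp x \<union> supp y)" using simplicial_complexD(3)[OF K xy] .
  have "sum (seg x y t) (supp x \<union> supp y) = (1 - t) * sum x (supp x \<union> supp y) + t * sum y (supp x \<union> supp y)"
    by (simp add: seg_def sum.distrib sum_distrib_left)
  also have "\<dots> = 1" using geom_sum[OF x f] geom_sum[OF y f] by simp
  finally have 1: "sum (seg x y t) (supp (seg x y t)) = 1" using sum_supp[OF f s] by simp
  then have "supp (seg x y t) \<noteq> {}" by auto
  then have "supp (seg x y t) \<in> K" using simplicial_complexD(6)[OF K xy s] by blast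
  moreover have "0 \<le> seg x y t v" for v using x y t by (auto simp: seg_def geom_supp)
  ultimately show "seg x y t \<in> geom K" using 1 by (simp add: geom_supp)
qed

text \<open>The closed star of a simplex of \<open>K\<close>, and the whole realisation for
  \<open>\<tau> = {}\<close>. Closed stars are used because lifting and descent rest on compactness.
  The overlap attached to an edge is the star of the edge rather than the intersection of two vertex
  stars, because it is star-shaped.\<close>

definition cstar :: "'v set set \<Rightarrow> 'v set \<Rightarrow> ('v \<Rightarrow> real) set" where
  "cstar K \<tau> = {x \<in> geom K. supp x \<union> \<tau> \<in> K}"

lemma cstar_subset: "cstar K \<tau> \<subseteq> geom K"
  by (auto simp: cstar_def)

lemma cstar_mono:
  assumes K: "simplicial_complex V K" and "\<tau> \<subseteq> \<tau>'"
  shows "cstar K \<tau>' \<subseteq> cstar K \<tau>"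
proof
  fix x assume "x \<in> cstar K \<tau>'"
  then have x: "x \<in> geom K" "supp x \<union> \<tau>' \<in> K" by (auto simp: cstar_def)
  then have "supp x \<noteq> {}" using simplicial_complexD(4)[OF K] by (auto simp: geom_supp)
  then have "supp x \<union> \<tau> \<in> K"
    by (intro simplicial_complexD(6)[OF K x(2)]) (use assms in auto)
  then show "x \<in> cstar K \<tau>" using x by (simp add: cstar_def)
qed

lemma geom_eq_cstar: "geom K = cstar K {}"
  by (auto simp: cstar_def geom_supp)

lemma star_at_cstar:
  assumes K: "simplicial_complex V K" and \<tau>: "\<tau> \<in> K" "v \<in> \<tau>"
  shows "star_at (vtx v) (cstar K \<tau>)"
  unfolding star_at_def
proof (intro conjI ballI)
  have v: "vtx v \<in> geom K"
    using simplicial_complexD(6)[OF K \<tau>(1), of "{v}"] \<tau> by (intro vtx_in_geom) auto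
  then show "vtx v \<in> cstar K \<tau>" using \<tau> by (auto simp: cstar_def insert_absorb)
  fix x and t :: real assume x: "x \<in> cstar K \<tau>" and t: "t \<in> {0..1}"
  have xK: "x \<in> geom K" "supp x \<union> \<tau> \<in> K" using x by (auto simp: cstar_def)
  have sub: "supp (vtx v) \<union> supp x \<subseteq> supp x \<union> \<tau>" using \<tau> by auto
  have "supp (vtx v) \<union> supp x \<in> K"
    by (rule simplicial_complexD(6)[OF K xK(2) sub]) auto
  note s = seg_in_geom[OF K v xK(1) _ _ this, of t]
  have "supp (seg (vtx v) x t) \<union> \<tau> \<in> K"
    by (rule simplicial_complexD(6)[OF K xK(2)]) (use s t sub \<tau> in auto)
  then show "seg (vtx v) x t \<in> cstar K \<tau>" using s t by (auto simp: cstar_def)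
qed

text \<open>The vertex type may be infinite, so the points lie in an infinite product; the cube is
  compact by Tychonoff and the simplex is cut out of it by closed conditions.\<close>

lemma compact_geom_faces:
  assumes "finite \<sigma>" shows "compact (geom (faces \<sigma>))"
proof -
  define B where "B = (PiE UNIV (\<lambda>_. {0..1}) :: ('a \<Rightarrow> real) set)"
  have "compactin (product_topology (\<lambda>_. euclidean) UNIV) B"
    unfolding B_def by (subst compactin_PiE) auto
  then have B: "compact B" by (simp add: euclidean_product_topology)
  define C where "C = (\<Inter>v. {x. 0 \<le> x v}) \<inter> (\<Inter>v\<in>-\<sigma>. {x::'a \<Rightarrow> real. x v = 0}) \<inter> {x. sum x \<sigma> = 1}"
  have "closed C"
    unfolding C_def
    by (intro closed_Int closed_INT ballI closed_Collect_le closed_Collect_eq continuous_intros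
        continuous_on_product_coordinates)
  moreover have "geom (faces \<sigma>) = B \<inter> C"
  proof
    show "geom (faces \<sigma>) \<subseteq> B \<inter> C"
    proof
      fix x assume x: "x \<in> geom (faces \<sigma>)"
      then have s: "supp x \<subseteq> \<sigma>" "\<And>v. 0 \<le> x v" by (auto simp: geom_supp faces_def)
      have 1: "sum x \<sigma> = 1" using geom_sum[OF x assms s(1)] .
      have "x v \<le> 1" for v
      proof (cases "v \<in> \<sigma>")
        case True
        then show ?thesis using member_le_sum[of v \<sigma> x] s assms 1 by auto
      next
        case False
        then have "x v = 0" using s by (auto simp: supp_def)
        then show ?thesis by simp
      qed
      then show "x \<in> B \<inter> C" using s 1 by (auto simp: B_def C_def supp_def)
    qed
    show "B \<inter> C \<subseteq> geom (faces \<sigma>)"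
    proof
      fix x assume "x \<in> B \<inter> C"
      then have x: "\<And>v. 0 \<le> x v" "supp x \<subseteq> \<sigma>" "sum x \<sigma> = 1" by (auto simp: C_def supp_def)
      then have "sum x (supp x) = 1" using sum_supp[OF assms x(2)] by simp
      moreover from this have "supp x \<noteq> {}" by auto
      ultimately show "x \<in> geom (faces \<sigma>)" using x by (auto simp: geom_supp faces_def)
    qed
  qed
  ultimately show ?thesis using B by (simp add: compact_Int_closed)
qed

lemma compact_cstar:
  assumes K: "simplicial_complex V K" shows "compact (cstar K \<tau>)"
proof -
  have "cstar K \<tau> = (\<Union>\<sigma>\<in>{\<sigma>\<in>K. \<tau> \<subseteq> \<sigma>}. geom (faces \<sigma>))"
  proof
    show "cstar K \<tau> \<subseteq> (\<Union>\<sigma>\<in>{\<sigma>\<in>K. \<tau> \<subseteq> \<sigma>}. geom (faces \<sigma>))"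
    proof
      fix x assume "x \<in> cstar K \<tau>"
      then have x: "x \<in> geom K" "supp x \<union> \<tau> \<in> K" by (auto simp: cstar_def)
      then have "x \<in> geom (faces (supp x \<union> \<tau>))"
        using simplicial_complexD(4)[OF K, of "supp x"] by (auto simp: geom_supp faces_def)
      then show "x \<in> (\<Union>\<sigma>\<in>{\<sigma>\<in>K. \<tau> \<subseteq> \<sigma>}. geom (faces \<sigma>))" using x by blast
    qed
    show "(\<Union>\<sigma>\<in>{\<sigma>\<in>K. \<tau> \<subseteq> \<sigma>}. geom (faces \<sigma>)) \<subseteq> cstar K \<tau>"
    proof
      fix x assume "x \<in> (\<Union>\<sigma>\<in>{\<sigma>\<in>K. \<tau> \<subseteq> \<sigma>}. geom (faces \<sigma>))"
      then obtain \<sigma> where \<sigma>: "\<sigma> \<in> K" "\<tau> \<subseteq> \<sigma>" "x \<in> geom (faces \<sigma>)" by auto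
      then have s: "supp x \<subseteq> \<sigma>" "supp x \<noteq> {}" by (auto simp: geom_supp faces_def)
      have "supp x \<in> K" "supp x \<union> \<tau> \<in> K"
        using simplicial_complexD(6)[OF K \<sigma>(1)] s \<sigma>(2) by auto
      then show "x \<in> cstar K \<tau>" using \<sigma>(3) by (auto simp: cstar_def geom_supp)
    qed
  qed
  moreover have "finite {\<sigma>\<in>K. \<tau> \<subseteq> \<sigma>}" using simplicial_complexD(2)[OF K] by simp
  ultimately show ?thesis
    using compact_geom_faces simplicial_complexD(3)[OF K] by (auto intro!: compact_UN)
qed

lemma geom_faces_subset_cstar:
  assumes K: "simplicial_complex V K" and "\<sigma> \<in> K" "\<tau> \<subseteq> \<sigma>"
  shows "geom (faces \<sigma>) \<subseteq> cstar K \<tau>"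
proof
  fix x assume x: "x \<in> geom (faces \<sigma>)"
  then have s: "supp x \<subseteq> \<sigma>" "supp x \<noteq> {}" by (auto simp: geom_supp faces_def)
  have "supp x \<in> K" "supp x \<union> \<tau> \<in> K"
    using simplicial_complexD(6)[OF K assms(2)] s assms(3) by auto
  then show "x \<in> cstar K \<tau>" using x by (auto simp: cstar_def geom_supp)
qed

lemma star_at_geom_faces:
  assumes "finite \<sigma>" "v \<in> \<sigma>" shows "star_at (vtx v) (geom (faces \<sigma>))"
proof -
  have "geom (faces \<sigma>) = cstar (faces \<sigma>) {v}"
    using assms by (auto simp: cstar_def geom_supp faces_def)
  then show ?thesis
    using star_at_cstar[OF simplicial_complex_faces[OF assms(1)], of "{v}" v] assms
    by (auto simp: faces_def)
qed

section \<open>Circle bundles over a simplicial complex\<close>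

locale bundle_over_complex =
  fixes V :: "'v set" and K :: "'v set set"
    and E :: "'e topology" and p :: "'e \<Rightarrow> 'v \<Rightarrow> real" and act :: "complex \<Rightarrow> 'e \<Rightarrow> 'e"
  assumes K: "simplicial_complex V K" and circ: "circle_bundle E p act (geom K)"
begin

definition over :: "('v \<Rightarrow> real) set \<Rightarrow> 'e set" where
  "over S = {\<xi> \<in> topspace E. p \<xi> \<in> S}"

lemma Hausdorff_base: "Hausdorff_space (top_of_set S)" for S :: "('a \<Rightarrow> real) set"
proof -
  have "Hausdorff_space (product_topology (\<lambda>_::'a. euclideanreal) UNIV)"
    by (simp add: Hausdorff_space_product_topology)
  then show ?thesis by (simp add: euclidean_product_topology Hausdorff_space_subtopology)
qed

lemma compact_base: "compact (geom K)"
  using compact_cstar[OF K, of "{}"] by (simp add: geom_eq_cstar)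

lemma p_continuous: "continuous_map E (top_of_set (geom K)) p"
  and p_image: "p ` topspace E = geom K"
  using circ by (auto simp: circle_bundle_def)

lemma p_continuous': "continuous_map E euclidean p"
  using p_continuous continuous_map_in_subtopology by blast

lemma p_coord_continuous: "continuous_map E euclideanreal (\<lambda>\<xi>. p \<xi> v)"
proof -
  have "continuous_map E euclideanreal ((\<lambda>x. x v) \<circ> p)"
    by (rule continuous_map_compose[OF p_continuous']) simp
  then show ?thesis by (simp add: o_def)
qed

lemma p_in: "\<xi> \<in> topspace E \<Longrightarrow> p \<xi> \<in> geom K"
  using p_image by blast

lemma fibre_nonempty: "x \<in> geom K \<Longrightarrow> \<exists>\<xi>\<in>topspace E. p \<xi> = x"
  using p_image by (metis imageE)

lemma act_in: "\<xi> \<in> topspace E \<Longrightarrow> norm z = 1 \<Longrightarrow> act z \<xi> \<in> topspace E"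
  and p_act: "\<xi> \<in> topspace E \<Longrightarrow> norm z = 1 \<Longrightarrow> p (act z \<xi>) = p \<xi>"
  and act_1: "\<xi> \<in> topspace E \<Longrightarrow> act 1 \<xi> = \<xi>"
  using circ by (auto simp: circle_bundle_def)

lemma local_trivD:
  assumes "local_triv E p act U \<phi>" "\<xi> \<in> topspace E" "p \<xi> \<in> U"
  shows "fst (\<phi> \<xi>) = p \<xi>" "norm z = 1 \<Longrightarrow> \<phi> (act z \<xi>) = (p \<xi>, z * snd (\<phi> \<xi>))" "norm (snd (\<phi> \<xi>)) = 1"
proof -
  show "fst (\<phi> \<xi>) = p \<xi>" "norm z = 1 \<Longrightarrow> \<phi> (act z \<xi>) = (p \<xi>, z * snd (\<phi> \<xi>))"
    using assms by (auto simp: local_triv_def)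
  have "\<phi> ` topspace (subtopology E {x \<in> topspace E. p x \<in> U}) = U \<times> sphere 0 1"
    using assms(1) homeomorphic_imp_surjective_map by (fastforce simp: local_triv_def)
  then have "\<phi> \<xi> \<in> U \<times> sphere 0 1" using assms by auto
  then show "norm (snd (\<phi> \<xi>)) = 1" by auto
qed

lemma chart_at:
  assumes "x \<in> geom K"
  obtains U \<phi> where "openin (top_of_set (geom K)) U" "x \<in> U" "local_triv E p act U \<phi>"
  using assms circ unfolding circle_bundle_def by blast

lemma fibre_transitive:
  assumes "\<xi> \<in> topspace E" "\<eta> \<in> topspace E" "p \<xi> = p \<eta>"
  obtains z where "norm z = 1" "\<eta> = act z \<xi>"
proof -
  obtain U \<phi> where U: "p \<xi> \<in> U" "local_triv E p act U \<phi>"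
    using chart_at[OF p_in[OF assms(1)]] by blast
  note D = local_trivD[OF U(2) assms(1) U(1)] 
  have D': "fst (\<phi> \<eta>) = p \<eta>" "norm (snd (\<phi> \<eta>)) = 1"
    using local_trivD(1,3)[OF U(2) assms(2)] U(1) assms(3) by auto
  define z where "z = snd (\<phi> \<eta>) / snd (\<phi> \<xi>)"
  have nz: "snd (\<phi> \<xi>) \<noteq> 0" using D(3) by auto
  have z: "norm z = 1" using D(3) D'(2) by (simp add: z_def norm_divide)
  have "\<phi> (act z \<xi>) = \<phi> \<eta>"
    using D(2)[OF z] D' nz assms(3) by (simp add: z_def prod_eq_iff)
  moreover have "inj_on \<phi> (topspace (subtopology E {x \<in> topspace E. p x \<in> U}))"
    using U(2) homeomorphic_imp_injective_map unfolding local_triv_def by blast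
  ultimately have "act z \<xi> = \<eta>"
    using act_in[OF assms(1) z] p_act[OF assms(1) z] assms U(1) by (auto simp: inj_on_def)
  then show thesis using that z by blast
qed

text \<open>The bump functions come from complete regularity of the compact Hausdorff base. In place
  of a partition of unity it suffices that some bump exceeds 1/2 at each point: the closed sets
  where a bump is at least 1/2 still cover and lie inside the charts.\<close>

lemma finite_charts:
  obtains I U \<phi> and \<rho> :: "('v \<Rightarrow> real) \<Rightarrow> ('v \<Rightarrow> real) \<Rightarrow> real"
  where "finite I" "\<And>i. i \<in> I \<Longrightarrow> local_triv E p act (U i) (\<phi> i)" "\<And>i. i \<in> I \<Longrightarrow> U i \<subseteq> geom K"
    "\<And>i. i \<in> I \<Longrightarrow> continuous_on (geom K) (\<rho> i)" "\<And>i x. i \<in> I \<Longrightarrow> x \<in> geom K \<Longrightarrow> x \<notin> U i \<Longrightarrow> \<rho> i x = 0"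
    "\<And>x. x \<in> geom K \<Longrightarrow> \<exists>i\<in>I. 1 / 2 < \<rho> i x"
proof -
  let ?X = "top_of_set (geom K)"
  have cr: "completely_regular_space ?X"
    by (intro normal_imp_completely_regular_space compact_Hausdorff_or_regular_imp_normal_space)
      (use compact_base Hausdorff_base in \<open>auto simp: compact_space_subtopology\<close>)
  define Q where "Q y U \<phi> \<rho> \<longleftrightarrow> local_triv E p act U \<phi> \<and> U \<subseteq> geom K \<and> continuous_on (geom K) \<rho>
      \<and> (\<forall>x\<in>geom K - U. \<rho> x = 0) \<and> \<rho> y = (1::real)" for y U \<phi> and \<rho> :: "('v \<Rightarrow> real) \<Rightarrow> real"
  have "\<exists>t. Q y (fst t) (fst (snd t)) (snd (snd t))"
    if y: "y \<in> geom K" for y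
  proof -
    obtain U \<phi> where U: "openin ?X U" "y \<in> U" "local_triv E p act U \<phi>" using chart_at[OF y] .
    have "closedin ?X (geom K - U)" using U(1) by auto
    then obtain f where f: "continuous_map ?X (top_of_set {0..1::real}) f" "f y = 0" "f ` (geom K - U) \<subseteq> {1}"
      using cr[unfolded completely_regular_space_def, rule_format, of "geom K - U" y] U(2) y by auto
    have "continuous_on (geom K) f" using f(1) continuous_map_in_subtopology by fastforce
    then have "continuous_on (geom K) (\<lambda>x. 1 - f x)" by (intro continuous_intros)
    moreover have "U \<subseteq> geom K" using U(1) openin_imp_subset by blast
    ultimately show ?thesis
      using U(3) f unfolding Q_def by (intro exI[of _ "(U, \<phi>, \<lambda>x. 1 - f x)"]) auto
  qed
  then have "\<forall>y\<in>geom K. \<exists>t. Q y (fst t) (fst (snd t)) (snd (snd t))" by blast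
  from bchoice[OF this]
  obtain t where t: "\<forall>y\<in>geom K. Q y (fst (t y)) (fst (snd (t y))) (snd (snd (t y)))" ..
  define U \<phi> \<rho> where "U = (\<lambda>y. fst (t y))" and "\<phi> = (\<lambda>y. fst (snd (t y)))" and "\<rho> = (\<lambda>y. snd (snd (t y)))"
  have A: "\<And>y. y \<in> geom K \<Longrightarrow> local_triv E p act (U y) (\<phi> y)" "\<And>y. y \<in> geom K \<Longrightarrow> U y \<subseteq> geom K"
    "\<And>y. y \<in> geom K \<Longrightarrow> continuous_on (geom K) (\<rho> y)"
    "\<And>y x. y \<in> geom K \<Longrightarrow> x \<in> geom K \<Longrightarrow> x \<notin> U y \<Longrightarrow> \<rho> y x = 0" "\<And>y. y \<in> geom K \<Longrightarrow> \<rho> y y = (1::real)"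
    using t unfolding Q_def U_def \<phi>_def \<rho>_def by blast+
  define Nb where "Nb y = {x \<in> geom K. 1 / 2 < \<rho> y x}" for y
  have op: "openin ?X (Nb y)" if "y \<in> geom K" for y
    using openin_continuous_map_preimage[of ?X euclideanreal "\<rho> y" "{1/2<..}"] A(3)[OF that]
    by (simp add: Nb_def)
  have cov: "geom K \<subseteq> \<Union> (Nb ` geom K)" using A(5) by (force simp: Nb_def)
  have "compactin ?X (geom K)" using compact_base by (simp add: compactin_subtopology)
  then obtain \<F> where \<F>: "finite \<F>" "\<F> \<subseteq> Nb ` geom K" "geom K \<subseteq> \<Union> \<F>"
    using compactinD[of ?X "geom K" "Nb ` geom K"] op cov by blast
  obtain I where I: "finite I" "I \<subseteq> geom K" "\<F> = Nb ` I" using finite_subset_image[OF \<F>(1,2)] by blast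
  show thesis
  proof (rule that[of I U \<phi> \<rho>])
    fix x assume "x \<in> geom K"
    then have "x \<in> \<Union> (Nb ` I)" using \<F>(3) I(3) by blast
    then show "\<exists>i\<in>I. 1 / 2 < \<rho> i x" by (auto simp: Nb_def)
  next
    show "\<rho> i x = 0" if "i \<in> I" "x \<in> geom K" "x \<notin> U i" for i x
      using A(4)[OF subsetD[OF I(2) that(1)] that(2,3)] .
  qed (use A(1-3) I(1,2) in blast)+
qed

text \<open>Over each closed set where a bump is at least 1/2 a chart identifies the bundle with a
  product of compact spaces, and finitely many of these parts cover \<open>E\<close>.\<close>

lemma compact_total: "compact_space E"
proof -
  obtain I U \<phi> and \<rho> :: "('v \<Rightarrow> real) \<Rightarrow> ('v \<Rightarrow> real) \<Rightarrow> real"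
    where I: "finite I" and tr: "\<And>i. i \<in> I \<Longrightarrow> local_triv E p act (U i) (\<phi> i)"
      and U: "\<And>i. i \<in> I \<Longrightarrow> U i \<subseteq> geom K"
      and \<rho>: "\<And>i. i \<in> I \<Longrightarrow> continuous_on (geom K) (\<rho> i)" "\<And>i x. i \<in> I \<Longrightarrow> x \<in> geom K \<Longrightarrow> x \<notin> U i \<Longrightarrow> \<rho> i x = 0"
      and cov: "\<And>x. x \<in> geom K \<Longrightarrow> \<exists>i\<in>I. 1 / 2 < \<rho> i x"
    by (rule finite_charts, rule that)
  have "compactin E (over {x \<in> geom K. 1 / 2 \<le> \<rho> i x})" if i: "i \<in> I" for i
  proof -
    let ?D = "{x \<in> geom K. 1 / 2 \<le> \<rho> i x}" and ?P = "subtopology E {x \<in> topspace E. p x \<in> U i}"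
    have "closedin (top_of_set (geom K)) ?D"
      using continuous_closedin_preimage[OF \<rho>(1)[OF i], of "{1/2..}"] by (simp add: vimage_def Int_def)
    then have D: "compact ?D" using compact_base closedin_compact by blast
    have DU: "?D \<subseteq> U i" using \<rho>(2)[OF i] by force
    obtain g where g: "homeomorphic_maps ?P (prod_topology (top_of_set (U i)) (top_of_set (sphere 0 1))) (\<phi> i) g"
      using tr[OF i] homeomorphic_map_maps unfolding local_triv_def by blast
    have "compactin (prod_topology (top_of_set (U i)) (top_of_set (sphere 0 1))) (?D \<times> sphere (0::complex) 1)"
      using D DU by (auto simp: compactin_subtopology intro!: compact_Times)
    then have "compactin ?P (g ` (?D \<times> sphere 0 1))"
      using g image_compactin unfolding homeomorphic_maps_def by blast
    moreover have "g ` (?D \<times> sphere 0 1) = over ?D"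
    proof
      show "g ` (?D \<times> sphere 0 1) \<subseteq> over ?D"
      proof
        fix \<xi> assume "\<xi> \<in> g ` (?D \<times> sphere 0 1)"
        then obtain x z where xz: "x \<in> ?D" "z \<in> sphere 0 1" "\<xi> = g (x, z)" by auto
        have m: "(x, z) \<in> topspace (prod_topology (top_of_set (U i)) (top_of_set (sphere 0 1)))"
          using xz DU by auto
        have "\<xi> \<in> topspace ?P" using g m xz(3) unfolding homeomorphic_maps_def continuous_map_def by blast
        moreover have "\<phi> i \<xi> = (x, z)" using g m xz(3) unfolding homeomorphic_maps_def by blast
        ultimately show "\<xi> \<in> over ?D"
          using local_trivD(1)[OF tr[OF i], of \<xi>] xz(1) by (auto simp: over_def)
      qed
      show "over ?D \<subseteq> g ` (?D \<times> sphere 0 1)"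
      proof
        fix \<xi> assume \<xi>: "\<xi> \<in> over ?D"
        then have "\<xi> \<in> topspace E" "p \<xi> \<in> U i" "p \<xi> \<in> ?D" using DU by (auto simp: over_def)
        moreover from this have "g (\<phi> i \<xi>) = \<xi>" using g unfolding homeomorphic_maps_def by auto
        ultimately show "\<xi> \<in> g ` (?D \<times> sphere 0 1)"
          using local_trivD(1,3)[OF tr[OF i], of \<xi>] by (intro image_eqI[of _ _ "\<phi> i \<xi>"]) (auto simp: mem_Times_iff)
      qed
    qed
    ultimately show ?thesis by (simp add: compactin_subtopology)
  qed
  then have "compactin E (\<Union> ((\<lambda>i. over {x \<in> geom K. 1 / 2 \<le> \<rho> i x}) ` I))"
    using I by (intro compactin_Union) auto
  moreover have "\<Union> ((\<lambda>i. over {x \<in> geom K. 1 / 2 \<le> \<rho> i x}) ` I) = topspace E"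
    using cov p_in by (fastforce simp: over_def)
  ultimately show ?thesis by (simp add: compact_space_def)
qed

text \<open>A chart coordinate times a bump pulled back from the base stays equivariant, and it
  extends by zero to all of \<open>E\<close> since the coordinate has modulus 1.\<close>

lemma equivariant_functions:
  obtains I :: "('v \<Rightarrow> real) set" and \<Phi> :: "('v \<Rightarrow> real) \<Rightarrow> 'e \<Rightarrow> complex"
  where "finite I" "\<And>i. i \<in> I \<Longrightarrow> continuous_map E euclidean (\<Phi> i)"
    "\<And>i \<xi> z. i \<in> I \<Longrightarrow> \<xi> \<in> topspace E \<Longrightarrow> norm z = 1 \<Longrightarrow> \<Phi> i (act z \<xi>) = z * \<Phi> i \<xi>"
    "\<And>\<xi>. \<xi> \<in> topspace E \<Longrightarrow> \<exists>i\<in>I. \<Phi> i \<xi> \<noteq> 0"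
proof -
  obtain I U \<phi> and \<rho> :: "('v \<Rightarrow> real) \<Rightarrow> ('v \<Rightarrow> real) \<Rightarrow> real"
    where I: "finite I" and tr: "\<And>i. i \<in> I \<Longrightarrow> local_triv E p act (U i) (\<phi> i)"
      and U: "\<And>i. i \<in> I \<Longrightarrow> U i \<subseteq> geom K"
      and \<rho>: "\<And>i. i \<in> I \<Longrightarrow> continuous_on (geom K) (\<rho> i)" "\<And>i x. i \<in> I \<Longrightarrow> x \<in> geom K \<Longrightarrow> x \<notin> U i \<Longrightarrow> \<rho> i x = 0"
      and cov: "\<And>x. x \<in> geom K \<Longrightarrow> \<exists>i\<in>I. 1 / 2 < \<rho> i x"
    by (rule finite_charts, rule that)
  define \<Phi> where "\<Phi> i \<xi> = complex_of_real (\<rho> i (p \<xi>)) * snd (\<phi> i \<xi>)" for i \<xi>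
  show thesis
  proof (rule that[of I \<Phi>])
    fix i assume i: "i \<in> I"
    have r: "continuous_map E euclideanreal (\<lambda>\<xi>. \<rho> i (p \<xi>))"
      using continuous_map_compose[OF p_continuous, of euclideanreal "\<rho> i"] \<rho>(1)[OF i] by (simp add: o_def)
    let ?N = "{\<xi> \<in> topspace E. \<rho> i (p \<xi>) \<noteq> 0}"
    have sub: "?N \<subseteq> {\<xi> \<in> topspace E. p \<xi> \<in> U i}" using \<rho>(2)[OF i] p_in by blast
    have "continuous_map (subtopology E {\<xi> \<in> topspace E. p \<xi> \<in> U i})
        (prod_topology (top_of_set (U i)) (top_of_set (sphere 0 1))) (\<phi> i)"
      using tr[OF i] homeomorphic_imp_continuous_map unfolding local_triv_def by blast
    then have "continuous_map (subtopology E {\<xi> \<in> topspace E. p \<xi> \<in> U i}) (top_of_set (sphere 0 1)) (snd \<circ> \<phi> i)"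
      by (rule continuous_map_snd_of)
    then have s: "continuous_map (subtopology E ?N) euclidean (\<lambda>\<xi>. snd (\<phi> i \<xi>))"
      using continuous_map_from_subtopology_mono[OF _ sub] continuous_map_in_subtopology
      by (fastforce simp: o_def)
    show "continuous_map E euclidean (\<Phi> i)"
    proof (rule continuous_map_dominated[OF r, where B = 1])
      have "continuous_map (subtopology E ?N) euclideanreal (\<lambda>\<xi>. \<rho> i (p \<xi>))"
        using r by (rule continuous_map_from_subtopology)
      with s show "continuous_map (subtopology E ?N) euclidean (\<Phi> i)"
        unfolding \<Phi>_def by (simp add: continuous_map_atin tendsto_mult tendsto_of_real)
      fix \<xi> assume \<xi>: "\<xi> \<in> topspace E"
      show "norm (\<Phi> i \<xi>) \<le> 1 * \<bar>\<rho> i (p \<xi>)\<bar>"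
        using local_trivD(3)[OF tr[OF i] \<xi>] \<rho>(2)[OF i p_in[OF \<xi>]]
        by (cases "p \<xi> \<in> U i") (auto simp: \<Phi>_def norm_mult)
    qed
  next
    fix i \<xi> z assume i: "i \<in> I" and \<xi>: "\<xi> \<in> topspace E" and z: "norm (z::complex) = 1"
    show "\<Phi> i (act z \<xi>) = z * \<Phi> i \<xi>"
      using local_trivD(2)[OF tr[OF i] \<xi> _ z] \<rho>(2)[OF i p_in[OF \<xi>]] p_act[OF \<xi> z]
      by (cases "p \<xi> \<in> U i") (auto simp: \<Phi>_def)
  next
    fix \<xi> assume \<xi>: "\<xi> \<in> topspace E"
    obtain i where i: "i \<in> I" "1 / 2 < \<rho> i (p \<xi>)" using cov[OF p_in[OF \<xi>]] by blast
    then have "p \<xi> \<in> U i" using \<rho>(2)[OF i(1) p_in[OF \<xi>]] by force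
    then show "\<exists>i\<in>I. \<Phi> i \<xi> \<noteq> 0"
      using i local_trivD(3)[OF tr[OF i(1)] \<xi>] by (intro bexI[of _ i]) (auto simp: \<Phi>_def)
  qed (use I in auto)
qed


section \<open>Equivariant circle-valued functions and trivialisations\<close>

lemma closedin_over:
  assumes "compact S" "S \<subseteq> geom K" shows "closedin E (over S)"
proof -
  have "closedin (top_of_set (geom K)) S"
    by (rule compactin_imp_closedin[OF Hausdorff_base]) (use assms in \<open>auto simp: compactin_subtopology\<close>)
  from closedin_continuous_map_preimage[OF p_continuous this] show ?thesis by (simp add: over_def)
qed

lemma compact_over:
  assumes "compact S" "S \<subseteq> geom K" shows "compact_space (subtopology E (over S))"
  using closedin_compact_space[OF compact_total closedin_over[OF assms]] by (rule compact_space_subtopology)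

lemma topspace_over: "topspace (subtopology E (over S)) = over S"
  by (auto simp: over_def)

lemma p_over: "continuous_map (subtopology E (over S)) (top_of_set S) p"
  using p_continuous' by (auto simp: continuous_map_in_subtopology continuous_map_from_subtopology over_def)

lemma p_image_over: "S \<subseteq> geom K \<Longrightarrow> p ` over S = S"
  using fibre_nonempty by (fastforce simp: over_def)

text \<open>Over a compact set \<open>p\<close> maps a compact space onto a Hausdorff one, hence is
  a quotient map. Continuity on the base can so be checked upstairs, without local sections.\<close>

lemma descend:
  assumes "compact S" "S \<subseteq> geom K"
    and "continuous_map (subtopology E (over S)) euclidean (\<lambda>\<xi>. F (p \<xi>))"
  shows "continuous_on S F"
proof -
  have "quotient_map (subtopology E (over S)) (top_of_set S) p"
    by (rule continuous_imp_quotient_map[OF p_over compact_over[OF assms(1,2)] Hausdorff_base])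
      (use p_image_over[OF assms(2)] in \<open>simp add: topspace_over del: topspace_subtopology\<close>)
  then have "continuous_map (top_of_set S) euclidean F"
    by (rule continuous_compose_quotient_map) (use assms in \<open>simp add: o_def\<close>)
  then show ?thesis by simp
qed

text \<open>Such a function is the fibre coordinate of a trivialisation over \<open>S\<close>. In
  this form the quotient of two of them is constant along fibres and gives the transition function
  at once.\<close>

definition equivariant_on :: "('v \<Rightarrow> real) set \<Rightarrow> ('e \<Rightarrow> complex) \<Rightarrow> bool" where
  "equivariant_on S \<theta> \<longleftrightarrow> continuous_map (subtopology E (over S)) euclidean \<theta> \<and>
     (\<forall>\<xi>\<in>over S. norm (\<theta> \<xi>) = 1 \<and> (\<forall>z. norm z = 1 \<longrightarrow> \<theta> (act z \<xi>) = z * \<theta> \<xi>))"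

lemma equivariant_onD:
  assumes "equivariant_on S \<theta>"
  shows "continuous_map (subtopology E (over S)) euclidean \<theta>"
    and "\<xi> \<in> over S \<Longrightarrow> norm (\<theta> \<xi>) = 1" "\<xi> \<in> over S \<Longrightarrow> norm z = 1 \<Longrightarrow> \<theta> (act z \<xi>) = z * \<theta> \<xi>"
  using assms by (auto simp: equivariant_on_def)

lemma equivariant_ratio:
  assumes "equivariant_on S \<theta>" "equivariant_on S' \<theta>'" "\<xi> \<in> over S" "\<xi> \<in> over S'" "\<eta> \<in> over S" "\<eta> \<in> over S'" "p \<xi> = p \<eta>"
  shows "\<theta>' \<xi> / \<theta> \<xi> = \<theta>' \<eta> / \<theta> \<eta>"
proof -
  obtain z where z: "norm z = 1" "\<eta> = act z \<xi>"
    using fibre_transitive[of \<xi> \<eta>] assms by (auto simp: over_def)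
  have "\<theta>' \<eta> = z * \<theta>' \<xi>" "\<theta> \<eta> = z * \<theta> \<xi>"
    using equivariant_onD(3) assms z by auto
  then show ?thesis using z(1) by auto
qed

lemma equivariant_on_inj:
  assumes "equivariant_on S \<theta>" "\<xi> \<in> over S" "\<eta> \<in> over S" "p \<xi> = p \<eta>" "\<theta> \<xi> = \<theta> \<eta>"
  shows "\<xi> = \<eta>"
proof -
  obtain z where z: "norm z = 1" "\<eta> = act z \<xi>"
    using fibre_transitive[of \<xi> \<eta>] assms by (auto simp: over_def)
  have "z * \<theta> \<xi> = \<theta> \<xi>" using equivariant_onD(3)[OF assms(1,2) z(1)] assms z by simp
  moreover have "\<theta> \<xi> \<noteq> 0" using equivariant_onD(2)[OF assms(1,2)] by auto
  ultimately have "z = 1" by simp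
  then show ?thesis using z act_1 assms(2) by (auto simp: over_def)
qed

text \<open>The winding numbers are prescribed for local trivialisations, so the equivariant
  functions have to be turned into such; by compactness a continuous bijection onto the product
  suffices.\<close>

lemma equivariant_on_local_triv:
  assumes \<theta>: "equivariant_on S \<theta>" and S: "compact S" "S \<subseteq> geom K"
  shows "local_triv E p act S (\<lambda>\<xi>. (p \<xi>, \<theta> \<xi>))"
  unfolding local_triv_def
proof (intro conjI ballI impI)
  let ?P = "subtopology E {x \<in> topspace E. p x \<in> S}"
  have P: "?P = subtopology E (over S)" by (simp add: over_def)
  have cont: "continuous_map ?P (prod_topology (top_of_set S) (top_of_set (sphere 0 1))) (\<lambda>\<xi>. (p \<xi>, \<theta> \<xi>))"
    unfolding P
    by (intro continuous_map_pairedI p_over)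
      (use equivariant_onD(1,2)[OF \<theta>] in \<open>auto simp: continuous_map_in_subtopology topspace_over\<close>)
  show "homeomorphic_map ?P (prod_topology (top_of_set S) (top_of_set (sphere 0 1))) (\<lambda>\<xi>. (p \<xi>, \<theta> \<xi>))"
  proof (rule continuous_imp_homeomorphic_map[OF cont])
    show "compact_space ?P" using compact_over[OF S] by (simp add: P)
    show "Hausdorff_space (prod_topology (top_of_set S) (top_of_set (sphere (0::complex) 1)))"
      by (auto simp: Hausdorff_space_prod_topology Hausdorff_base Hausdorff_space_subtopology
          simp del: prod_topology_subtopology_eu)
    show "(\<lambda>\<xi>. (p \<xi>, \<theta> \<xi>)) ` topspace ?P = topspace (prod_topology (top_of_set S) (top_of_set (sphere 0 1)))"
    proof
      show "(\<lambda>\<xi>. (p \<xi>, \<theta> \<xi>)) ` topspace ?P \<subseteq> topspace (prod_topology (top_of_set S) (top_of_set (sphere 0 1)))"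
        using cont by (auto simp: continuous_map_def)
      show "topspace (prod_topology (top_of_set S) (top_of_set (sphere 0 1))) \<subseteq> (\<lambda>\<xi>. (p \<xi>, \<theta> \<xi>)) ` topspace ?P"
      proof
        fix t :: "('v \<Rightarrow> real) \<times> complex"
        assume "t \<in> topspace (prod_topology (top_of_set S) (top_of_set (sphere 0 1)))"
        then obtain x w where xw: "t = (x, w)" "x \<in> S" "norm w = 1" by auto
        obtain \<xi> where \<xi>: "\<xi> \<in> topspace E" "p \<xi> = x" using fibre_nonempty S xw by blast
        then have \<xi>S: "\<xi> \<in> over S" using xw by (simp add: over_def)
        define z where "z = w / \<theta> \<xi>"
        have z: "norm z = 1" "z * \<theta> \<xi> = w"
          using equivariant_onD(2)[OF \<theta> \<xi>S] xw by (auto simp: z_def norm_divide)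
        have "act z \<xi> \<in> topspace ?P" "p (act z \<xi>) = x" "\<theta> (act z \<xi>) = w"
          using act_in[OF \<xi>(1) z(1)] p_act[OF \<xi>(1) z(1)] \<xi> xw equivariant_onD(3)[OF \<theta> \<xi>S z(1)] z(2) by auto
        then show "t \<in> (\<lambda>\<xi>. (p \<xi>, \<theta> \<xi>)) ` topspace ?P" using xw by (intro image_eqI[of _ _ "act z \<xi>"]) auto
      qed
    qed
    show "inj_on (\<lambda>\<xi>. (p \<xi>, \<theta> \<xi>)) (topspace ?P)"
      using equivariant_on_inj[OF \<theta>] by (auto simp: inj_on_def over_def)
  qed
next
  fix \<xi> z assume \<xi>: "\<xi> \<in> topspace E" "p \<xi> \<in> S" and z: "z \<in> sphere (0::complex) 1"
  then show "(p (act z \<xi>), \<theta> (act z \<xi>)) = (p \<xi>, z * snd (p \<xi>, \<theta> \<xi>))"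
    using p_act[of \<xi> z] equivariant_onD(3)[OF \<theta>, of \<xi> z] by (auto simp: over_def)
qed auto

text \<open>The functions \<open>\<Phi>\<close> embed the bundle into a trivial hermitian one. Orthogonal projection
  between sufficiently close fibres transports a fixed vector from \<open>c\<close> along the rays of \<open>S\<close>.\<close>

lemma equivariant_on_star:
  assumes S: "compact S" "S \<subseteq> geom K" "star_at c S"
  obtains \<theta> where "equivariant_on S \<theta>"
proof -
  obtain I :: "('v \<Rightarrow> real) set" and \<Phi> :: "('v \<Rightarrow> real) \<Rightarrow> 'e \<Rightarrow> complex"
    where I: "finite I" and \<Phi>: "\<And>i. i \<in> I \<Longrightarrow> continuous_map E euclidean (\<Phi> i)"
    and eq: "\<And>i \<xi> z. i \<in> I \<Longrightarrow> \<xi> \<in> topspace E \<Longrightarrow> norm z = 1 \<Longrightarrow> \<Phi> i (act z \<xi>) = z * \<Phi> i \<xi>"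
    and nz: "\<And>\<xi>. \<xi> \<in> topspace E \<Longrightarrow> \<exists>i\<in>I. \<Phi> i \<xi> \<noteq> 0"
    by (rule equivariant_functions, rule that)
  define pick where "pick x = (SOME \<xi>. \<xi> \<in> topspace E \<and> p \<xi> = x)" for x
  have pick: "pick x \<in> topspace E" "p (pick x) = x" if "x \<in> geom K" for x
    using someI_ex[of "\<lambda>\<xi>. \<xi> \<in> topspace E \<and> p \<xi> = x"] fibre_nonempty[OF that] by (auto simp: pick_def)
  \<comment> \<open>\<open>P\<close> is the matrix of the unnormalised projection onto the line
    spanned by the vector of all \<open>\<Phi> i\<close> over \<open>x\<close>. Another choice of
    the point in the fibre changes that vector by a phase, which cancels; therefore \<open>P\<close>
    is continuous although \<open>pick\<close> is arbitrary.\<close>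
  define P where "P i j x = \<Phi> i (pick x) * cnj (\<Phi> j (pick x))" for i j x
  have P: "P i j (p \<xi>) = \<Phi> i \<xi> * cnj (\<Phi> j \<xi>)" if \<xi>: "\<xi> \<in> topspace E" and ij: "i \<in> I" "j \<in> I" for i j \<xi>
  proof -
    obtain z where z: "norm z = 1" "pick (p \<xi>) = act z \<xi>"
      using fibre_transitive[OF \<xi>, of "pick (p \<xi>)"] pick[OF p_in[OF \<xi>]] by auto
    have "z * cnj z = 1" using z(1) by (simp add: complex_norm_square[symmetric])
    then show ?thesis using eq[OF ij(1) \<xi> z(1)] eq[OF ij(2) \<xi> z(1)] z(2)
      by (simp add: P_def)
  qed
  have Pc: "continuous_on (geom K) (P i j)" if "i \<in> I" "j \<in> I" for i j
  proof (rule descend[OF compact_base order_refl])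
    have "continuous_map E euclidean (\<lambda>\<xi>. \<Phi> i \<xi> * cnj (\<Phi> j \<xi>))"
      using \<Phi>[OF that(1)] \<Phi>[OF that(2)] by (simp add: continuous_map_atin tendsto_mult tendsto_cnj)
    then show "continuous_map (subtopology E (over (geom K))) euclidean (\<lambda>\<xi>. P i j (p \<xi>))"
      by (intro continuous_map_eq[OF continuous_map_from_subtopology]) (auto simp: over_def P that)
  qed
  define ip where "ip \<xi> \<eta> = (\<Sum>i\<in>I. \<Phi> i \<xi> * cnj (\<Phi> i \<eta>))" for \<xi> \<eta>
  have ip_pos: "ip \<xi> \<xi> \<noteq> 0" if \<xi>: "\<xi> \<in> topspace E" for \<xi>
  proof -
    obtain i where i: "i \<in> I" "\<Phi> i \<xi> \<noteq> 0" using nz[OF \<xi>] by blast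
    have "0 < (\<Sum>i\<in>I. (norm (\<Phi> i \<xi>))\<^sup>2)" using I i by (intro sum_pos2[of I i]) auto
    moreover have "ip \<xi> \<xi> = of_real (\<Sum>i\<in>I. (norm (\<Phi> i \<xi>))\<^sup>2)"
      by (simp only: ip_def complex_norm_square of_real_sum)
    ultimately show ?thesis by (metis less_irrefl of_real_eq_0_iff)
  qed
  \<comment> \<open>The trace of the product of two such matrices is the squared modulus of the
    inner product of the vectors; positivity says that the two lines are not orthogonal.\<close>
  define N where "N t t' x = Re (\<Sum>i\<in>I. \<Sum>j\<in>I. P i j (seg c x t) * P j i (seg c x t'))" for t t' x
  have N: "N t t' x = (norm (ip \<xi> \<eta>))\<^sup>2"
    if "\<xi> \<in> topspace E" "\<eta> \<in> topspace E" "p \<xi> = seg c x t" "p \<eta> = seg c x t'" for t t' x \<xi> \<eta>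
  proof -
    have "(\<Sum>i\<in>I. \<Sum>j\<in>I. P i j (seg c x t) * P j i (seg c x t'))
        = (\<Sum>i\<in>I. \<Sum>j\<in>I. (\<Phi> i \<xi> * cnj (\<Phi> i \<eta>)) * (cnj (\<Phi> j \<xi>) * \<Phi> j \<eta>))"
      unfolding that(3,4)[symmetric] using P[OF that(1)] P[OF that(2)] by (simp add: mult_ac)
    also have "\<dots> = ip \<xi> \<eta> * cnj (ip \<xi> \<eta>)"
      by (simp add: ip_def sum_product)
    finally show ?thesis by (simp add: N_def complex_norm_square[symmetric])
  qed
  have seg_S: "seg c x t \<in> geom K" "seg c x t \<in> S" if "x \<in> S" "0 \<le> t" "t \<le> 1" for x t
    using S that by (auto simp: star_at_def)
  note Pc' = continuous_on_seg_comp[OF continuous_on_subset[OF Pc S(2)] S(3)]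
  have "continuous_on ({0..1} \<times> {0..1} \<times> S) (\<lambda>(t, t', x). N t t' x)"
    unfolding N_def case_prod_unfold
    by (intro continuous_intros Pc') auto
  moreover have "0 < N t t x" if t: "0 \<le> t" "t \<le> 1" "x \<in> S" for t x
  proof -
    obtain \<xi> where "\<xi> \<in> topspace E" "p \<xi> = seg c x t" using fibre_nonempty seg_S(1)[OF t(3,1,2)] by blast
    then show ?thesis using N[of \<xi> \<xi> x t t] ip_pos[of \<xi>] by simp
  qed
  ultimately obtain M :: nat where M: "M > 0"
    "\<And>j x. j < M \<Longrightarrow> x \<in> S \<Longrightarrow> 0 < N (real j / M) (real (Suc j) / M) x"
    using uniform_steps[OF S(1)] by blast
  have cS: "c \<in> geom K" using S by (auto simp: star_at_def)
  \<comment> \<open>The vector over \<open>c\<close> is projected, up to scale, onto the lines over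
    the successive subdivision points of the ray; after \<open>M\<close> steps it lies over
    \<open>x\<close> itself.\<close>
  define W where "W = rec_nat (\<lambda>x i. \<Phi> i (pick c))
      (\<lambda>n W x i. \<Sum>j\<in>I. P i j (seg c x (real (Suc n) / M)) * W x j)"
  have W0: "W 0 x i = \<Phi> i (pick c)"
    and WS: "W (Suc n) x i = (\<Sum>j\<in>I. P i j (seg c x (real (Suc n) / M)) * W n x j)" for n x i
    by (simp_all add: W_def)
  have Wc: "continuous_on S (\<lambda>x. W n x i)" if "n \<le> M" "i \<in> I" for n i
    using that
  proof (induction n arbitrary: i)
    case 0 then show ?case by (simp add: W0)
  next
    case (Suc n)
    then show ?case unfolding WS by (intro continuous_intros Pc') (auto simp del: of_nat_Suc)
  qed
  have Wk: "\<exists>k. k \<noteq> 0 \<and> (\<forall>i\<in>I. W n x i = k * \<Phi> i \<xi>)"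
    if "n \<le> M" "x \<in> S" "\<xi> \<in> topspace E" "p \<xi> = seg c x (real n / M)" for n x \<xi>
    using that
  proof (induction n arbitrary: \<xi>)
    case 0
    obtain z where z: "norm z = 1" "pick c = act z \<xi>"
      using fibre_transitive[of \<xi> "pick c"] pick[OF cS] 0 by auto
    then show ?case using eq[OF _ 0(3) z(1)] by (intro exI[of _ z]) (auto simp: W0)
  next
    case (Suc n)
    obtain \<eta> where \<eta>: "\<eta> \<in> topspace E" "p \<eta> = seg c x (real n / M)"
      using fibre_nonempty seg_S(1)[of x "real n / M"] Suc.prems by auto
    obtain k where k: "k \<noteq> 0" "\<forall>i\<in>I. W n x i = k * \<Phi> i \<eta>" using Suc.IH[OF _ _ \<eta>] Suc.prems by auto
    have "0 < N (real n / M) (real (Suc n) / M) x" using M(2) Suc.prems by simp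
    then have "ip \<eta> \<xi> \<noteq> 0" using N[OF \<eta>(1) Suc.prems(3) \<eta>(2) Suc.prems(4)] by auto
    moreover have "W (Suc n) x i = k * ip \<eta> \<xi> * \<Phi> i \<xi>" if i: "i \<in> I" for i
    proof -
      have "W (Suc n) x i = (\<Sum>j\<in>I. P i j (p \<xi>) * W n x j)" by (simp add: WS Suc.prems(4))
      also have "\<dots> = (\<Sum>j\<in>I. k * \<Phi> i \<xi> * (\<Phi> j \<eta> * cnj (\<Phi> j \<xi>)))"
        using P[OF Suc.prems(3) i] k by (intro sum.cong) auto
      finally show ?thesis by (simp add: ip_def sum_distrib_left mult_ac)
    qed
    ultimately show ?case using k(1) by (intro exI[of _ "k * ip \<eta> \<xi>"]) auto
  qed
  \<comment> \<open>The transported vector depends only on the base point, so pairing it with the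
    vector at \<open>\<xi>\<close> is equivariant; the pairing is nonzero as both span the same
    line.\<close>
  define \<theta>0 where "\<theta>0 \<xi> = (\<Sum>i\<in>I. \<Phi> i \<xi> * cnj (W M (p \<xi>) i))" for \<xi>
  have nz0: "\<theta>0 \<xi> \<noteq> 0" if \<xi>: "\<xi> \<in> over S" for \<xi>
  proof -
    have "\<xi> \<in> topspace E" "p \<xi> \<in> S" using \<xi> by (auto simp: over_def)
    moreover from this obtain k where k: "k \<noteq> 0" "\<forall>i\<in>I. W M (p \<xi>) i = k * \<Phi> i \<xi>"
      using Wk[of M "p \<xi>" \<xi>] M(1) by auto
    moreover have "\<theta>0 \<xi> = cnj k * ip \<xi> \<xi>"
      unfolding \<theta>0_def ip_def sum_distrib_left using k by (intro sum.cong) auto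
    ultimately show ?thesis using ip_pos[of \<xi>] by simp
  qed
  have "continuous_map (subtopology E (over S)) euclidean \<theta>0"
  proof -
    have "continuous_map (subtopology E (over S)) euclidean (\<lambda>\<xi>. \<Phi> i \<xi> * cnj (W M (p \<xi>) i))" if i: "i \<in> I" for i
    proof -
      have "continuous_map (subtopology E (over S)) euclidean ((\<lambda>x. W M x i) \<circ> p)"
        using Wc[OF _ i, of M] by (intro continuous_map_compose[OF p_over]) auto
      moreover have "continuous_map (subtopology E (over S)) euclidean (\<Phi> i)"
        using \<Phi>[OF i] by (rule continuous_map_from_subtopology)
      ultimately show ?thesis by (simp add: continuous_map_atin tendsto_mult tendsto_cnj o_def)
    qed
    then show ?thesis unfolding \<theta>0_def using I by (intro continuous_map_sum) auto
  qed
  then have "continuous_map (subtopology E (over S)) euclidean (\<lambda>\<xi>. sgn (\<theta>0 \<xi>))"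
    using nz0 by (simp add: continuous_map_atin topspace_over tendsto_sgn)
  moreover have "norm (sgn (\<theta>0 \<xi>)) = 1" if "\<xi> \<in> over S" for \<xi> using nz0[OF that] by (simp add: norm_sgn)
  moreover have "sgn (\<theta>0 (act z \<xi>)) = z * sgn (\<theta>0 \<xi>)" if \<xi>: "\<xi> \<in> over S" and z: "norm z = 1" for \<xi> z
  proof -
    have "\<xi> \<in> topspace E" using \<xi> by (auto simp: over_def)
    then have "\<theta>0 (act z \<xi>) = z * \<theta>0 \<xi>"
      using eq[OF _ _ z] p_act[OF _ z] by (simp add: \<theta>0_def sum_distrib_left mult.assoc)
    then show ?thesis using z by (simp add: sgn_div_norm norm_mult)
  qed
  ultimately have "equivariant_on S (\<lambda>\<xi>. sgn (\<theta>0 \<xi>))" by (auto simp: equivariant_on_def)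
  then show thesis by (rule that)
qed

end

section \<open>Comparison with the Euler cocycle\<close>

lemma cis_2pi_diff: "cis (2 * pi * (r - t)) = cis (2 * pi * r) / cis (2 * pi * t)"
  and cis_2pi_add: "cis (2 * pi * (r + t)) = cis (2 * pi * r) * cis (2 * pi * t)"
  by (simp_all add: right_diff_distrib distrib_left cis_divide cis_mult)

lemma cis_2pi_Ints: "r \<in> \<int> \<Longrightarrow> cis (2 * pi * r) = 1"
  using cis_2pi_eq_1_iff by blast

lemma qcis_eq_cis_2pi: "qcis r = cis (2 * pi * (r / 4))"
  by (simp add: qcis_def)

context bundle_over_complex
begin

lemma vertex_in_skel: "{v} \<in> K \<Longrightarrow> vtx v \<in> geom (skel1 K)"
  by (intro vtx_in_geom) (auto simp: skel1_def)

lemma edge_in_skel: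
  assumes "{u, v} \<in> K" shows "geom (faces {u, v}) \<subseteq> geom (skel1 K)"
proof -
  have "\<tau> \<in> skel1 K" if "\<tau> \<in> faces {u, v}" for \<tau>
  proof -
    have t: "\<tau> \<subseteq> {u, v}" "\<tau> \<noteq> {}" using that by (auto simp: faces_def)
    then have "\<tau> \<in> K" using simplicial_complexD(6)[OF K assms] by blast
    moreover have "card \<tau> \<le> card {u, v}" using t by (intro card_mono) auto
    moreover have "card {u, v} \<le> 2" by (simp add: card_insert_if)
    ultimately show ?thesis by (simp add: skel1_def)
  qed
  then show ?thesis by (auto simp: geom_def)
qed

lemma equivariant_on_subset: "equivariant_on S \<theta> \<Longrightarrow> T \<subseteq> S \<Longrightarrow> equivariant_on T \<theta>"
  unfolding equivariant_on_def
  by (auto simp: over_def intro: continuous_map_from_subtopology_mono)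

text \<open>Normalising at the vertices lets the angle of the section start at 0 there, which spares
  the comparison with winding numbers additional vertex terms.\<close>

lemma normalised_trivialisations:
  assumes s: "continuous_map (top_of_set (geom (skel1 K))) E s" "\<And>x. x \<in> geom (skel1 K) \<Longrightarrow> p (s x) = x"
  obtains \<theta> where "\<And>v. {v} \<in> K \<Longrightarrow> equivariant_on (cstar K {v}) (\<theta> v)" "\<And>v. {v} \<in> K \<Longrightarrow> \<theta> v (s (vtx v)) = 1"
proof -
  have "\<exists>\<theta>. equivariant_on (cstar K {v}) \<theta> \<and> \<theta> (s (vtx v)) = 1" if v: "{v} \<in> K" for v
  proof -
    have st: "star_at (vtx v) (cstar K {v})" using star_at_cstar[OF K v] by simp
    obtain \<theta> where \<theta>: "equivariant_on (cstar K {v}) \<theta>"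
      using equivariant_on_star[OF compact_cstar[OF K] cstar_subset st] .
    have "s (vtx v) \<in> over (cstar K {v})"
      using s vertex_in_skel[OF v] st by (auto simp: over_def star_at_def continuous_map_def)
    then have n: "norm (\<theta> (s (vtx v))) = 1" using equivariant_onD(2)[OF \<theta>] by blast
    then have nz: "\<theta> (s (vtx v)) \<noteq> 0" by auto
    have "continuous_map (subtopology E (over (cstar K {v}))) euclidean (\<lambda>\<xi>. \<theta> \<xi> / \<theta> (s (vtx v)))"
      using equivariant_onD(1)[OF \<theta>] nz by (simp add: continuous_map_atin tendsto_divide)
    then have "equivariant_on (cstar K {v}) (\<lambda>\<xi>. \<theta> \<xi> / \<theta> (s (vtx v)))"
      using equivariant_onD(2,3)[OF \<theta>] n by (simp add: equivariant_on_def norm_divide)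
    then show ?thesis using nz by (intro exI[of _ "\<lambda>\<xi>. \<theta> \<xi> / \<theta> (s (vtx v))"]) simp
  qed
  then have "\<forall>v\<in>{v. {v} \<in> K}. \<exists>\<theta>. equivariant_on (cstar K {v}) \<theta> \<and> \<theta> (s (vtx v)) = 1" by blast
  from bchoice[OF this] show thesis using that by blast
qed

end

locale euler_bundle = bundle_over_complex V K E p act + cyclic_system K a eps
  for V :: "'v set" and K :: "'v set set" and E :: "'e topology" and p :: "'e \<Rightarrow> 'v \<Rightarrow> real"
    and act :: "complex \<Rightarrow> 'e \<Rightarrow> 'e" and a eps +
  fixes e :: "'v \<Rightarrow> 'v \<Rightarrow> 'v \<Rightarrow> int" and b :: "'v \<Rightarrow> 'v \<Rightarrow> int" and s :: "('v \<Rightarrow> real) \<Rightarrow> 'e"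
    and \<theta> :: "'v \<Rightarrow> 'e \<Rightarrow> complex"
  assumes e_eps: "{u, v, w} \<in> K \<Longrightarrow> distinct [u, v, w] \<Longrightarrow>
        cobd1 a u v w + eps u v w = 4 * (e u v w + cobd1 a u v w)"
    and s_cont: "continuous_map (top_of_set (geom (skel1 K))) E s"
    and p_s: "x \<in> geom (skel1 K) \<Longrightarrow> p (s x) = x"
    and b_alt: "alt1 K b"
    and winding: "{u, v, w} \<in> K \<Longrightarrow> distinct [u, v, w] \<Longrightarrow> local_triv E p act (geom (faces {u, v, w})) \<phi> \<Longrightarrow>
        complex_of_int (e u v w - cobd1 b u v w) = winding_number (\<lambda>t. snd (\<phi> (s (bdry u v w t)))) 0"
    and \<theta>: "{v} \<in> K \<Longrightarrow> equivariant_on (cstar K {v}) (\<theta> v)"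
    and \<theta>_vtx: "{v} \<in> K \<Longrightarrow> \<theta> v (s (vtx v)) = 1"
begin

lemma vertexK: "{u, v} \<in> K \<Longrightarrow> {u} \<in> K" "{u, v} \<in> K \<Longrightarrow> {v} \<in> K"
  using face by blast+

lemma s_in: "x \<in> geom (skel1 K) \<Longrightarrow> s x \<in> topspace E"
  using s_cont by (auto simp: continuous_map_def)

lemma s_over: "x \<in> geom (skel1 K) \<Longrightarrow> x \<in> S \<Longrightarrow> s x \<in> over S"
  using s_in p_s by (auto simp: over_def)

lemma \<theta>_s_continuous:
  assumes "{v} \<in> K" "T \<subseteq> geom (skel1 K)" "T \<subseteq> cstar K {v}"
  shows "continuous_on T (\<lambda>x. \<theta> v (s x))"
proof -
  have "continuous_map (top_of_set T) E s"
    using s_cont assms(2) continuous_map_from_subtopology_mono by blast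
  then have "continuous_map (top_of_set T) (subtopology E (over (cstar K {v}))) s"
    by (rule continuous_map_into_subtopology) (use assms s_over in auto)
  then have "continuous_map (top_of_set T) euclidean (\<theta> v \<circ> s)"
    using equivariant_onD(1)[OF \<theta>[OF assms(1)]] by (rule continuous_map_compose)
  then show ?thesis by (simp add: o_def)
qed

text \<open>The transition function. It is evaluated at some point of the fibre, and over the closed
  star of the edge the choice is immaterial.\<close>

definition ratio :: "'v \<Rightarrow> 'v \<Rightarrow> ('v \<Rightarrow> real) \<Rightarrow> complex" where
  "ratio u v x = (let \<xi> = SOME \<xi>. \<xi> \<in> topspace E \<and> p \<xi> = x in \<theta> v \<xi> / \<theta> u \<xi>)"

lemma ratio:
  assumes "{u, v} \<in> K" "\<xi> \<in> over (cstar K {u, v})"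
  shows "ratio u v (p \<xi>) = \<theta> v \<xi> / \<theta> u \<xi>" "norm (ratio u v (p \<xi>)) = 1" "\<theta> v \<xi> = \<theta> u \<xi> * ratio u v (p \<xi>)"
proof -
  have sub: "cstar K {u, v} \<subseteq> cstar K {u}" "cstar K {u, v} \<subseteq> cstar K {v}"
    using cstar_mono[OF K] by auto
  define \<eta> where "\<eta> = (SOME \<eta>. \<eta> \<in> topspace E \<and> p \<eta> = p \<xi>)"
  have "\<xi> \<in> topspace E \<and> p \<xi> = p \<xi>" using assms by (simp add: over_def)
  then have \<eta>: "\<eta> \<in> topspace E \<and> p \<eta> = p \<xi>" unfolding \<eta>_def by (rule someI)
  then have \<eta>': "\<eta> \<in> over (cstar K {u, v})" using assms by (auto simp: over_def)
  have \<xi>: "\<xi> \<in> over (cstar K {u})" "\<xi> \<in> over (cstar K {v})" "\<eta> \<in> over (cstar K {u})" "\<eta> \<in> over (cstar K {v})"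
    using assms(2) \<eta>' sub by (auto simp: over_def)
  note \<theta>s = \<theta>[OF vertexK(1)[OF assms(1)]] \<theta>[OF vertexK(2)[OF assms(1)]]
  show *: "ratio u v (p \<xi>) = \<theta> v \<xi> / \<theta> u \<xi>"
    using equivariant_ratio[OF \<theta>s \<xi>(3,4,1,2)] \<eta>
    unfolding ratio_def \<eta>_def[symmetric] Let_def by auto
  show "norm (ratio u v (p \<xi>)) = 1"
    using equivariant_onD(2)[OF \<theta>s(1) \<xi>(1)] equivariant_onD(2)[OF \<theta>s(2) \<xi>(2)] by (simp add: * norm_divide)
  have "\<theta> u \<xi> \<noteq> 0" using equivariant_onD(2)[OF \<theta>s(1) \<xi>(1)] by auto
  then show "\<theta> v \<xi> = \<theta> u \<xi> * ratio u v (p \<xi>)" by (simp add: *)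
qed

lemma ratio_point:
  assumes "x \<in> geom K"
  obtains \<xi> where "\<xi> \<in> topspace E" "p \<xi> = x" "\<And>S. x \<in> S \<Longrightarrow> \<xi> \<in> over S"
  using fibre_nonempty[OF assms] that by (auto simp: over_def)

lemma ratio_continuous:
  assumes "{u, v} \<in> K" shows "continuous_on (cstar K {u, v}) (ratio u v)"
proof (rule descend[OF compact_cstar[OF K] cstar_subset])
  have c: "continuous_map (subtopology E (over (cstar K {u, v}))) euclidean (\<theta> u)"
    "continuous_map (subtopology E (over (cstar K {u, v}))) euclidean (\<theta> v)"
    using equivariant_on_subset[OF \<theta>[OF vertexK(1)[OF assms]] cstar_mono[OF K]]
      equivariant_on_subset[OF \<theta>[OF vertexK(2)[OF assms]] cstar_mono[OF K]] equivariant_onD(1) by blast+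
  have "\<theta> u \<xi> \<noteq> 0" if "\<xi> \<in> over (cstar K {u, v})" for \<xi>
    using ratio(2)[OF assms that] ratio(1)[OF assms that] by auto
  then have "continuous_map (subtopology E (over (cstar K {u, v}))) euclidean (\<lambda>\<xi>. \<theta> v \<xi> / \<theta> u \<xi>)"
    using c by (simp add: continuous_map_atin topspace_over tendsto_divide del: topspace_subtopology)
  then show "continuous_map (subtopology E (over (cstar K {u, v}))) euclidean (\<lambda>\<xi>. ratio u v (p \<xi>))"
    by (rule continuous_map_eq) (use ratio(1)[OF assms] in \<open>simp add: topspace_over del: topspace_subtopology\<close>)
qed

text \<open>\<open>\<alpha> u v\<close> and \<open>\<alpha> v u\<close> follow the section along the
  same edge, but in the trivialisations at \<open>u\<close> and at \<open>v\<close>, and each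
  vanishes at its own vertex.\<close>

lemma edge_angles:
  obtains \<alpha> where "\<And>u v. {u, v} \<in> K \<Longrightarrow> u \<noteq> v \<Longrightarrow> continuous_on (geom (faces {u, v})) (\<alpha> u v)"
    "\<And>u v y. {u, v} \<in> K \<Longrightarrow> u \<noteq> v \<Longrightarrow> y \<in> geom (faces {u, v}) \<Longrightarrow> \<theta> u (s y) = cis (2 * pi * \<alpha> u v y)"
    "\<And>u v. {u, v} \<in> K \<Longrightarrow> u \<noteq> v \<Longrightarrow> \<alpha> u v (vtx u) = 0"
proof -
  have "\<exists>h. continuous_on (geom (faces {u, v})) h \<and> h (vtx u) = 0 \<and>
      (\<forall>y\<in>geom (faces {u, v}). \<theta> u (s y) = cis (2 * pi * h y))" if uv: "{u, v} \<in> K" for u v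
  proof -
    let ?S = "geom (faces {u, v})"
    have S: "compact ?S" "star_at (vtx u) ?S" using compact_geom_faces[of "{u, v}"] star_at_geom_faces[of "{u, v}" u] by auto
    have sub: "?S \<subseteq> geom (skel1 K)" "?S \<subseteq> cstar K {u}"
      using edge_in_skel[OF uv] geom_faces_subset_cstar[OF K uv] by auto
    have c: "continuous_on ?S (\<lambda>x. \<theta> u (s x))" using \<theta>_s_continuous[OF vertexK(1)[OF uv] sub] .
    have "norm (\<theta> u (s x)) = 1" if "x \<in> ?S" for x
      using equivariant_onD(2)[OF \<theta>[OF vertexK(1)[OF uv]]] s_over sub that by blast
    from star_at_angle[OF S c this] obtain h where h: "continuous_on ?S h"
      "\<And>x. x \<in> ?S \<Longrightarrow> \<theta> u (s x) = cis (2 * pi * h x)" by blast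
    have "vtx u \<in> ?S" using S(2) by (simp add: star_at_def)
    then have "cis (2 * pi * h (vtx u)) = 1" using h(2) \<theta>_vtx[OF vertexK(1)[OF uv]] by metis
    then show ?thesis
      using h by (intro exI[of _ "\<lambda>x. h x - h (vtx u)"])
        (auto simp: cis_2pi_diff simp del: cis_divide intro!: continuous_intros)
  qed
  then have "\<forall>t\<in>{(u, v). {u, v} \<in> K}. \<exists>h. continuous_on (geom (faces {fst t, snd t})) h \<and> h (vtx (fst t)) = 0 \<and>
      (\<forall>y\<in>geom (faces {fst t, snd t}). \<theta> (fst t) (s y) = cis (2 * pi * h y))" by auto
  from bchoice[OF this] obtain A where A: "\<And>u v. {u, v} \<in> K \<Longrightarrow> continuous_on (geom (faces {u, v})) (A (u, v)) \<and> A (u, v) (vtx u) = 0 \<and>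
      (\<forall>y\<in>geom (faces {u, v}). \<theta> u (s y) = cis (2 * pi * A (u, v) y))" by auto
  show thesis by (rule that[of "\<lambda>u v. A (u, v)"]) (use A in auto)
qed

end

section \<open>Winding numbers along the boundary of a triangle\<close>

lemma winding_number_cis:
  assumes c: "continuous_on {0..1} g" and g: "\<And>t. t \<in> {0..1} \<Longrightarrow> norm (g t) = 1"
  obtains h where "continuous_on {0..1} h" "\<And>t. t \<in> {0..1} \<Longrightarrow> g t = cis (2 * pi * h t)"
    "winding_number g 0 = complex_of_real (h 1 - h 0)"
proof -
  have "path g" using c by (simp add: path_def)
  moreover have "0 \<notin> path_image g" using g by (force simp: path_image_def)
  ultimately obtain q where q: "path q" "pathfinish q - pathstart q = 2 * of_real pi * \<i> * winding_number g 0"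
    "\<And>t. t \<in> {0..1} \<Longrightarrow> g t = 0 + exp (q t)"
    using winding_number_as_continuous_log by blast
  define h where "h t = Im (q t) / (2 * pi)" for t
  have re: "Re (q t) = 0" if "t \<in> {0..1}" for t
    using q(3)[OF that] g[OF that] by simp
  have qh: "q t = 2 * of_real pi * \<i> * of_real (h t)" if "t \<in> {0..1}" for t
    using re[OF that] by (simp add: complex_eq_iff h_def)
  show thesis
  proof (rule that)
    show "continuous_on {0..1} h"
      unfolding h_def using q(1) by (intro continuous_intros) (auto simp: path_def)
    show "g t = cis (2 * pi * h t)" if "t \<in> {0..1}" for t
      using q(3)[OF that] qh[OF that] by (simp add: cis_conv_exp mult_ac)
    have "2 * of_real pi * \<i> * winding_number g 0 = 2 * of_real pi * \<i> * (of_real (h 1 - h 0))"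
      using q(2) qh[of 0] qh[of 1] by (simp add: pathfinish_def pathstart_def algebra_simps)
    then show "winding_number g 0 = of_real (h 1 - h 0)" by simp
  qed
qed

lemma seg_in_edge: "0 \<le> t \<Longrightarrow> t \<le> 1 \<Longrightarrow> seg (vtx u) (vtx v) t \<in> geom (faces {u, v})"
  using seg_in_geom(1)[OF simplicial_complex_faces[of "{u, v}"], of "vtx u" "vtx v" t]
    vtx_in_geom[of u "faces {u, v}"] vtx_in_geom[of v "faces {u, v}"]
  by (auto simp: faces_def)

lemma bdry_simps:
  "t \<le> 1/3 \<Longrightarrow> bdry u v w t = seg (vtx u) (vtx v) (3 * t)"
  "1/3 \<le> t \<Longrightarrow> t \<le> 2/3 \<Longrightarrow> bdry u v w t = seg (vtx v) (vtx w) (3 * t - 1)"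
  "2/3 \<le> t \<Longrightarrow> bdry u v w t = seg (vtx w) (vtx u) (3 * t - 2)"
proof -
  show "t \<le> 1/3 \<Longrightarrow> bdry u v w t = seg (vtx u) (vtx v) (3 * t)" by (simp add: bdry_def)
  show "1/3 \<le> t \<Longrightarrow> t \<le> 2/3 \<Longrightarrow> bdry u v w t = seg (vtx v) (vtx w) (3 * t - 1)"
  proof (cases "t = 1/3")
    case True show ?thesis unfolding True by (simp add: bdry_def)
  qed (simp add: bdry_def)
  show "2/3 \<le> t \<Longrightarrow> bdry u v w t = seg (vtx w) (vtx u) (3 * t - 2)"
  proof (cases "t = 2/3")
    case True show ?thesis unfolding True by (simp add: bdry_def)
  qed (simp add: bdry_def)
qed

lemma continuous_on_bdry: "continuous_on {0..1} (bdry u v w)"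
proof -
  have m: "t = 1/3 \<Longrightarrow> seg (vtx u) (vtx v) (3 * t) = seg (vtx v) (vtx w) (3 * t - 1)"
    "t = 2/3 \<Longrightarrow> seg (vtx v) (vtx w) (3 * t - 1) = seg (vtx w) (vtx u) (3 * t - 2)" for t :: real
    by (simp_all only:) simp_all
  have "continuous_on {0..1} (\<lambda>t. if t \<le> 1/3 then seg (vtx u) (vtx v) (3 * t)
                   else if t \<le> 2/3 then seg (vtx v) (vtx w) (3 * t - 1)
                   else seg (vtx w) (vtx u) (3 * t - 2))"
    by (intro continuous_on_cases_le continuous_on_seg continuous_intros) (use m in force)+
  then show ?thesis by (simp add: bdry_def[abs_def])
qed

lemma bdry_in_edge:
  assumes "0 \<le> t" "t \<le> 1"
  shows "bdry u v w t \<in> geom (faces {u, v}) \<union> geom (faces {v, w}) \<union> geom (faces {w, u})"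
proof -
  consider "t \<le> 1/3" | "1/3 \<le> t" "t \<le> 2/3" | "2/3 \<le> t" by linarith
  then show ?thesis
    using assms by cases (auto simp: bdry_simps intro!: seg_in_edge)
qed

context euler_bundle
begin

text \<open>On each edge any lift differs from the lift along the whole loop by a constant, so only
  increments matter: the three lifts may be chosen separately and need not agree at the
  corners.\<close>

lemma winding_along_edges:
  assumes K3: "{u, v, w} \<in> K" and d: "distinct [u, v, w]"
    and c1: "continuous_on (geom (faces {u, v})) f1" "\<And>y. y \<in> geom (faces {u, v}) \<Longrightarrow> \<theta> u (s y) = cis (2 * pi * f1 y)"
    and c2: "continuous_on (geom (faces {v, w})) f2" "\<And>y. y \<in> geom (faces {v, w}) \<Longrightarrow> \<theta> u (s y) = cis (2 * pi * f2 y)"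
    and c3: "continuous_on (geom (faces {w, u})) f3" "\<And>y. y \<in> geom (faces {w, u}) \<Longrightarrow> \<theta> u (s y) = cis (2 * pi * f3 y)"
  shows "real_of_int (e u v w - cobd1 b u v w)
      = (f1 (vtx v) - f1 (vtx u)) + (f2 (vtx w) - f2 (vtx v)) + (f3 (vtx u) - f3 (vtx w))"
proof -
  let ?S = "geom (faces {u, v, w})"
  let ?g = "\<lambda>t. \<theta> u (s (bdry u v w t))"
  have sub: "?S \<subseteq> cstar K {u}" using geom_faces_subset_cstar[OF K K3] by auto
  have uK: "{u} \<in> K" "{u, v} \<in> K" "{v, w} \<in> K" "{w, u} \<in> K" using face[OF K3] by auto
  have lt: "local_triv E p act ?S (\<lambda>\<xi>. (p \<xi>, \<theta> u \<xi>))"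
    by (rule equivariant_on_local_triv[OF equivariant_on_subset[OF \<theta>[OF uK(1)] sub]
          compact_geom_faces order_trans[OF sub cstar_subset]]) simp
  have W: "complex_of_int (e u v w - cobd1 b u v w) = winding_number ?g 0"
    using winding[OF K3 d lt] by simp
  let ?T = "geom (faces {u, v}) \<union> geom (faces {v, w}) \<union> geom (faces {w, u})"
  have T: "?T \<subseteq> geom (skel1 K)" "?T \<subseteq> cstar K {u}"
  proof -
    show "?T \<subseteq> geom (skel1 K)" using edge_in_skel uK by auto
    have "?T \<subseteq> ?S" by (auto simp: geom_def faces_def)
    then show "?T \<subseteq> cstar K {u}" using sub by blast
  qed
  have gc: "continuous_on {0..1} ?g"
    by (rule continuous_on_compose2[OF \<theta>_s_continuous[OF uK(1) T] continuous_on_bdry])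
      (simp add: image_subset_iff bdry_in_edge del: Un_iff)
  have gn: "norm (?g t) = 1" if "t \<in> {0..1}" for t
  proof -
    have "bdry u v w t \<in> ?T" using bdry_in_edge[of t u v w] that by auto
    then show ?thesis using equivariant_onD(2)[OF \<theta>[OF uK(1)] s_over] T by blast
  qed
  obtain h where h: "continuous_on {0..1} h" "\<And>t. t \<in> {0..1} \<Longrightarrow> ?g t = cis (2 * pi * h t)"
    "winding_number ?g 0 = complex_of_real (h 1 - h 0)" by (rule winding_number_cis[OF gc gn], assumption, rule that)
  have 1: "h (1/3) - h 0 = f1 (vtx v) - f1 (vtx u)"
  proof -
    have "continuous_on {0..1/3} (\<lambda>t. f1 (seg (vtx u) (vtx v) (3 * t)))"
      by (rule continuous_on_compose2[OF c1(1)])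
        (auto intro!: continuous_on_seg continuous_on_mult continuous_on_diff continuous_on_const
          continuous_on_id seg_in_edge)
    moreover have "cis (2 * pi * h t) = cis (2 * pi * f1 (seg (vtx u) (vtx v) (3 * t)))" if "t \<in> {0..1/3}" for t
      using h(2)[of t] c1(2)[OF seg_in_edge[of "3 * t" u v]] that by (simp add: bdry_simps)
    ultimately show ?thesis
      using cis_lift_difference(1)[of "{0..1/3}" h "\<lambda>t. f1 (seg (vtx u) (vtx v) (3 * t))" "1/3" 0]
        continuous_on_subset[OF h(1), of "{0..1/3}"] by simp
  qed
  have 2: "h (2/3) - h (1/3) = f2 (vtx w) - f2 (vtx v)"
  proof -
    have "continuous_on {1/3..2/3} (\<lambda>t. f2 (seg (vtx v) (vtx w) (3 * t - 1)))"
      by (rule continuous_on_compose2[OF c2(1)])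
        (auto intro!: continuous_on_seg continuous_on_mult continuous_on_diff continuous_on_const
          continuous_on_id seg_in_edge)
    moreover have "cis (2 * pi * h t) = cis (2 * pi * f2 (seg (vtx v) (vtx w) (3 * t - 1)))" if "t \<in> {1/3..2/3}" for t
      using h(2)[of t] c2(2)[OF seg_in_edge[of "3 * t - 1" v w]] that by (simp add: bdry_simps)
    ultimately show ?thesis
      using cis_lift_difference(1)[of "{1/3..2/3}" h "\<lambda>t. f2 (seg (vtx v) (vtx w) (3 * t - 1))" "2/3" "1/3"]
        continuous_on_subset[OF h(1), of "{1/3..2/3}"] by simp
  qed
  have 3: "h 1 - h (2/3) = f3 (vtx u) - f3 (vtx w)"
  proof -
    have "continuous_on {2/3..1} (\<lambda>t. f3 (seg (vtx w) (vtx u) (3 * t - 2)))"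
      by (rule continuous_on_compose2[OF c3(1)])
        (auto intro!: continuous_on_seg continuous_on_mult continuous_on_diff continuous_on_const
          continuous_on_id seg_in_edge)
    moreover have "cis (2 * pi * h t) = cis (2 * pi * f3 (seg (vtx w) (vtx u) (3 * t - 2)))" if "t \<in> {2/3..1}" for t
      using h(2)[of t] c3(2)[OF seg_in_edge[of "3 * t - 2" w u]] that by (simp add: bdry_simps)
    ultimately show ?thesis
      using cis_lift_difference(1)[of "{2/3..1}" h "\<lambda>t. f3 (seg (vtx w) (vtx u) (3 * t - 2))" 1 "2/3"]
        continuous_on_subset[OF h(1), of "{2/3..1}"] by simp
  qed
  have "complex_of_real (real_of_int (e u v w - cobd1 b u v w)) = complex_of_real (h 1 - h 0)"
    using W h(3) by simp
  then have "real_of_int (e u v w - cobd1 b u v w) = h 1 - h 0" by (simp only: of_real_eq_iff)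
  then show ?thesis using 1 2 3 by linarith
qed

text \<open>The section fixes the integer ambiguity of each transition angle: along its edge
  \<open>\<Gamma> u v\<close> is to be \<open>\<alpha> v u - \<alpha> u v\<close>. The coboundary is
  then an integer constant over the star of a triangle, and its value at a corner is minus the
  winding number.\<close>

lemma ratio_angles:
  obtains \<Gamma> where "\<And>u v. {u, v} \<in> K \<Longrightarrow> u \<noteq> v \<Longrightarrow> continuous_on (cstar K {u, v}) (\<Gamma> u v)"
    "\<And>u v x. {u, v} \<in> K \<Longrightarrow> u \<noteq> v \<Longrightarrow> x \<in> cstar K {u, v} \<Longrightarrow> ratio u v x = cis (2 * pi * \<Gamma> u v x)"
    "\<And>u v x. {u, v} \<in> K \<Longrightarrow> u \<noteq> v \<Longrightarrow> x \<in> cstar K {u, v} \<Longrightarrow> \<Gamma> v u x = - \<Gamma> u v x"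
    "\<And>u v w x. {u, v, w} \<in> K \<Longrightarrow> distinct [u, v, w] \<Longrightarrow> x \<in> cstar K {u, v, w} \<Longrightarrow>
        \<Gamma> v w x - \<Gamma> u w x + \<Gamma> u v x = - of_int (e u v w - cobd1 b u v w)"
proof -
  obtain \<alpha> where \<alpha>: "\<And>u v. {u, v} \<in> K \<Longrightarrow> u \<noteq> v \<Longrightarrow> continuous_on (geom (faces {u, v})) (\<alpha> u v)"
    "\<And>u v y. {u, v} \<in> K \<Longrightarrow> u \<noteq> v \<Longrightarrow> y \<in> geom (faces {u, v}) \<Longrightarrow> \<theta> u (s y) = cis (2 * pi * \<alpha> u v y)"
    "\<And>u v. {u, v} \<in> K \<Longrightarrow> u \<noteq> v \<Longrightarrow> \<alpha> u v (vtx u) = 0"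
    by (rule edge_angles, rule that)
  have comm: "{v, u} = {u, v}" for u v :: 'v by auto
  have vtx_ed: "vtx u \<in> geom (faces {u, v})" "vtx v \<in> geom (faces {u, v})" for u v :: 'v
    by (auto intro!: vtx_in_geom simp: faces_def)
  have ed: "geom (faces {u, v}) \<subseteq> cstar K {u, v}" if "{u, v} \<in> K" for u v
    using geom_faces_subset_cstar[OF K that] by auto
  have ratio_s: "ratio u v y = cis (2 * pi * (\<alpha> v u y - \<alpha> u v y))"
    if uv: "{u, v} \<in> K" "u \<noteq> v" and y: "y \<in> geom (faces {u, v})" for u v y
  proof -
    have "y \<in> geom (skel1 K)" using edge_in_skel[OF uv(1)] y by blast
    then have "s y \<in> over (cstar K {u, v})" "p (s y) = y" using s_over p_s ed[OF uv(1)] y by auto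
    then show ?thesis
      using ratio(1)[OF uv(1), of "s y"] \<alpha>(2)[OF uv y] \<alpha>(2)[of v u y] uv y
      by (simp add: comm[of v u] cis_2pi_diff del: cis_divide)
  qed
  have "\<exists>h. continuous_on (cstar K {u, v}) h \<and> (\<forall>x\<in>cstar K {u, v}. ratio u v x = cis (2 * pi * h x))
      \<and> (\<forall>y\<in>geom (faces {u, v}). h y = \<alpha> v u y - \<alpha> u v y)" if uv: "{u, v} \<in> K" "u \<noteq> v" for u v
  proof -
    have st: "star_at (vtx u) (cstar K {u, v})" using star_at_cstar[OF K uv(1)] by auto
    have "norm (ratio u v x) = 1" if "x \<in> cstar K {u, v}" for x
      using ratio_point[of x] ratio(2)[OF uv(1)] that cstar_subset by (metis subsetD)
    from star_at_angle[OF compact_cstar[OF K] st ratio_continuous[OF uv(1)] this]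
    obtain h where h: "continuous_on (cstar K {u, v}) h" "\<And>x. x \<in> cstar K {u, v} \<Longrightarrow> ratio u v x = cis (2 * pi * h x)"
      by blast
    define g where "g y = \<alpha> v u y - \<alpha> u v y" for y
    let ?S = "geom (faces {u, v})"
    have conn: "connected ?S" using star_at_connected star_at_geom_faces[of "{u, v}" u] by blast
    have hc: "continuous_on ?S h" using h(1) ed[OF uv(1)] continuous_on_subset by blast
    have gc: "continuous_on ?S g"
      unfolding g_def using \<alpha>(1)[OF uv] \<alpha>(1)[of v u] uv
      by (intro continuous_intros) (auto simp: comm[of v u])
    have same: "cis (2 * pi * h y) = cis (2 * pi * g y)" if "y \<in> ?S" for y
      using h(2)[of y] ratio_s[OF uv that] ed[OF uv(1)] that by (auto simp: g_def)
    \<comment> \<open>The integer by which an arbitrary lift misses the normalisation along the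
      edge.\<close>
    define n where "n = h (vtx u) - g (vtx u)"
    have n: "n \<in> \<int>" "\<And>y. y \<in> ?S \<Longrightarrow> h y - g y = n"
      unfolding n_def using cis_lift_difference[OF conn hc gc same] vtx_ed by blast+
    show ?thesis
    proof (intro exI[of _ "\<lambda>x. h x - n"] conjI ballI)
      show "continuous_on (cstar K {u, v}) (\<lambda>x. h x - n)" using h(1) by (intro continuous_intros)
      show "ratio u v x = cis (2 * pi * (h x - n))" if "x \<in> cstar K {u, v}" for x
        using h(2)[OF that] cis_2pi_Ints[OF n(1)] by (simp add: cis_2pi_diff del: cis_divide)
      show "h y - n = \<alpha> v u y - \<alpha> u v y" if "y \<in> ?S" for y
        using n(2)[OF that] by (simp add: g_def)
    qed
  qed
  then have "\<forall>t\<in>{t. {fst t, snd t} \<in> K \<and> fst t \<noteq> snd t}. \<exists>h. continuous_on (cstar K {fst t, snd t}) h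
      \<and> (\<forall>x\<in>cstar K {fst t, snd t}. ratio (fst t) (snd t) x = cis (2 * pi * h x))
      \<and> (\<forall>y\<in>geom (faces {fst t, snd t}). h y = \<alpha> (snd t) (fst t) y - \<alpha> (fst t) (snd t) y)" by blast
  from bchoice[OF this] obtain G where G0: "\<forall>t\<in>{t. {fst t, snd t} \<in> K \<and> fst t \<noteq> snd t}.
      continuous_on (cstar K {fst t, snd t}) (G t)
      \<and> (\<forall>x\<in>cstar K {fst t, snd t}. ratio (fst t) (snd t) x = cis (2 * pi * G t x))
      \<and> (\<forall>y\<in>geom (faces {fst t, snd t}). G t y = \<alpha> (snd t) (fst t) y - \<alpha> (fst t) (snd t) y)" ..
  have G: "\<And>u v. {u, v} \<in> K \<Longrightarrow> u \<noteq> v \<Longrightarrow> continuous_on (cstar K {u, v}) (G (u, v))"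
    "\<And>u v x. {u, v} \<in> K \<Longrightarrow> u \<noteq> v \<Longrightarrow> x \<in> cstar K {u, v} \<Longrightarrow> ratio u v x = cis (2 * pi * G (u, v) x)"
    "\<And>u v y. {u, v} \<in> K \<Longrightarrow> u \<noteq> v \<Longrightarrow> y \<in> geom (faces {u, v}) \<Longrightarrow> G (u, v) y = \<alpha> v u y - \<alpha> u v y"
    using G0 by auto
  define \<Gamma> where "\<Gamma> u v = G (u, v)" for u v
  note \<Gamma> = G[folded \<Gamma>_def]
  show thesis
  proof (rule that[of \<Gamma>])
    fix u v x assume uv: "{u, v} \<in> K" "u \<noteq> v" and x: "x \<in> cstar K {u, v}"
    have vu: "{v, u} \<in> K" "v \<noteq> u" using uv by (auto simp: comm[of v u])
    have conn: "connected (cstar K {u, v})" using star_at_connected star_at_cstar[OF K uv(1), of u] by blast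
    have u: "vtx u \<in> cstar K {u, v}" using ed[OF uv(1)] vtx_ed by blast
    have inv: "ratio v u y = inverse (ratio u v y)" if y: "y \<in> cstar K {u, v}" for y
    proof -
      obtain \<xi> where \<xi>: "p \<xi> = y" "\<xi> \<in> over (cstar K {u, v})"
        using ratio_point[of y] cstar_subset y by (metis subsetD)
      show ?thesis using ratio(1)[OF uv(1) \<xi>(2)] ratio(1)[OF vu(1), of \<xi>] \<xi> by (simp add: comm[of v u])
    qed
    have "cis (2 * pi * \<Gamma> v u y) = cis (2 * pi * (- \<Gamma> u v y))" if "y \<in> cstar K {u, v}" for y
      using inv[OF that] \<Gamma>(2)[OF uv that] \<Gamma>(2)[OF vu] that by (simp add: comm[of v u] cis_inverse)
    then have "\<Gamma> v u x - - \<Gamma> u v x = \<Gamma> v u (vtx u) - - \<Gamma> u v (vtx u)"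
      using \<Gamma>(1)[OF uv] \<Gamma>(1)[OF vu] x u
      by (intro cis_lift_difference(1)[OF conn]) (auto simp: comm[of v u] intro!: continuous_intros)
    moreover have "\<Gamma> v u (vtx u) = - \<Gamma> u v (vtx u)"
      using \<Gamma>(3)[OF uv vtx_ed(1)] \<Gamma>(3)[OF vu, of "vtx u"] vtx_ed[of u v] by (simp add: comm[of v u])
    ultimately show "\<Gamma> v u x = - \<Gamma> u v x" by simp
  next
    fix u v w x assume uvw: "{u, v, w} \<in> K" and d: "distinct [u, v, w]" and x: "x \<in> cstar K {u, v, w}"
    have ne: "u \<noteq> v" "v \<noteq> w" "u \<noteq> w" "w \<noteq> u" using d by auto
    have e: "{u, v} \<in> K" "{v, w} \<in> K" "{u, w} \<in> K" "{w, u} \<in> K" using face[OF uvw] by auto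
    have sub: "cstar K {u, v, w} \<subseteq> cstar K {u, v}" "cstar K {u, v, w} \<subseteq> cstar K {v, w}" "cstar K {u, v, w} \<subseteq> cstar K {u, w}"
      using cstar_mono[OF K] by auto
    have st: "star_at (vtx w) (cstar K {u, v, w})" using star_at_cstar[OF K uvw] by auto
    then have w: "vtx w \<in> cstar K {u, v, w}" by (simp add: star_at_def)
    have one: "cis (2 * pi * (\<Gamma> v w y - \<Gamma> u w y + \<Gamma> u v y)) = cis (2 * pi * 0)" if y: "y \<in> cstar K {u, v, w}" for y
    proof -
      obtain \<xi> where \<xi>: "p \<xi> = y" "\<And>S. y \<in> S \<Longrightarrow> \<xi> \<in> over S"
        using ratio_point[of y] cstar_subset y by (metis subsetD)
      have "cis (2 * pi * (\<Gamma> v w y - \<Gamma> u w y + \<Gamma> u v y)) = ratio v w y / ratio u w y * ratio u v y"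
        using \<Gamma>(2)[OF e(1) ne(1) subsetD[OF sub(1) y]] \<Gamma>(2)[OF e(2) ne(2) subsetD[OF sub(2) y]]
          \<Gamma>(2)[OF e(3) ne(3) subsetD[OF sub(3) y]] by (simp only: cis_2pi_diff cis_2pi_add)
      also have "\<dots> = 1"
      proof -
        have \<xi>s: "\<xi> \<in> over (cstar K {u, v})" "\<xi> \<in> over (cstar K {v, w})" "\<xi> \<in> over (cstar K {u, w})"
          using \<xi>(2) y sub by blast+
        note R = ratio(1,2)[OF e(1) \<xi>s(1)] ratio(1,2)[OF e(2) \<xi>s(2)] ratio(1,2)[OF e(3) \<xi>s(3)]
        then have "\<theta> v \<xi> \<noteq> 0" "\<theta> u \<xi> \<noteq> 0" "\<theta> w \<xi> \<noteq> 0" by auto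
        then show ?thesis using R(1,3,5) \<xi>(1) by simp
      qed
      finally show ?thesis by simp
    qed
    have cont: "continuous_on (cstar K {u, v, w}) (\<lambda>y. \<Gamma> v w y - \<Gamma> u w y + \<Gamma> u v y)"
      using continuous_on_subset[OF \<Gamma>(1)[OF e(1) ne(1)] sub(1)] continuous_on_subset[OF \<Gamma>(1)[OF e(2) ne(2)] sub(2)]
        continuous_on_subset[OF \<Gamma>(1)[OF e(3) ne(3)] sub(3)] by (intro continuous_intros)
    have "(\<Gamma> v w x - \<Gamma> u w x + \<Gamma> u v x) - 0 = (\<Gamma> v w (vtx w) - \<Gamma> u w (vtx w) + \<Gamma> u v (vtx w)) - 0"
      by (rule cis_lift_difference(1)[OF star_at_connected[OF st] cont _ one x w]) auto
    \<comment> \<open>The winding number is computed in the trivialisation at \<open>u\<close>. On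
      the edge from \<open>v\<close> to \<open>w\<close> the available lift is taken at
      \<open>v\<close>; subtracting \<open>\<Gamma> u v\<close> converts it to one at
      \<open>u\<close>.\<close>
    moreover have "real_of_int (e u v w - cobd1 b u v w)
        = (\<alpha> u v (vtx v) - \<alpha> u v (vtx u)) + ((\<alpha> v w (vtx w) - \<Gamma> u v (vtx w)) - (\<alpha> v w (vtx v) - \<Gamma> u v (vtx v)))
          + (\<alpha> u w (vtx u) - \<alpha> u w (vtx w))"
    proof (rule winding_along_edges[OF uvw d])
      show "continuous_on (geom (faces {u, v})) (\<alpha> u v)" using \<alpha>(1) e ne by auto
      show "continuous_on (geom (faces {w, u})) (\<alpha> u w)" using \<alpha>(1)[OF e(3) ne(3)] by (simp add: comm[of w u])
      have vw: "geom (faces {v, w}) \<subseteq> cstar K {u, v}"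
        using geom_faces_subset_cstar[OF K uvw, of "{u, v}"] by (auto simp: geom_def faces_def)
      show "continuous_on (geom (faces {v, w})) (\<lambda>y. \<alpha> v w y - \<Gamma> u v y)"
        using \<alpha>(1)[OF e(2) ne(2)] continuous_on_subset[OF \<Gamma>(1)[OF e(1) ne(1)] vw] by (intro continuous_intros)
      show "\<theta> u (s y) = cis (2 * pi * \<alpha> u v y)" if "y \<in> geom (faces {u, v})" for y
        using \<alpha>(2)[OF e(1) ne(1) that] .
      show "\<theta> u (s y) = cis (2 * pi * \<alpha> u w y)" if "y \<in> geom (faces {w, u})" for y
        using \<alpha>(2)[OF e(3) ne(3)] that by (simp add: comm[of w u])
      show "\<theta> u (s y) = cis (2 * pi * (\<alpha> v w y - \<Gamma> u v y))" if y: "y \<in> geom (faces {v, w})" for y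
      proof -
        have "y \<in> geom (skel1 K)" using edge_in_skel[OF e(2)] y by blast
        then have sy: "s y \<in> over (cstar K {u, v})" "p (s y) = y" using s_over p_s vw y by auto
        have "\<theta> v (s y) = \<theta> u (s y) * cis (2 * pi * \<Gamma> u v y)"
          using ratio(3)[OF e(1) sy(1)] \<Gamma>(2)[OF e(1) ne(1)] vw y sy(2) by auto
        then show ?thesis using \<alpha>(2)[OF e(2) ne(2) y] by (simp add: cis_2pi_diff del: cis_divide)
      qed
    qed
    \<comment> \<open>At the vertex where the angle of the reversed edge starts, one of the two
      terms of the normalisation is 0.\<close>
    moreover have "\<Gamma> u v (vtx v) = - \<alpha> u v (vtx v)" "\<Gamma> v w (vtx w) = - \<alpha> v w (vtx w)" "\<Gamma> u w (vtx w) = - \<alpha> u w (vtx w)"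
      using \<Gamma>(3)[OF e(1) ne(1), of "vtx v"] \<Gamma>(3)[OF e(2) ne(2), of "vtx w"] \<Gamma>(3)[OF e(3) ne(3), of "vtx w"]
        \<alpha>(3)[of v u] \<alpha>(3)[of w v] \<alpha>(3)[of w u] vtx_ed e ne by (auto simp: comm)
    ultimately show "\<Gamma> v w x - \<Gamma> u w x + \<Gamma> u v x = - of_int (e u v w - cobd1 b u v w)"
      using \<alpha>(3)[OF e(1) ne(1)] \<alpha>(3)[OF e(2) ne(2)] \<alpha>(3)[OF e(3) ne(3)] by linarith
  qed (use \<Gamma> in auto)
qed

end

text \<open>Writing \<open>d\<close> for the coboundary, the angles contribute
  \<open>- (e - db)\<close>, the marks \<open>(da + eps) / 4 = e + da\<close>, and the subtracted
  integers \<open>- da - db\<close>. The total is 0; this is why precisely \<open>a\<close> and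
  \<open>b\<close> are subtracted.\<close>

lemma cocycle_arith:
  fixes dvw duw duv eps avw auw auv e gvw guw guv bvw buw buv G1 G2 G3 :: real
  assumes "dvw - duw + duv = eps" "avw - auw + auv + eps = 4 * (e + (avw - auw + auv))"
    "gvw - guw + guv = - (e - (bvw - buw + buv))"
    "G1 = guv + (auv + duv) / 4 - auv - buv" "G2 = gvw + (avw + dvw) / 4 - avw - bvw"
    "G3 = guw + (auw + duw) / 4 - auw - buw"
  shows "G3 - G2 = G1"
proof -
  have d: "dvw = 4 * e + 3 * (avw - auw + auv) + duw - duv" using assms(1,2) by simp
  have g: "gvw = guw - guv - e + (bvw - buw + buv)" using assms(3) by simp
  show ?thesis unfolding assms(4-6) d g by (simp add: field_simps)
qed

section \<open>Realising the marks in the given bundle\<close>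

context euler_bundle
begin

text \<open>A fixed index set replaces the support, which jumps with \<open>x\<close>, and makes
  continuity visible.\<close>

lemma drift_eq_sum_V:
  assumes "x \<in> geom K" shows "drift u v x = (\<Sum>z\<in>V. of_int (eps u v z) * x z)"
  unfolding drift_def
proof (rule sum.mono_neutral_left)
  show "finite V" "supp x \<subseteq> V" using simplicial_complexD(1,5)[OF K] geomD(2)[OF assms] by auto
qed (auto simp: supp_def)

lemma continuous_on_mark_diff: "continuous_on (geom K) (mark_diff u v)"
proof -
  have "continuous_on (geom K) (\<lambda>x. of_int (a u v) + (\<Sum>z\<in>V. of_int (eps u v z) * x z))"
    by (intro continuous_intros continuous_on_subset[OF continuous_on_product_coordinates]) auto
  then show ?thesis
    by (rule continuous_on_eq) (simp add: mark_diff_def drift_eq_sum_V)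
qed

lemma markings:
  obtains q where
    "\<And>v. continuous_map (subtopology E {\<xi> \<in> topspace E. p \<xi> v \<noteq> 0}) euclidean (q v)"
    "\<And>\<xi>. \<xi> \<in> topspace E \<Longrightarrow> compatible (p \<xi>) (\<lambda>v. q v \<xi>)"
    "\<And>\<xi> v z. \<xi> \<in> topspace E \<Longrightarrow> v \<in> supp (p \<xi>) \<Longrightarrow> norm z = 1 \<Longrightarrow> q v (act z \<xi>) = z * q v \<xi>"
proof -
  obtain \<Gamma> where \<Gamma>: "\<And>u v. {u, v} \<in> K \<Longrightarrow> u \<noteq> v \<Longrightarrow> continuous_on (cstar K {u, v}) (\<Gamma> u v)"
    "\<And>u v x. {u, v} \<in> K \<Longrightarrow> u \<noteq> v \<Longrightarrow> x \<in> cstar K {u, v} \<Longrightarrow> ratio u v x = cis (2 * pi * \<Gamma> u v x)"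
    "\<And>u v x. {u, v} \<in> K \<Longrightarrow> u \<noteq> v \<Longrightarrow> x \<in> cstar K {u, v} \<Longrightarrow> \<Gamma> v u x = - \<Gamma> u v x"
    "\<And>u v w x. {u, v, w} \<in> K \<Longrightarrow> distinct [u, v, w] \<Longrightarrow> x \<in> cstar K {u, v, w} \<Longrightarrow>
        \<Gamma> v w x - \<Gamma> u w x + \<Gamma> u v x = - of_int (e u v w - cobd1 b u v w)"
    by (rule ratio_angles, rule that)
  \<comment> \<open>A quarter of a mark difference is its fraction of a full turn. The integers from
    \<open>a\<close> and \<open>b\<close> leave the angle unchanged and make \<open>G\<close> an
    exact cocycle.\<close>
  define G where "G u v x = (if u = v \<or> {u, v} \<notin> K then 0
      else \<Gamma> u v x + mark_diff u v x / 4 - of_int (a u v) - of_int (b u v))" for u v x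
  have G_cont: "continuous_on (cstar K {u, v}) (G u v)" for u v
  proof (cases "u = v \<or> {u, v} \<notin> K")
    case True then show ?thesis by (simp add: G_def[abs_def])
  next
    case False
    then show ?thesis
      using \<Gamma>(1)[of u v] continuous_on_subset[OF continuous_on_mark_diff cstar_subset]
      by (auto simp: G_def[abs_def] intro!: continuous_intros)
  qed
  have in_star: "x \<in> cstar K {u, v}" "{u, v} \<in> K" if "x \<in> geom K" "u \<in> supp x" "v \<in> supp x" for u v x
    using supp_union2[OF that] supp_edge[OF that] that by (auto simp: cstar_def)
  have G_anti: "G v u x = - G u v x" if x: "x \<in> geom K" "u \<in> supp x" "v \<in> supp x" for u v x
  proof (cases "u = v")
    case False
    note s = in_star[OF x] and s' = in_star[OF x(1,3,2)]
    have "b v u = - b u v" using b_alt s(2) False by (auto simp: alt1_def)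
    moreover have "mark_diff v u x = - mark_diff u v x"
      using a_anti[OF s(2) False] drift_anti[OF supp_union2[OF x] False] by (simp add: mark_diff_def)
    ultimately show ?thesis
      using \<Gamma>(3)[OF s(2) False s(1)] a_anti[OF s(2) False] s(2) s'(2) False by (simp add: G_def)
  qed (simp add: G_def)
  have G_cocycle: "G u w x - G v w x = G u v x"
    if x: "x \<in> geom K" "u \<in> supp x" "v \<in> supp x" "w \<in> supp x" for u v w x
  proof -
    consider "u = v" | "u = w" | "v = w" | "distinct [u, v, w]" by (cases "u = v"; cases "u = w"; cases "v = w") auto
    then show ?thesis
    proof cases
      case 2 then show ?thesis using G_anti[OF x(1-3)] by (simp add: G_def)
    next
      case 4
      have K3: "{u, v, w} \<in> K" by (rule face[OF geomD(2)[OF x(1)]]) (use x in auto)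
      have x3: "x \<in> cstar K {u, v, w}" using supp_union3[OF x] x by (simp add: cstar_def)
      have "drift v w x - drift u w x + drift u v x = of_int (eps u v w)"
        using drift_cocycle[OF x(1) supp_union3[OF x] 4] .
      moreover have "real_of_int (cobd1 a u v w + eps u v w) = real_of_int (4 * (e u v w + cobd1 a u v w))"
        using e_eps[OF K3 4] by simp
      moreover have "\<Gamma> v w x - \<Gamma> u w x + \<Gamma> u v x = - of_int (e u v w - cobd1 b u v w)"
        using \<Gamma>(4)[OF K3 4 x3] .
      moreover have "G y z x = \<Gamma> y z x + (of_int (a y z) + drift y z x) / 4 - of_int (a y z) - of_int (b y z)"
        if "y \<in> supp x" "z \<in> supp x" "y \<noteq> z" for y z
        using in_star(2)[OF x(1) that(1,2)] that(3) by (simp add: G_def mark_diff_def)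
      from this[OF x(2,3)] this[OF x(3,4)] this[OF x(2,4)] 4
      have "G u v x = \<Gamma> u v x + (of_int (a u v) + drift u v x) / 4 - of_int (a u v) - of_int (b u v)"
        "G v w x = \<Gamma> v w x + (of_int (a v w) + drift v w x) / 4 - of_int (a v w) - of_int (b v w)"
        "G u w x = \<Gamma> u w x + (of_int (a u w) + drift u w x) / 4 - of_int (a u w) - of_int (b u w)"
        by auto
      ultimately show ?thesis
        unfolding cobd1_def of_int_add of_int_diff of_int_mult of_int_numeral by (rule cocycle_arith)
    qed (auto simp: G_def)
  qed
  \<comment> \<open>The splitting of a Cech cocycle by a partition of unity, with the barycentric
    coordinates as the partition.\<close>
  define f where "f v x = (\<Sum>w\<in>V. x w * G v w x)" for v x
  have f_diff: "f u x - f v x = G u v x" if x: "x \<in> geom K" "u \<in> supp x" "v \<in> supp x" for u v x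
  proof -
    have V: "finite V" "supp x \<subseteq> V" using simplicial_complexD(1,5)[OF K] geomD(2)[OF x(1)] by auto
    have "f u x - f v x = (\<Sum>w\<in>V. x w * (G u w x - G v w x))"
      by (simp add: f_def sum_subtractf right_diff_distrib)
    also have "\<dots> = (\<Sum>w\<in>V. x w * G u v x)"
      using G_cocycle[OF x] by (intro sum.cong) (auto simp: supp_def)
    also have "\<dots> = G u v x" using geom_sum[OF x(1) V] by (simp add: sum_distrib_right[symmetric])
    finally show ?thesis .
  qed
  define D where "D v = {x \<in> geom K. x v \<noteq> 0}" for v
  have f_cont: "continuous_on (D v) (f v)" for v
    unfolding f_def
  proof (intro continuous_on_sum)
    fix w
    have coord: "continuous_on (D v) (\<lambda>x. x w)"
      by (rule continuous_on_subset[OF continuous_on_product_coordinates]) auto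
    \<comment> \<open>\<open>G v w\<close> is controlled only on the closed star of the edge. It is
      bounded there by compactness, and the factor \<open>x w\<close> makes the product tend to 0
      where \<open>x w\<close> does.\<close>
    have "compact (G v w ` cstar K {v, w})"
      by (rule compact_continuous_image[OF G_cont compact_cstar[OF K]])
    then have "bounded (G v w ` cstar K {v, w})" by (rule compact_imp_bounded)
    then obtain B where B: "\<And>x. x \<in> cstar K {v, w} \<Longrightarrow> \<bar>G v w x\<bar> \<le> B"
      unfolding bounded_real by blast
    let ?N = "{x \<in> topspace (top_of_set (D v)). x w \<noteq> 0}"
    have N: "?N \<subseteq> cstar K {v, w}" using in_star(1) by (auto simp: D_def supp_def)
    have "continuous_map (top_of_set (D v)) euclidean (\<lambda>x. x w * G v w x)"
    proof (rule continuous_map_dominated[where r = "\<lambda>x. x w" and B = B])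
      show "continuous_map (top_of_set (D v)) euclideanreal (\<lambda>x. x w)" using coord by simp
      have "continuous_on ?N (\<lambda>x. x w * G v w x)"
        using continuous_on_subset[OF coord, of ?N] continuous_on_subset[OF G_cont N]
        by (intro continuous_intros) auto
      moreover have "subtopology (top_of_set (D v)) ?N = top_of_set ?N"
      proof -
        have "D v \<inter> ?N = ?N" by auto
        then show ?thesis by (simp only: subtopology_subtopology)
      qed
      ultimately show "continuous_map (subtopology (top_of_set (D v)) ?N) euclidean (\<lambda>x. x w * G v w x)"
        by (simp only: continuous_map_iff_continuous)
      fix x assume x: "x \<in> topspace (top_of_set (D v))"
      show "norm (x w * G v w x) \<le> B * \<bar>x w\<bar>"
      proof (cases "x w = 0")
        case False
        then have "\<bar>G v w x\<bar> \<le> B" using B N x by blast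
        then show ?thesis using mult_right_mono[of "\<bar>G v w x\<bar>" B "\<bar>x w\<bar>"] by (simp add: abs_mult mult.commute)
      qed simp
    qed
    then show "continuous_on (D v) (\<lambda>x. x w * G v w x)" by simp
  qed
  have D_star: "D v \<subseteq> cstar K {v}" for v using in_star(1)[of _ v v] by (auto simp: D_def supp_def)
  have over_D: "{\<xi> \<in> topspace E. p \<xi> v \<noteq> 0} = over (D v)" for v using p_in by (auto simp: over_def D_def)
  define q where "q v \<xi> = (if {v} \<in> K then \<theta> v \<xi> * cis (2 * pi * f v (p \<xi>)) else 0)" for v \<xi>
  have vK: "{v} \<in> K" "\<xi> \<in> over (cstar K {v})" if "\<xi> \<in> topspace E" "v \<in> supp (p \<xi>)" for v \<xi>
    using in_star[OF p_in[OF that(1)] that(2) that(2)] that by (auto simp: over_def)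
  show thesis
  proof (rule that[of q])
    fix v
    show "continuous_map (subtopology E {\<xi> \<in> topspace E. p \<xi> v \<noteq> 0}) euclidean (q v)"
    proof (cases "{v} \<in> K")
      case True
      have "continuous_map (subtopology E (over (D v))) euclidean (\<theta> v)"
        using equivariant_onD(1)[OF equivariant_on_subset[OF \<theta>[OF True] D_star]] .
      moreover have "continuous_map (subtopology E (over (D v))) euclidean ((\<lambda>x. cis (2 * pi * f v x)) \<circ> p)"
        by (rule continuous_map_compose[OF p_over]) (auto intro!: continuous_intros f_cont)
      ultimately show ?thesis
        unfolding over_D using True by (simp add: q_def[abs_def] continuous_map_atin tendsto_mult o_def)
    qed (simp add: q_def[abs_def])
  next
    fix \<xi> assume \<xi>: "\<xi> \<in> topspace E"
    note x = p_in[OF \<xi>]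
    show "compatible (p \<xi>) (\<lambda>v. q v \<xi>)"
      unfolding compatible_def
    proof (intro conjI ballI impI)
      fix v assume v: "v \<in> supp (p \<xi>)"
      show "norm (q v \<xi>) = 1"
        using vK[OF \<xi> v] equivariant_onD(2)[OF \<theta>] by (simp add: q_def norm_mult)
    next
      fix u v assume u: "u \<in> supp (p \<xi>)" and v: "v \<in> supp (p \<xi>)" and ne: "u \<noteq> v"
      note s = in_star[OF x u v]
      have o: "\<xi> \<in> over (cstar K {u, v})" using s(1) \<xi> by (simp add: over_def)
      have "cis (2 * pi * \<Gamma> u v (p \<xi>)) = cis (2 * pi * (G u v (p \<xi>) - mark_diff u v (p \<xi>) / 4 + of_int (a u v + b u v)))"
        using s(2) ne by (simp add: G_def)
      also have "\<dots> = cis (2 * pi * (f u (p \<xi>) - f v (p \<xi>) - mark_diff u v (p \<xi>) / 4)) * cis (2 * pi * of_int (a u v + b u v))"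
        unfolding f_diff[OF x u v, symmetric] by (rule cis_2pi_add)
      \<comment> \<open>Here the integers subtracted in \<open>G\<close> disappear.\<close>
      also have "cis (2 * pi * of_int (a u v + b u v)) = 1" by (rule cis_2pi_Ints) simp
      finally have "ratio u v (p \<xi>) = cis (2 * pi * (f u (p \<xi>) - f v (p \<xi>) - mark_diff u v (p \<xi>) / 4))"
        using \<Gamma>(2)[OF s(2) ne s(1)] by simp
      then have "ratio u v (p \<xi>) * cis (2 * pi * f v (p \<xi>))
          = cis (2 * pi * (f u (p \<xi>) - f v (p \<xi>) - mark_diff u v (p \<xi>) / 4 + f v (p \<xi>)))"
        by (simp only: cis_2pi_add)
      also have "f u (p \<xi>) - f v (p \<xi>) - mark_diff u v (p \<xi>) / 4 + f v (p \<xi>) = f u (p \<xi>) + - mark_diff u v (p \<xi>) / 4"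
        by simp
      finally have r: "ratio u v (p \<xi>) * cis (2 * pi * f v (p \<xi>)) = cis (2 * pi * f u (p \<xi>)) * qcis (- mark_diff u v (p \<xi>))"
        by (simp only: cis_2pi_add qcis_eq_cis_2pi)
      have "q v \<xi> = \<theta> u \<xi> * (ratio u v (p \<xi>) * cis (2 * pi * f v (p \<xi>)))"
        using vK(1)[OF \<xi> v] ratio(3)[OF s(2) o] by (simp add: q_def)
      also have "\<dots> = q u \<xi> * qcis (- mark_diff u v (p \<xi>))"
        unfolding r using vK(1)[OF \<xi> u] by (simp add: q_def)
      finally show "q v \<xi> = q u \<xi> * qcis (- mark_diff u v (p \<xi>))" .
    qed
  next
    fix \<xi> v z assume \<xi>: "\<xi> \<in> topspace E" and v: "v \<in> supp (p \<xi>)" and z: "norm (z::complex) = 1"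
    show "q v (act z \<xi>) = z * q v \<xi>"
      using equivariant_onD(3)[OF \<theta> vK(2)[OF \<xi> v] z] vK(1)[OF \<xi> v] p_act[OF \<xi> z] by (simp add: q_def)
  qed
qed

end

section \<open>The triangulation\<close>

lemma continuous_on_weight: "continuous_on (sphere 0 1 \<times> UNIV) (\<lambda>(q, x). weight i q x)"
proof -
  have "- 1 \<le> Re (unit_sign (snd i) * q) \<and> Re (unit_sign (snd i) * q) \<le> 1"
    "- 1 \<le> Im (unit_sign (snd i) * q) \<and> Im (unit_sign (snd i) * q) \<le> 1" if "norm q = 1" for q
    using abs_Re_le_cmod[of "unit_sign (snd i) * q"] abs_Im_le_cmod[of "unit_sign (snd i) * q"] that
    unfolding norm_mult abs_le_iff by auto
  then show ?thesis
    unfolding weight_def case_prod_unfold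
    by (cases "fst i") (auto intro!: continuous_intros continuous_on_arccos' continuous_on_arcsin'
        simp del: times_complex.sel)
qed

context euler_bundle
begin

theorem triangulation: "classical_triangulation K E p"
proof -
  obtain q where q_cont: "\<And>v. continuous_map (subtopology E {\<xi> \<in> topspace E. p \<xi> v \<noteq> 0}) euclidean (q v)"
    and q: "\<And>\<xi>. \<xi> \<in> topspace E \<Longrightarrow> compatible (p \<xi>) (\<lambda>v. q v \<xi>)"
    and q_act: "\<And>\<xi> v z. \<xi> \<in> topspace E \<Longrightarrow> v \<in> supp (p \<xi>) \<Longrightarrow> norm z = 1 \<Longrightarrow> q v (act z \<xi>) = z * q v \<xi>"
    by (rule markings, rule that)
  have V: "finite V" using simplicial_complexD(1)[OF K] .
  have VK: "{v} \<in> K" if "v \<in> V" for v using K that unfolding simplicial_complex_def by blast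
  have supp_V: "supp x \<subseteq> V" if "x \<in> geom K" for x using simplicial_complexD(5)[OF K geomD(2)[OF that]] .
  \<comment> \<open>Where the coordinate of \<open>v\<close> vanishes, \<open>q v\<close> carries no
    information; 0 is the continuous continuation because a weight never exceeds the
    coordinate.\<close>
  define val where "val v i \<xi> = (if p \<xi> v = 0 then 0 else weight i (q v \<xi>) (p \<xi> v))" for v i \<xi>
  have qn: "norm (q v \<xi>) = 1" if "\<xi> \<in> topspace E" "p \<xi> v \<noteq> 0" for v \<xi>
    using compatibleD(1)[OF q[OF that(1)]] that(2) by (simp add: supp_def)
  have val: "0 \<le> val v i \<xi>" "val v i \<xi> \<le> p \<xi> v" "(\<Sum>i\<in>UNIV. val v i \<xi>) = p \<xi> v" if \<xi>: "\<xi> \<in> topspace E" for v i \<xi>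
    using weight_nonneg[OF qn[OF \<xi>]] weight_le[OF qn[OF \<xi>]] weight_sum[OF qn[OF \<xi>]] geomD(1,6)[OF p_in[OF \<xi>]]
    by (cases "p \<xi> v = 0"; simp add: val_def)+
  have val_cont: "continuous_map E euclideanreal (val v i)" for v i
  proof (rule continuous_map_dominated[OF p_coord_continuous, where B = 1])
    let ?N = "{\<xi> \<in> topspace E. p \<xi> v \<noteq> 0}"
    have "continuous_map (subtopology E ?N) (prod_topology (top_of_set (sphere 0 1)) euclideanreal) (\<lambda>\<xi>. (q v \<xi>, p \<xi> v))"
      by (intro continuous_map_pairedI continuous_map_into_subtopology q_cont
          continuous_map_from_subtopology[OF p_coord_continuous]) (use qn in auto)
    moreover have "prod_topology (top_of_set (sphere (0::complex) 1)) euclideanreal = top_of_set (sphere 0 1 \<times> UNIV)"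
      using prod_topology_subtopology_eu[of "sphere (0::complex) 1" "UNIV :: real set"] by simp
    ultimately have "continuous_map (subtopology E ?N) euclideanreal ((\<lambda>(q, x). weight i q x) \<circ> (\<lambda>\<xi>. (q v \<xi>, p \<xi> v)))"
      by (intro continuous_map_compose[where X' = "top_of_set (sphere 0 1 \<times> UNIV)"]) (auto simp: continuous_on_weight)
    then show "continuous_map (subtopology E ?N) euclideanreal (val v i)"
      by (rule continuous_map_eq) (auto simp: val_def)
    show "norm (val v i \<xi>) \<le> 1 * \<bar>p \<xi> v\<bar>" if "\<xi> \<in> topspace E" for \<xi> using val(1,2)[OF that, of v i] by simp
  qed
  \<comment> \<open>The vertices of a classical triangulation are natural numbers, so the four
    copies of each vertex are numbered.\<close>
  obtain \<iota> :: "'v \<times> bool \<times> bool \<Rightarrow> nat" where \<iota>: "inj_on \<iota> (V \<times> UNIV)"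
    using finite_imp_inj_to_nat_seg[of "V \<times> (UNIV :: (bool \<times> bool) set)"] V by auto
  define W where "W = \<iota> ` (V \<times> UNIV)"
  define dec where "dec = inv_into (V \<times> UNIV) \<iota>"
  have dec: "dec (\<iota> (v, i)) = (v, i)" if "v \<in> V" for v i
    unfolding dec_def using that by (intro inv_into_f_f[OF \<iota>]) auto
  define f where "f w = fst (dec w)" for w
  define g where "g \<xi> w = (if w \<in> W then val (fst (dec w)) (snd (dec w)) \<xi> else 0)" for \<xi> w
  have \<iota>W: "\<iota> (v, i) \<in> W" if "v \<in> V" for v i using that by (auto simp: W_def)
  have finW: "finite W" using V by (simp add: W_def)
  have g: "g \<xi> (\<iota> (v, i)) = val v i \<xi>" if "v \<in> V" for v i \<xi> using dec[OF that] \<iota>W[OF that] by (simp add: g_def)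
  have WE: "\<exists>v i. v \<in> V \<and> w = \<iota> (v, i)" if "w \<in> W" for w using that by (auto simp: W_def)
  have fibre_sum: "(\<Sum>w\<in>{w \<in> W. f w = v}. y w) = (\<Sum>i\<in>UNIV. y (\<iota> (v, i)))" if "v \<in> V" for v and y :: "nat \<Rightarrow> real"
  proof -
    have "{w \<in> W. f w = v} = (\<lambda>i. \<iota> (v, i)) ` UNIV"
      using dec that by (auto simp: W_def f_def)
    moreover have "inj (\<lambda>i. \<iota> (v, i))" using \<iota> that by (auto simp: inj_on_def)
    ultimately show ?thesis by (simp add: sum.reindex)
  qed
  have total_sum: "(\<Sum>w\<in>W. y w) = (\<Sum>v\<in>V. \<Sum>i\<in>UNIV. y (\<iota> (v, i)))" for y :: "nat \<Rightarrow> real"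
    unfolding W_def by (subst sum.reindex[OF \<iota>]) (simp add: sum.cartesian_product)
  have suppW: "supp (g \<xi>) \<subseteq> W" for \<xi> by (auto simp: supp_def g_def)
  have proj: "(\<lambda>v. \<Sum>w\<in>{w \<in> W. f w = v}. g \<xi> w) = p \<xi>" if \<xi>: "\<xi> \<in> topspace E" for \<xi>
  proof
    fix v
    show "(\<Sum>w\<in>{w \<in> W. f w = v}. g \<xi> w) = p \<xi> v"
    proof (cases "v \<in> V")
      case True
      then show ?thesis using fibre_sum[OF True] g[OF True] val(3)[OF \<xi>] by simp
    next
      case False
      then have "{w \<in> W. f w = v} = {}" using dec by (auto simp: W_def f_def)
      moreover have "p \<xi> v = 0" using supp_V[OF p_in[OF \<xi>]] False by (auto simp: supp_def)
      ultimately show ?thesis by (simp only: sum.empty)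
    qed
  qed
  have g_sum: "sum (g \<xi>) (supp (g \<xi>)) = 1" if \<xi>: "\<xi> \<in> topspace E" for \<xi>
  proof -
    have "sum (g \<xi>) (supp (g \<xi>)) = (\<Sum>v\<in>V. p \<xi> v)"
      using sum_supp[OF finW suppW] total_sum[of "g \<xi>"] g val(3)[OF \<xi>] by simp
    then show ?thesis using geom_sum[OF p_in[OF \<xi>] V supp_V[OF p_in[OF \<xi>]]] by simp
  qed
  have g_nonneg: "0 \<le> g \<xi> w" if "\<xi> \<in> topspace E" for \<xi> w using val(1)[OF that] by (simp add: g_def)
  have g_supp: "f w \<in> supp (p \<xi>)" "w \<in> W" if "w \<in> supp (g \<xi>)" for w \<xi>
    using that by (auto simp: supp_def g_def f_def val_def split: if_splits)
  define L where "L = {\<tau>. \<tau> \<noteq> {} \<and> (\<exists>\<xi>\<in>topspace E. \<tau> \<subseteq> supp (g \<xi>))}"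
  have g_geom: "g \<xi> \<in> geom L" if \<xi>: "\<xi> \<in> topspace E" for \<xi>
  proof -
    have "supp (g \<xi>) \<noteq> {}" using g_sum[OF \<xi>] by auto
    then show ?thesis using g_nonneg[OF \<xi>] g_sum[OF \<xi>] \<xi> by (auto simp: geom_supp L_def)
  qed
  have complex_L: "simplicial_complex W L"
  proof -
    have "{w} \<in> L" if w: "w \<in> W" for w
    proof -
      obtain v i where vi: "v \<in> V" "w = \<iota> (v, i)" using WE[OF w] by blast
      obtain \<xi> where \<xi>: "\<xi> \<in> topspace E" "p \<xi> = vtx v"
        using fibre_nonempty vtx_in_geom[OF VK[OF vi(1)]] by blast
      have pv: "p \<xi> v = 1" by (simp add: \<xi>(2) vtx_def)
      obtain k s where i: "i = (k, s)" by (cases i)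
      \<comment> \<open>Over the vertex \<open>v\<close> itself the centre sits at 0 and the gap
        shrinks to the single position 1; at these places the corresponding vertex has full
        weight.\<close>
      define c where "c = unit_sign s * qcis (if k then 0 else 1)"
      define z where "z = c / q v \<xi>"
      have n: "norm (q v \<xi>) = 1" using qn[OF \<xi>(1)] pv by simp
      have z: "norm z = 1" "z * q v \<xi> = c" using n by (auto simp: z_def c_def norm_divide norm_mult)
      have "weight i c 1 = 1"
        using weight_peak_values(1)[of 0 1 s] weight_flat_values(2)[of 1 1 s] by (simp add: i c_def)
      moreover have "q v (act z \<xi>) = c" using q_act[OF \<xi>(1) _ z(1)] pv z(2) by (simp add: supp_def)
      ultimately have "g (act z \<xi>) w \<noteq> 0"
        using g[OF vi(1)] vi(2) p_act[OF \<xi>(1) z(1)] pv by (simp add: val_def)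
      then show ?thesis using act_in[OF \<xi>(1) z(1)] by (auto simp: L_def supp_def)
    qed
    moreover have "\<sigma> \<noteq> {} \<and> \<sigma> \<subseteq> W" if "\<sigma> \<in> L" for \<sigma> using that suppW by (auto simp: L_def)
    moreover have "\<tau> \<in> L" if "\<sigma> \<in> L" "\<tau> \<noteq> {}" "\<tau> \<subseteq> \<sigma>" for \<sigma> \<tau>
      using that unfolding L_def by blast
    ultimately show ?thesis using finW unfolding simplicial_complex_def by blast
  qed
  have f_L: "f ` \<sigma> \<in> K" if \<sigma>: "\<sigma> \<in> L" for \<sigma>
  proof -
    obtain \<xi> where \<xi>: "\<xi> \<in> topspace E" "\<sigma> \<subseteq> supp (g \<xi>)" "\<sigma> \<noteq> {}" using \<sigma> by (auto simp: L_def)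
    then have "f ` \<sigma> \<subseteq> supp (p \<xi>)" using g_supp(1) by blast
    then show ?thesis using face[OF geomD(2)[OF p_in[OF \<xi>(1)]]] \<xi>(3) by simp
  qed
  have inj: "inj_on g (topspace E)"
  proof (rule inj_onI)
    fix \<xi> \<eta> assume \<xi>: "\<xi> \<in> topspace E" and \<eta>: "\<eta> \<in> topspace E" and eq: "g \<xi> = g \<eta>"
    have peq: "p \<xi> = p \<eta>" using proj[OF \<xi>] proj[OF \<eta>] eq by metis
    obtain z where z: "norm z = 1" "\<eta> = act z \<xi>" using fibre_transitive[OF \<xi> \<eta> peq] .
    have "z = 1"
    proof (rule fibre_injective[OF p_in[OF \<xi>] q[OF \<xi>] z(1)])
      fix v i assume v: "v \<in> supp (p \<xi>)"
      have "v \<in> V" using supp_V[OF p_in[OF \<xi>]] v by blast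
      then have "val v i \<eta> = val v i \<xi>" using g[of v \<xi> i] g[of v \<eta> i] eq by simp
      moreover have "p \<xi> v \<noteq> 0" using v by (simp add: supp_def)
      ultimately show "weight i (z * q v \<xi>) (p \<xi> v) = weight i (q v \<xi>) (p \<xi> v)"
        using q_act[OF \<xi> v z(1)] z(2) peq by (simp add: val_def)
    qed
    then show "\<xi> = \<eta>" using z(2) act_1[OF \<xi>] by simp
  qed
  have surj: "y \<in> g ` topspace E" if y: "y \<in> geom L" for y
  proof -
    have y0: "\<And>w. 0 \<le> y w" "supp y \<in> L" "sum y (supp y) = 1" using y by (auto simp: geom_supp)
    \<comment> \<open>A point of the bundle whose support contains that of \<open>y\<close>; it is
      the model from which signs and odd parts are taken to fill the simplex.\<close>
    obtain \<xi>0 where \<xi>0: "\<xi>0 \<in> topspace E" "supp y \<subseteq> supp (g \<xi>0)" using y0(2) by (auto simp: L_def)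
    have yW: "supp y \<subseteq> W" using \<xi>0(2) suppW by blast
    define Y where "Y v i = (if v \<in> V then y (\<iota> (v, i)) else 0)" for v i
    define x where "x v = (\<Sum>i\<in>UNIV. Y v i)" for v
    have Y0: "0 \<le> Y v i" for v i using y0(1) by (simp add: Y_def)
    have Yval: "val v i \<xi>0 \<noteq> 0" if "Y v i \<noteq> 0" for v i
    proof -
      have v: "v \<in> V" "\<iota> (v, i) \<in> supp y" using that by (auto simp: Y_def supp_def split: if_splits)
      then show ?thesis using \<xi>0(2) g[OF v(1), of \<xi>0 i] by (auto simp: supp_def)
    qed
    have sub: "supp x \<subseteq> supp (p \<xi>0)"
    proof
      fix v assume "v \<in> supp x"
      then have "sum (Y v) UNIV \<noteq> 0" by (simp add: supp_def x_def)
      then obtain i where "Y v i \<noteq> 0" by (rule sum.not_neutral_contains_not_neutral)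
      then have "val v i \<xi>0 \<noteq> 0" by (rule Yval)
      then show "v \<in> supp (p \<xi>0)" by (auto simp: val_def supp_def)
    qed
    have "sum x (supp x) = 1"
    proof -
      have "supp x \<subseteq> V" using sub supp_V[OF p_in[OF \<xi>0(1)]] by blast
      then have "sum x (supp x) = sum x V" using V by (rule sum_supp[rotated])
      also have "\<dots> = sum y W" unfolding total_sum by (simp add: x_def Y_def)
      also have "\<dots> = 1" using sum_supp[OF finW yW] y0(3) by simp
      finally show ?thesis .
    qed
    moreover from this have "supp x \<noteq> {}" by auto
    ultimately have x: "x \<in> geom K"
      using face[OF geomD(2)[OF p_in[OF \<xi>0(1)]] sub] Y0 by (auto simp: geom_supp x_def intro!: sum_nonneg)
    obtain \<xi>1 where \<xi>1: "\<xi>1 \<in> topspace E" "p \<xi>1 = x" using fibre_nonempty[OF x] by blast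
    have q1: "compatible x (\<lambda>v. q v \<xi>1)" using q[OF \<xi>1(1)] \<xi>1(2) by simp
    obtain z where z: "norm z = 1" "\<And>v i. v \<in> supp x \<Longrightarrow> weight i (z * q v \<xi>1) (x v) = Y v i"
    proof (rule fibre_surjective[OF p_in[OF \<xi>0(1)] q[OF \<xi>0(1)] x sub q1, of Y])
      show "weight i (q v \<xi>0) (p \<xi>0 v) \<noteq> 0" if "Y v i \<noteq> 0" for v i
        using Yval[OF that] by (auto simp: val_def split: if_splits)
    qed (use Y0 in \<open>auto simp: x_def\<close>)
    have "g (act z \<xi>1) w = y w" for w
    proof (cases "w \<in> W")
      case True
      obtain v i where vi: "v \<in> V" "w = \<iota> (v, i)" using WE[OF True] by blast
      have "val v i (act z \<xi>1) = Y v i"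
      proof (cases "x v = 0")
        case True
        then have "Y v i = 0" using Y0 unfolding x_def by (intro sum_nonneg_0[of UNIV "Y v" i]) auto
        then show ?thesis using True p_act[OF \<xi>1(1) z(1)] \<xi>1(2) by (simp add: val_def)
      next
        case False
        then have "v \<in> supp x" by (simp add: supp_def)
        then show ?thesis
          using False z(2)[of v i] q_act[OF \<xi>1(1) _ z(1), of v] p_act[OF \<xi>1(1) z(1)] \<xi>1(2) by (simp add: val_def)
      qed
      then show ?thesis using g[OF vi(1)] vi by (simp add: Y_def)
    next
      case False
      then show ?thesis using yW by (auto simp: g_def supp_def)
    qed
    then have "g (act z \<xi>1) = y" by blast
    then show ?thesis using act_in[OF \<xi>1(1) z(1)] by blast
  qed
  have g_cont: "continuous_map E (top_of_set (geom L)) g"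
  proof -
    have "continuous_map E euclideanreal (\<lambda>\<xi>. g \<xi> w)" for w
      using val_cont by (cases "w \<in> W") (simp_all add: g_def)
    then have "continuous_map E (product_topology (\<lambda>_. euclideanreal) UNIV) g"
      by (simp add: continuous_map_componentwise_UNIV)
    then show ?thesis using g_geom by (auto simp: euclidean_product_topology continuous_map_in_subtopology)
  qed
  have "homeomorphic_map E (top_of_set (geom L)) g"
    by (rule continuous_imp_homeomorphic_map[OF g_cont compact_total Hausdorff_base _ inj])
      (use g_geom surj in auto)
  then obtain h where h: "homeomorphic_maps E (top_of_set (geom L)) g h"
    using homeomorphic_map_maps by blast
  then have "homeomorphic_map (top_of_set (geom L)) E h"
    using homeomorphic_map_maps homeomorphic_maps_sym by blast
  moreover have "p (h x) = (\<lambda>v. \<Sum>w\<in>{w \<in> W. f w = v}. x w)" if x: "x \<in> geom L" for x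
  proof -
    have "h x \<in> topspace E" "g (h x) = x"
      using h x by (auto simp: homeomorphic_maps_def continuous_map_def)
    then show ?thesis using proj[of "h x"] by simp
  qed
  ultimately show ?thesis
    unfolding classical_triangulation_def using complex_L f_L by blast
qed

end

text \<open>The bound holds because \<open>4 e + 3 da\<close> is four times a value of
  \<open>FF\<close>, the cocycle identity because \<open>e\<close> is closed and \<open>da\<close>
  is exact. Putting 0 off the nondegenerate simplices makes \<open>eps_deg\<close>
  unconditional.\<close>

lemma cyclic_system_from_cocycle:
  fixes K :: "'v set set" and a :: "'v \<Rightarrow> 'v \<Rightarrow> int" and e :: "'v \<Rightarrow> 'v \<Rightarrow> 'v \<Rightarrow> int"
  assumes K: "simplicial_complex V K" and e: "cocycle2 K e"
    and a: "\<And>u v. {u, v} \<in> K \<Longrightarrow> u \<noteq> v \<Longrightarrow> a v u = - a u v \<and> a u v \<in> {-1, 1}"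
    and eG: "\<And>u v w. {u, v, w} \<in> K \<Longrightarrow> distinct [u, v, w] \<Longrightarrow> of_int (e u v w) = GG a u v w"
  shows "cyclic_system K a (\<lambda>u v w. if distinct [u, v, w] \<and> {u, v, w} \<in> K then 4 * e u v w + 3 * cobd1 a u v w else 0)"
    (is "cyclic_system K a ?eps")
proof
  note face = simplicial_complexD(6)[OF K]
  show "\<sigma> \<in> K \<Longrightarrow> \<tau> \<subseteq> \<sigma> \<Longrightarrow> \<tau> \<noteq> {} \<Longrightarrow> \<tau> \<in> K" for \<sigma> \<tau> using face by blast
  show "\<sigma> \<in> K \<Longrightarrow> finite \<sigma>" for \<sigma> using simplicial_complexD(3)[OF K] by blast
  show "{u, v} \<in> K \<Longrightarrow> u \<noteq> v \<Longrightarrow> a v u = - a u v" for u v using a by blast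
  show "{u, v} \<in> K \<Longrightarrow> u \<noteq> v \<Longrightarrow> a u v = 1 \<or> a u v = - 1" for u v using a by blast
  show "\<bar>?eps u v w\<bar> \<le> 1" if "{u, v, w} \<in> K" for u v w
  proof (cases "distinct [u, v, w]")
    case True
    have "real_of_int (4 * e u v w + 3 * cobd1 a u v w) = 4 * FF (cobd1 a u v w)"
      using eG[OF that True] by (simp add: GG_def)
    moreover have "\<bar>4 * FF (cobd1 a u v w)\<bar> \<le> 1" by (simp add: FF_def)
    ultimately have "\<bar>4 * e u v w + 3 * cobd1 a u v w\<bar> \<le> 1" by linarith
    then show ?thesis using True that by simp
  next
    case False
    then show ?thesis by auto
  qed
  show "?eps u v u = 0" "?eps u v v = 0" for u v by auto
  have alt: "e v u w = - e u v w" "e u w v = - e u v w" if "{u, v, w} \<in> K" "distinct [u, v, w]" for u v w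
    using e that by (auto simp: cocycle2_def alt2_def)
  have perm: "{v, u, w} = {u, v, w}" "{u, w, v} = {u, v, w}" "{v, w, u} = {u, v, w}" for u v w :: 'v by auto
  have sw1: "?eps v u w = - ?eps u v w" if "{u, v, w} \<in> K" "distinct [u, v, w]" for u v w
  proof -
    have "{u, v} \<in> K" by (rule face[OF that(1)]) auto
    then have "a v u = - a u v" using a that(2) by auto
    then show ?thesis using alt(1)[OF that] that by (auto simp: cobd1_def perm)
  qed
  have sw2: "?eps u w v = - ?eps u v w" if "{u, v, w} \<in> K" "distinct [u, v, w]" for u v w
  proof -
    have "{v, w} \<in> K" by (rule face[OF that(1)]) auto
    then have "a w v = - a v w" using a that(2) by auto
    then show ?thesis using alt(2)[OF that] that by (auto simp: cobd1_def perm)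
  qed
  show "?eps v u w = - ?eps u v w" if "{u, v, w} \<in> K" "u \<noteq> v" for u v w
  proof (cases "distinct [u, v, w]")
    case True then show ?thesis using sw1[OF that(1)] by blast
  qed auto
  show "?eps v w z - ?eps u w z + ?eps u v z = ?eps u v w" if K4: "{u, v, w, z} \<in> K" and d: "distinct [u, v, w]" for u v w z
  proof -
    have K3: "{u, v, w} \<in> K" by (rule face[OF K4]) auto
    \<comment> \<open>For \<open>z\<close> among the three vertices the identity amounts to
      alternation and vanishing on repeated vertices; closedness of \<open>e\<close> enters for four
      distinct ones.\<close>
    consider "z = u" | "z = v" | "z = w" | "distinct [u, v, w, z]" using d by auto
    then show ?thesis
    proof cases
      case 1
      have "?eps v w u = - ?eps v u w" using sw2[of v u w] K3 d by (auto simp: perm)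
      moreover have "?eps u w u = 0" "?eps u v u = 0" by auto
      ultimately show ?thesis using sw1[OF K3 d] unfolding 1 by linarith
    next
      case 2
      moreover have "?eps v w v = 0" "?eps u v v = 0" by auto
      ultimately show ?thesis using sw2[OF K3 d] by (simp only:)
    next
      case 3 then show ?thesis by simp
    next
      case 4
      have "{v, w, z} \<in> K" "{u, w, z} \<in> K" "{u, v, z} \<in> K" using face[OF K4] by auto
      moreover have "cobd2 e u v w z = 0" using e K4 4 by (auto simp: cocycle2_def)
      ultimately show ?thesis using 4 K3 by (simp add: cobd2_def cobd1_def)
    qed
  qed
qed

theorem mainTheorem6:
  fixes V :: "'v set" and K :: "'v set set"
    and E :: "'e topology" and p :: "'e \<Rightarrow> 'v \<Rightarrow> real" and act :: "complex \<Rightarrow> 'e \<Rightarrow> 'e"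
  assumes "simplicial_complex V K"
    and "circle_bundle E p act (geom K)"
    and "no_2torsion_H2 K"
    and "\<exists>e a. cocycle2 K e
           \<and> (\<forall>u v w. {u, v, w} \<in> K \<and> distinct [u, v, w] \<longrightarrow> e u v w \<in> {-2, -1, 1, 2})
           \<and> represents_euler K E p act e
           \<and> (\<forall>u v. {u, v} \<in> K \<and> u \<noteq> v \<longrightarrow> a v u = - a u v \<and> a u v \<in> {-1, 1})
           \<and> (\<forall>u v w. {u, v, w} \<in> K \<and> distinct [u, v, w] \<longrightarrow> of_int (e u v w) = GG a u v w)"
  shows "classical_triangulation K E p"
proof -
  from assms(4) obtain e a where e: "cocycle2 K e" and eu: "represents_euler K E p act e"
    and a: "\<forall>u v. {u, v} \<in> K \<and> u \<noteq> v \<longrightarrow> a v u = - a u v \<and> a u v \<in> {-1, 1}"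
    and eG: "\<forall>u v w. {u, v, w} \<in> K \<and> distinct [u, v, w] \<longrightarrow> of_int (e u v w) = GG a u v w"
    by (elim exE conjE) (rule that)
  from eu obtain s b where s: "continuous_map (top_of_set (geom (skel1 K))) E s" "\<forall>x\<in>geom (skel1 K). p (s x) = x"
    and b: "alt1 K b"
    and w: "\<forall>u v w. {u, v, w} \<in> K \<and> distinct [u, v, w] \<longrightarrow>
            (\<forall>\<phi>. local_triv E p act (geom (faces {u, v, w})) \<phi> \<longrightarrow>
               complex_of_int (e u v w - cobd1 b u v w)
                 = winding_number (\<lambda>t. snd (\<phi> (s (bdry u v w t)))) 0)"
    unfolding represents_euler_def by (elim exE conjE) (rule that)
  interpret bundle_over_complex V K E p act
    using assms(1,2) by (rule bundle_over_complex.intro)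
  obtain \<theta> where \<theta>: "\<And>v. {v} \<in> K \<Longrightarrow> equivariant_on (cstar K {v}) (\<theta> v)" "\<And>v. {v} \<in> K \<Longrightarrow> \<theta> v (s (vtx v)) = 1"
    by (rule normalised_trivialisations[OF s(1) bspec[OF s(2)]], assumption, rule that)
  interpret cyclic_system K a "\<lambda>u v w. if distinct [u, v, w] \<and> {u, v, w} \<in> K then 4 * e u v w + 3 * cobd1 a u v w else 0"
    by (rule cyclic_system_from_cocycle[OF assms(1) e]) (use a eG in blast)+
  \<comment> \<open>With this choice of \<open>eps\<close> the relation \<open>e_eps\<close> is the
    numerical identity \<open>da + (4 e + 3 da) = 4 (e + da)\<close>.\<close>
  interpret euler_bundle V K E p act a
    "\<lambda>u v w. if distinct [u, v, w] \<and> {u, v, w} \<in> K then 4 * e u v w + 3 * cobd1 a u v w else 0" e b s \<theta>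
    by unfold_locales (simp, rule s(1), erule bspec[OF s(2)], rule b, rule w[rule_format], erule (1) conjI,
        assumption, erule \<theta>(1), erule \<theta>(2))
  show ?thesis by (rule triangulation)
qed

end
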